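(* Let $X$ be a compact metric space, $\varepsilon>0$, and $c\in C(X\times X;[0,\infty))$ symmetric such that $k_c=\exp(-c/\varepsilon)$ is a positive definite universal kernel. Let $(\mu_t)_t$ be a path in $\mathcal{P}(X)$ such that the associated path $(\beta_t)_t=(B(\mu_t))_t$ is weakly differentiable in $\mathcal{H}_c$ at $t=0$. Write $\mu=\mu_0$, $\beta=\beta_0$, $\dot\beta=\dot\beta_0$. Then $\langle\dot\beta,\beta\rangle_{\mathcal{H}_c}=0$, the path $(\mu_t)_t$ is weakly differentiable in $\mathcal{H}_\mu^*$ at $t=0$ (with derivative denoted $\dot\mu$), and $$\mathbf{g}_\mu(\dot\mu,\dot\mu)=\tilde{\mathbf{g}}_\mu(\dot\beta,\dot\beta).$$
   Context: $\mathcal{P}(X)$: Radon probability measures. A kernel is universal if its reproducing kernel Hilbert space (RKHS) is dense in $C(X)$. For $\mu\in\mathcal{P}(X)$, $f_{\mu,\mu}\in C(X)$ is the unique function with $\int_X\exp\left(\frac1\varepsilon(f_{\mu,\mu}(x)+f_{\mu,\mu}(y)-c(x,y))\right)d\mu(x)=1$ for all $y\in X$; $a_\mu=\exp(f_{\mu,\mu}/\varepsilon)$; $k_\mu(x,y)=a_\mu(x)a_\mu(y)k_c(x,y)$. $\mathcal{H}_c,\mathcal{H}_\mu$ are the RKHS of $k_c,k_\mu$. $B(\mu)=\int_X a_\mu(x)k_c(x,\cdot)\,d\mu(x)=\exp(-f_{\mu,\mu}/\varepsilon)\in\mathcal{H}_c$. $K_\mu[\phi](y)=\int_X\phi(x)k_\mu(x,y)\,d\mu(x)$;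 $H_\mu[\sigma](y)=\langle\sigma,k_\mu(\cdot,y)\rangle$ is the Riesz isometry $\mathcal{H}_\mu^*\to\mathcal{H}_\mu$. $\mathcal{H}_{\mu,0}^*=\{\sigma\in\mathcal{H}_\mu^*:\langle\sigma,1_X\rangle=0\}$ is the dual of $\mathcal{H}_\mu/\mathbb{R}$ (quotient by constants). $K_\mu$ fixes constants; $\mathrm{id}-K_\mu^2$ is boundedly invertible on $\mathcal{H}_\mu/\mathbb{R}$ and $\mathrm{id}-K_\mu$ is boundedly invertible on $L^2(X,\mu)/\mathbb{R}$. Metric tensors: for $\dot\mu\in\mathcal{H}_{\mu,0}^*$, $\mathbf{g}_\mu(\dot\mu,\dot\mu)=\frac\varepsilon2\langle\dot\mu,(\mathrm{id}-K_\mu^2)^{-1}H_\mu[\dot\mu]\rangle$. For $\dot\beta\in\mathcal{H}_c$ with $\langle B(\mu),\dot\beta\rangle_{\mathcal{H}_c}=0$ (equivalently $\int a_\mu\dot\beta\,d\mu=0$), $$\tilde{\mathbf{g}}_\mu(\dot\beta,\dot\beta)=\frac\varepsilon2\left(\|\dot\beta\|_{\mathcal{H}_c}^2+2\left\langle a_\mu\dot\beta,(\mathrm{id}-K_\mu)^{-1}[a_\mu\dot\beta]\right\rangle_{L^2(X,\mu)}\right).$$ Differentiability: a path $(x_s)_{s\in I}$, $I\subset\mathbb{R}$, in a topological vector space is differentiable at $t\in I$ (for that topology) when $t$ is an accumulation point of $I$ and $(x_s-x_t)/(s-t)$ converges to some $\dot x_t$ as $s\to t$; "weakly" refers to the weak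 topology. Measures are viewed as elements of $\mathcal{H}_\mu^*$ by integration. *)

theory Defs
  imports "HOL-Analysis.Analysis" "HOL-Probability.Probability_Measure"
begin

text \<open>
  The compact metric space $X$ is a type of class \<^class>\<open>metric_space\<close> whose \<^term>\<open>UNIV\<close> is compact.
  All vector spaces below (an RKHS, its topological dual, the dual of that) are sets of real-valued
  functions on some type, with the pointwise operations.
\<close>

section \<open>Normed spaces of functions, duals, weak derivatives\<close>

definition fun_subspace :: "('b \<Rightarrow> real) set \<Rightarrow> bool" where
  "fun_subspace V \<longleftrightarrow>
     (\<lambda>_. 0) \<in> V \<and>
     (\<forall>f\<in>V. \<forall>g\<in>V. (\<lambda>b. f b + g b) \<in> V) \<and>
     (\<forall>r. \<forall>f\<in>V. (\<lambda>b. r * f b) \<in> V)"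

text \<open>Functionals on \<^term>\<open>V\<close> are totalised by 0 outside \<^term>\<open>V\<close>, so that two of them are equal
  as soon as they agree on \<^term>\<open>V\<close>.\<close>

definition dual :: "('b \<Rightarrow> real) set \<Rightarrow> (('b \<Rightarrow> real) \<Rightarrow> real) \<Rightarrow> (('b \<Rightarrow> real) \<Rightarrow> real) set" where
  "dual V nrm = {\<sigma>.
     (\<forall>f\<in>V. \<forall>g\<in>V. \<sigma> (\<lambda>b. f b + g b) = \<sigma> f + \<sigma> g) \<and>
     (\<forall>r. \<forall>f\<in>V. \<sigma> (\<lambda>b. r * f b) = r * \<sigma> f) \<and>
     (\<exists>C. \<forall>f\<in>V. \<bar>\<sigma> f\<bar> \<le> C * nrm f) \<and>
     (\<forall>f. f \<notin> V \<longrightarrow> \<sigma> f = 0)}"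

definition dual_norm :: "('b \<Rightarrow> real) set \<Rightarrow> (('b \<Rightarrow> real) \<Rightarrow> real) \<Rightarrow> (('b \<Rightarrow> real) \<Rightarrow> real) \<Rightarrow> real" where
  "dual_norm V nrm \<sigma> = (SUP f\<in>{f\<in>V. nrm f \<le> 1}. \<bar>\<sigma> f\<bar>)"

text \<open>The path \<open>(x s)\<close>, \<open>s \<in> I\<close>, in the normed space \<open>(V, nrm)\<close> has derivative \<open>x'\<close> at \<open>t\<close> for the
  weak topology, i.e. the difference quotients converge when tested against the dual of \<open>V\<close>.\<close>

definition has_weak_derivative ::
  "('b \<Rightarrow> real) set \<Rightarrow> (('b \<Rightarrow> real) \<Rightarrow> real) \<Rightarrow> real set \<Rightarrow> (real \<Rightarrow> 'b \<Rightarrow> real) \<Rightarrow> real \<Rightarrow> ('b \<Rightarrow> real) \<Rightarrow> bool"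
where
  "has_weak_derivative V nrm I x t x' \<longleftrightarrow>
     t \<in> I \<and> t islimpt I \<and> (\<forall>s\<in>I. x s \<in> V) \<and> x' \<in> V \<and>
     (\<forall>\<phi>\<in>dual V nrm. ((\<lambda>s. \<phi> (\<lambda>b. (x s b - x t b) / (s - t))) \<longlongrightarrow> \<phi> x') (at t within I))"

section \<open>Quotient spaces\<close>

definition coset :: "('b \<Rightarrow> real) set \<Rightarrow> ('b \<Rightarrow> real) set \<Rightarrow> ('b \<Rightarrow> real) \<Rightarrow> ('b \<Rightarrow> real) set" where
  "coset V N f = {g\<in>V. (\<lambda>b. g b - f b) \<in> N}"

definition quot :: "('b \<Rightarrow> real) set \<Rightarrow> ('b \<Rightarrow> real) set \<Rightarrow> ('b \<Rightarrow> real) set set" where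
  "quot V N = coset V N ` V"

text \<open>The operator on \<open>V/N\<close> induced by an operator \<open>T\<close> on \<open>V\<close> that maps \<open>N\<close> into \<open>N\<close>, and the value on
  a coset of a functional that vanishes on \<open>N\<close>. For such \<open>T\<close> and \<open>\<sigma>\<close> neither depends on the
  representative: the union is over equal sets, and the image is a singleton.\<close>

definition quot_map ::
  "('b \<Rightarrow> real) set \<Rightarrow> ('b \<Rightarrow> real) set \<Rightarrow> (('b \<Rightarrow> real) \<Rightarrow> 'b \<Rightarrow> real) \<Rightarrow> ('b \<Rightarrow> real) set \<Rightarrow> ('b \<Rightarrow> real) set"
where
  "quot_map V N T q = (\<Union>f\<in>q. coset V N (T f))"

definition quot_pairing :: "(('b \<Rightarrow> real) \<Rightarrow> real) \<Rightarrow> ('b \<Rightarrow> real) set \<Rightarrow> real" where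
  "quot_pairing \<sigma> q = the_elem (\<sigma> ` q)"

definition quot_inverse ::
  "('b \<Rightarrow> real) set \<Rightarrow> ('b \<Rightarrow> real) set \<Rightarrow> (('b \<Rightarrow> real) \<Rightarrow> 'b \<Rightarrow> real) \<Rightarrow> ('b \<Rightarrow> real) set \<Rightarrow> ('b \<Rightarrow> real) set"
where
  "quot_inverse V N T = inv_into (quot V N) (quot_map V N T)"

section \<open>Reproducing kernel Hilbert spaces\<close>

definition positive_definite_kernel :: "('a \<Rightarrow> 'a \<Rightarrow> real) \<Rightarrow> bool" where
  "positive_definite_kernel k \<longleftrightarrow>
     (\<forall>x y. k x y = k y x) \<and>
     (\<forall>S w. finite S \<longrightarrow> (\<Sum>x\<in>S. \<Sum>y\<in>S. w x * w y * k x y) \<ge> 0)"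

definition is_rkhs ::
  "('a \<Rightarrow> 'a \<Rightarrow> real) \<Rightarrow> ('a \<Rightarrow> real) set \<Rightarrow> (('a \<Rightarrow> real) \<Rightarrow> ('a \<Rightarrow> real) \<Rightarrow> real) \<Rightarrow> bool"
where
  "is_rkhs k H ip \<longleftrightarrow>
     fun_subspace H \<and>
     \<comment> \<open>\<open>ip\<close> is an inner product on \<open>H\<close>\<close>
     (\<forall>f\<in>H. \<forall>g\<in>H. ip f g = ip g f) \<and>
     (\<forall>f\<in>H. \<forall>g\<in>H. \<forall>h\<in>H. ip (\<lambda>x. f x + g x) h = ip f h + ip g h) \<and>
     (\<forall>r. \<forall>f\<in>H. \<forall>h\<in>H. ip (\<lambda>x. r * f x) h = r * ip f h) \<and>
     (\<forall>f\<in>H. ip f f \<ge> 0) \<and>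
     (\<forall>f\<in>H. ip f f = 0 \<longrightarrow> f = (\<lambda>_. 0)) \<and>
     \<comment> \<open>\<open>H\<close> is complete\<close>
     (\<forall>F :: nat \<Rightarrow> 'a \<Rightarrow> real.
        (\<forall>n. F n \<in> H) \<and>
        (\<forall>e>0. \<exists>N. \<forall>m\<ge>N. \<forall>n\<ge>N.
           sqrt (ip (\<lambda>x. F m x - F n x) (\<lambda>x. F m x - F n x)) < e) \<longrightarrow>
        (\<exists>f\<in>H. (\<lambda>n. sqrt (ip (\<lambda>x. F n x - f x) (\<lambda>x. F n x - f x))) \<longlonglongrightarrow> 0)) \<and>
     \<comment> \<open>reproducing property\<close>
     (\<forall>x. k x \<in> H) \<and>
     (\<forall>f\<in>H. \<forall>x. ip f (k x) = f x)"

text \<open>By the Moore--Aronszajn theorem a positive definite kernel has exactly one RKHS, so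
  the following descriptions are proper for such kernels (the inner product on its space only).\<close>

definition rkhs :: "('a \<Rightarrow> 'a \<Rightarrow> real) \<Rightarrow> ('a \<Rightarrow> real) set" where
  "rkhs k = (THE H. \<exists>ip. is_rkhs k H ip)"

definition rkhs_inner :: "('a \<Rightarrow> 'a \<Rightarrow> real) \<Rightarrow> ('a \<Rightarrow> real) \<Rightarrow> ('a \<Rightarrow> real) \<Rightarrow> real" where
  "rkhs_inner k f g = (THE r. \<exists>ip. is_rkhs k (rkhs k) ip \<and> r = ip f g)"

definition rkhs_norm :: "('a \<Rightarrow> 'a \<Rightarrow> real) \<Rightarrow> ('a \<Rightarrow> real) \<Rightarrow> real" where
  "rkhs_norm k f = sqrt (rkhs_inner k f f)"

definition universal_kernel :: "('a::metric_space \<Rightarrow> 'a \<Rightarrow> real) \<Rightarrow> bool" where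
  "universal_kernel k \<longleftrightarrow>
     (\<forall>f\<in>rkhs k. continuous_on UNIV f) \<and>
     (\<forall>g. continuous_on UNIV g \<longrightarrow> (\<forall>e>0. \<exists>f\<in>rkhs k. \<forall>x. \<bar>f x - g x\<bar> < e))"

abbreviation rkhs_dual :: "('a \<Rightarrow> 'a \<Rightarrow> real) \<Rightarrow> (('a \<Rightarrow> real) \<Rightarrow> real) set" where
  "rkhs_dual k \<equiv> dual (rkhs k) (rkhs_norm k)"

abbreviation rkhs_dual_norm :: "('a \<Rightarrow> 'a \<Rightarrow> real) \<Rightarrow> (('a \<Rightarrow> real) \<Rightarrow> real) \<Rightarrow> real" where
  "rkhs_dual_norm k \<equiv> dual_norm (rkhs k) (rkhs_norm k)"

text \<open>The subspace of \<^term>\<open>rkhs_dual k\<close> of functionals annihilating the constant function 1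
  (which belongs to the RKHS of the kernels for which this is used).\<close>

definition rkhs_dual0 :: "('a \<Rightarrow> 'a \<Rightarrow> real) \<Rightarrow> (('a \<Rightarrow> real) \<Rightarrow> real) set" where
  "rkhs_dual0 k = {\<sigma>\<in>rkhs_dual k. \<sigma> (\<lambda>_. 1) = 0}"

definition measure_functional :: "('a \<Rightarrow> 'a \<Rightarrow> real) \<Rightarrow> 'a measure \<Rightarrow> ('a \<Rightarrow> real) \<Rightarrow> real" where
  "measure_functional k \<mu> f = (if f \<in> rkhs k then (\<integral>x. f x \<partial>\<mu>) else 0)"

section \<open>Entropic self-transport\<close>

text \<open>Finite Borel measures on a compact metric space are automatically Radon.\<close>

definition prob_measures :: "'a::metric_space measure set" where
  "prob_measures = {\<mu>. prob_space \<mu> \<and> sets \<mu> = sets borel}"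

definition k_c :: "real \<Rightarrow> ('a \<Rightarrow> 'a \<Rightarrow> real) \<Rightarrow> 'a \<Rightarrow> 'a \<Rightarrow> real" where
  "k_c \<epsilon> c x y = exp (- c x y / \<epsilon>)"

definition self_potential ::
  "real \<Rightarrow> ('a::metric_space \<Rightarrow> 'a \<Rightarrow> real) \<Rightarrow> 'a measure \<Rightarrow> 'a \<Rightarrow> real" where
  "self_potential \<epsilon> c \<mu> =
     (THE f. continuous_on UNIV f \<and> (\<forall>y. (\<integral>x. exp (1 / \<epsilon> * (f x + f y - c x y)) \<partial>\<mu>) = 1))"

definition a_mu :: "real \<Rightarrow> ('a::metric_space \<Rightarrow> 'a \<Rightarrow> real) \<Rightarrow> 'a measure \<Rightarrow> 'a \<Rightarrow> real" where
  "a_mu \<epsilon> c \<mu> x = exp (self_potential \<epsilon> c \<mu> x / \<epsilon>)"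

definition k_mu :: "real \<Rightarrow> ('a::metric_space \<Rightarrow> 'a \<Rightarrow> real) \<Rightarrow> 'a measure \<Rightarrow> 'a \<Rightarrow> 'a \<Rightarrow> real" where
  "k_mu \<epsilon> c \<mu> x y = a_mu \<epsilon> c \<mu> x * a_mu \<epsilon> c \<mu> y * k_c \<epsilon> c x y"

definition B_map :: "real \<Rightarrow> ('a::metric_space \<Rightarrow> 'a \<Rightarrow> real) \<Rightarrow> 'a measure \<Rightarrow> 'a \<Rightarrow> real" where
  "B_map \<epsilon> c \<mu> y = (\<integral>x. a_mu \<epsilon> c \<mu> x * k_c \<epsilon> c x y \<partial>\<mu>)"

definition K_mu ::
  "real \<Rightarrow> ('a::metric_space \<Rightarrow> 'a \<Rightarrow> real) \<Rightarrow> 'a measure \<Rightarrow> ('a \<Rightarrow> real) \<Rightarrow> 'a \<Rightarrow> real" where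
  "K_mu \<epsilon> c \<mu> \<phi> y = (\<integral>x. \<phi> x * k_mu \<epsilon> c \<mu> x y \<partial>\<mu>)"

definition H_mu ::
  "real \<Rightarrow> ('a::metric_space \<Rightarrow> 'a \<Rightarrow> real) \<Rightarrow> 'a measure \<Rightarrow> (('a \<Rightarrow> real) \<Rightarrow> real) \<Rightarrow> 'a \<Rightarrow> real" where
  "H_mu \<epsilon> c \<mu> \<sigma> y = \<sigma> (\<lambda>x. k_mu \<epsilon> c \<mu> x y)"

section \<open>The two metric tensors\<close>

definition constants :: "('b \<Rightarrow> real) set" where
  "constants = {f. \<exists>r. f = (\<lambda>_. r)}"

text \<open>The quadratic form $\mathbf{g}_\mu(\sigma,\sigma)$ for \<open>\<sigma>\<close> in
  \<^term>\<open>rkhs_dual0 (k_mu \<epsilon> c \<mu>)\<close>; the inverse is taken on the RKHS modulo constants.\<close>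

definition metric_g ::
  "real \<Rightarrow> ('a::metric_space \<Rightarrow> 'a \<Rightarrow> real) \<Rightarrow> 'a measure \<Rightarrow> (('a \<Rightarrow> real) \<Rightarrow> real) \<Rightarrow> real" where
  "metric_g \<epsilon> c \<mu> \<sigma> =
     (let H = rkhs (k_mu \<epsilon> c \<mu>); K = K_mu \<epsilon> c \<mu> in
      \<epsilon> / 2 * quot_pairing \<sigma>
        (quot_inverse H constants (\<lambda>f x. f x - K (K f) x) (coset H constants (H_mu \<epsilon> c \<mu> \<sigma>))))"

text \<open>$L^2(X,\mu)$ is rendered by functions rather than classes; \<open>L2_constants \<mu>\<close> consists of the
  functions that are almost everywhere constant, so \<open>quot (L2 \<mu>) (L2_constants \<mu>)\<close> is
  $L^2(X,\mu)/\mathbb{R}$.\<close>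

definition L2 :: "'a measure \<Rightarrow> ('a \<Rightarrow> real) set" where
  "L2 \<mu> = {f. f \<in> borel_measurable \<mu> \<and> integrable \<mu> (\<lambda>x. (f x)\<^sup>2)}"

definition L2_constants :: "'a measure \<Rightarrow> ('a \<Rightarrow> real) set" where
  "L2_constants \<mu> = {f\<in>L2 \<mu>. \<exists>r. AE x in \<mu>. f x = r}"

definition L2_inner :: "'a measure \<Rightarrow> ('a \<Rightarrow> real) \<Rightarrow> ('a \<Rightarrow> real) \<Rightarrow> real" where
  "L2_inner \<mu> f g = (\<integral>x. f x * g x \<partial>\<mu>)"

text \<open>The quadratic form $\tilde{\mathbf{g}}_\mu(b,b)$ for \<open>b\<close> in \<^term>\<open>rkhs (k_c \<epsilon> c)\<close> orthogonal to
  \<^term>\<open>B_map \<epsilon> c \<mu>\<close>; by that orthogonality the $L^2$ pairing below does not see constants.\<close>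

definition metric_g_tilde ::
  "real \<Rightarrow> ('a::metric_space \<Rightarrow> 'a \<Rightarrow> real) \<Rightarrow> 'a measure \<Rightarrow> ('a \<Rightarrow> real) \<Rightarrow> real" where
  "metric_g_tilde \<epsilon> c \<mu> b =
     (let h = (\<lambda>x. a_mu \<epsilon> c \<mu> x * b x); K = K_mu \<epsilon> c \<mu> in
      \<epsilon> / 2 * ((rkhs_norm (k_c \<epsilon> c) b)\<^sup>2 +
        2 * quot_pairing (L2_inner \<mu> h)
              (quot_inverse (L2 \<mu>) (L2_constants \<mu>) (\<lambda>f x. f x - K f x)
                 (coset (L2 \<mu>) (L2_constants \<mu>) h))))"

end

theory Submission
  imports Defs
begin

text \<open>
  The pairing with test functions is moved from \<open>\<mu>\<^sub>s\<close> to \<open>\<beta>\<^sub>s = B(\<mu>\<^sub>s)\<close>: with \<open>a\<^sub>s = 1/\<beta>\<^sub>s\<close> and \<open>q\<^sub>s = (\<beta>\<^sub>s - \<beta>)/s\<close>,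
  \<open>(\<integral> a g d\<mu>\<^sub>s - \<integral> a g d\<mu>)/s = \<langle>q\<^sub>s, g\<rangle> + \<integral> a\<^sub>s a g q\<^sub>s d\<mu>\<^sub>s\<close> for \<open>g\<close> in the RKHS of \<open>k\<^sub>c\<close>.
  Weak convergence of \<open>q\<^sub>s\<close> bounds its norm, so \<open>q\<^sub>s \<rightarrow> \<beta>'\<close> uniformly; and \<open>\<integral> a\<^sub>s g d\<mu>\<^sub>s = \<langle>\<beta>\<^sub>s, g\<rangle>\<close> together
  with universality makes \<open>a\<^sub>s \<mu>\<^sub>s\<close> converge weakly. Hence the derivative is
  \<open>\<sigma>(a g) = \<langle>\<beta>', g\<rangle> + \<integral> a\<^sup>2 g \<beta>' d\<mu>\<close>. As every \<open>\<mu>\<^sub>s\<close> has mass 1, \<open>0 = \<sigma>(1) = 2 \<langle>\<beta>', \<beta>\<rangle>\<close>. With \<open>h = a \<beta>'\<close> one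
  gets \<open>H[\<sigma>] = (id + K) h\<close>, so both quadratic forms are computed from the same solution \<open>f\<close> of
  \<open>(id - K) f = h\<close>, which exists because \<open>K\<close> contracts mean-zero functions in the sup norm.
  The potential exists because \<open>\<beta> \<mapsto> \<integral> k\<^sub>c(x, \<cdot>)/\<beta>(x) d\<mu>(x)\<close> is, up to truncation, the negative of a monotone
  Lipschitz map on the RKHS.
\<close>

section \<open>Hilbert spaces of functions\<close>

text \<open>\<open>rkhs\<close> and \<open>rkhs_inner\<close> are definite descriptions over sets of
  functions, so existence and uniqueness of the RKHS have to be settled before any quantity can be
  computed, and Hilbert space facts are proved relative to a carrier set. Weak differentiability in
  the dual is tested against the bidual; reflexivity reduces this to functions in the RKHS of
  \<open>k_mu\<close>, all of the form \<open>a g\<close> because multiplication by \<open>a\<close>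
  maps the space of \<open>k_c\<close> isometrically onto it. The obstacle is that nothing is
  assumed about convergence of \<open>\<mu> s\<close>: \<open>B_map\<close> controls only the
  products of scaling and measure, since inner products with it integrate against these products.
  All estimates therefore rest on a lower bound \<open>\<kappa>\<close> of the kernel that depends
  neither on the measure nor on \<open>s\<close>. It confines every scaling to the interval from
  \<open>\<kappa>\<close> to \<open>1 / \<kappa>\<close>, and it gives the contraction factor
  \<open>1 - \<kappa> ^ 3\<close>: one \<open>\<kappa>\<close> for the kernel, one for each of the
  two scalings in \<open>k_mu\<close>.\<close>

lemma nonneg_quadratic_linear_coeff_zero:
  assumes "\<And>t. 0 \<le> 2 * t * a + t\<^sup>2 * (b::real)"
  shows "a = 0"
proof (rule ccontr)
  assume "a \<noteq> 0"
  have "b \<ge> 0"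
    using assms[of 1] assms[of "-1"] by simp
  \<comment> \<open>Dividing by \<open>b + 1\<close> instead of \<open>b\<close> covers
    \<open>b = 0\<close> as well.\<close>
  have "0 \<le> 2 * (- a / (b + 1)) * a + (- a / (b + 1))\<^sup>2 * b" by (rule assms)
  also have "\<dots> = - (a\<^sup>2 * (b + 2) / (b + 1)\<^sup>2)"
    using \<open>b \<ge> 0\<close> by (simp add: divide_simps) (simp add: algebra_simps power2_eq_square)
  also have "\<dots> < 0"
    using \<open>b \<ge> 0\<close> \<open>a \<noteq> 0\<close> by simp
  finally show False by simp
qed

text \<open>The space is a set and not a type because the RKHS varies with the kernel and, through
  \<open>k_mu\<close>, with the measure. \<open>ip\<close> is unconstrained off \<open>V\<close>, as
  \<open>rkhs_inner\<close> is.\<close>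

locale hilbert_functions =
  fixes V :: "('b \<Rightarrow> real) set" and ip :: "('b \<Rightarrow> real) \<Rightarrow> ('b \<Rightarrow> real) \<Rightarrow> real"
  assumes subspace: "fun_subspace V"
    and sym: "f \<in> V \<Longrightarrow> g \<in> V \<Longrightarrow> ip f g = ip g f"
    and add_left: "f \<in> V \<Longrightarrow> g \<in> V \<Longrightarrow> h \<in> V \<Longrightarrow> ip (\<lambda>x. f x + g x) h = ip f h + ip g h"
    and scale_left: "f \<in> V \<Longrightarrow> h \<in> V \<Longrightarrow> ip (\<lambda>x. r * f x) h = r * ip f h"
    and nonneg: "f \<in> V \<Longrightarrow> 0 \<le> ip f f"
    and definite: "f \<in> V \<Longrightarrow> ip f f = 0 \<Longrightarrow> f = (\<lambda>_. 0)"
    and complete: "(\<And>n. F n \<in> V) \<Longrightarrow>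
      (\<And>e. e > 0 \<Longrightarrow> \<exists>N. \<forall>m\<ge>N. \<forall>n\<ge>N. sqrt (ip (\<lambda>x. F m x - F n x) (\<lambda>x. F m x - F n x)) < e) \<Longrightarrow>
      \<exists>f\<in>V. (\<lambda>n. sqrt (ip (\<lambda>x. F n x - f x) (\<lambda>x. F n x - f x))) \<longlonglongrightarrow> 0"
begin

definition nm :: "('b \<Rightarrow> real) \<Rightarrow> real" where
  "nm f = sqrt (ip f f)"

lemma zero_mem [simp]: "(\<lambda>_. 0) \<in> V"
  using subspace by (simp add: fun_subspace_def)

lemma add_mem [simp]: "f \<in> V \<Longrightarrow> g \<in> V \<Longrightarrow> (\<lambda>x. f x + g x) \<in> V"
  using subspace by (simp add: fun_subspace_def)

lemma scale_mem [simp]: "f \<in> V \<Longrightarrow> (\<lambda>x. r * f x) \<in> V"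
  using subspace by (simp add: fun_subspace_def)

lemma minus_mem [simp]: "f \<in> V \<Longrightarrow> (\<lambda>x. - f x) \<in> V"
  using scale_mem[of f "-1"] by simp

lemma diff_mem [simp]: "f \<in> V \<Longrightarrow> g \<in> V \<Longrightarrow> (\<lambda>x. f x - g x) \<in> V"
  using add_mem[of f "\<lambda>x. - g x"] by simp

lemma add_right: "f \<in> V \<Longrightarrow> g \<in> V \<Longrightarrow> h \<in> V \<Longrightarrow> ip h (\<lambda>x. f x + g x) = ip h f + ip h g"
  by (simp add: sym[of h] add_left)

lemma scale_right: "f \<in> V \<Longrightarrow> h \<in> V \<Longrightarrow> ip h (\<lambda>x. r * f x) = r * ip h f"
  by (simp add: sym[of h] scale_left)

lemma minus_left: "f \<in> V \<Longrightarrow> h \<in> V \<Longrightarrow> ip (\<lambda>x. - f x) h = - ip f h"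
  using scale_left[of f h "-1"] by simp

lemma diff_left: "f \<in> V \<Longrightarrow> g \<in> V \<Longrightarrow> h \<in> V \<Longrightarrow> ip (\<lambda>x. f x - g x) h = ip f h - ip g h"
  using add_left[of f "\<lambda>x. - g x" h] by (simp add: minus_left)

lemma diff_right: "f \<in> V \<Longrightarrow> g \<in> V \<Longrightarrow> h \<in> V \<Longrightarrow> ip h (\<lambda>x. f x - g x) = ip h f - ip h g"
  by (simp add: sym[of h] diff_left)

lemma zero_left [simp]: "h \<in> V \<Longrightarrow> ip (\<lambda>_. 0) h = 0"
  using scale_left[of h h 0] by simp

lemma zero_right [simp]: "h \<in> V \<Longrightarrow> ip h (\<lambda>_. 0) = 0"
  by (simp add: sym[of h])

lemmas bilinear = add_left add_right diff_left diff_right scale_left scale_right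

lemma nm_nonneg [simp]: "f \<in> V \<Longrightarrow> 0 \<le> nm f"
  by (simp add: nm_def nonneg)

lemma nm_power2: "f \<in> V \<Longrightarrow> (nm f)\<^sup>2 = ip f f"
  by (simp add: nm_def nonneg)

lemma nm_scale: "f \<in> V \<Longrightarrow> nm (\<lambda>x. r * f x) = \<bar>r\<bar> * nm f"
  by (simp add: nm_def bilinear real_sqrt_mult flip: mult.assoc)

lemma Cauchy_Schwarz:
  assumes "f \<in> V" "g \<in> V"
  shows "\<bar>ip f g\<bar> \<le> nm f * nm g"
proof (cases "ip g g = 0")
  case True
  then show ?thesis using definite[OF assms(2)] assms by simp
next
  case False
  then have pos: "ip g g > 0" using nonneg[OF assms(2)] by simp
  have "0 \<le> ip f f - 2 * t * ip f g + t\<^sup>2 * ip g g" for t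
    using nonneg[of "\<lambda>x. f x - t * g x"] assms
    by (simp add: bilinear sym[of g f] algebra_simps power2_eq_square)
  from this[of "ip f g / ip g g"] have "(ip f g)\<^sup>2 \<le> ip f f * ip g g"
    using pos by (simp add: field_simps power2_eq_square)
  then have "sqrt ((ip f g)\<^sup>2) \<le> sqrt (ip f f * ip g g)"
    by (rule real_sqrt_le_mono)
  then show ?thesis by (simp add: nm_def real_sqrt_mult)
qed

lemma nm_triangle:
  assumes "f \<in> V" "g \<in> V"
  shows "nm (\<lambda>x. f x + g x) \<le> nm f + nm g"
proof (rule power2_le_imp_le)
  have "(nm (\<lambda>x. f x + g x))\<^sup>2 = ip f f + 2 * ip f g + ip g g"
    using assms by (simp add: nm_power2 bilinear sym[of g f])
  also have "\<dots> \<le> ip f f + 2 * (nm f * nm g) + ip g g"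
    using Cauchy_Schwarz[OF assms] by simp
  also have "\<dots> = (nm f + nm g)\<^sup>2"
    using assms by (simp add: power2_sum nm_power2)
  finally show "(nm (\<lambda>x. f x + g x))\<^sup>2 \<le> (nm f + nm g)\<^sup>2" .
qed (use assms in simp)

lemma nm_diff_triangle:
  assumes "f \<in> V" "g \<in> V" "h \<in> V"
  shows "nm (\<lambda>x. f x - h x) \<le> nm (\<lambda>x. f x - g x) + nm (\<lambda>x. g x - h x)"
  using nm_triangle[of "\<lambda>x. f x - g x" "\<lambda>x. g x - h x"] assms by simp

lemma nm_minus_commute: "f \<in> V \<Longrightarrow> g \<in> V \<Longrightarrow> nm (\<lambda>x. f x - g x) = nm (\<lambda>x. g x - f x)"
  by (simp add: nm_def bilinear sym[of g f])

lemma Cauchy_converges: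
  assumes "\<And>n. F n \<in> V"
    and "\<And>e. e > 0 \<Longrightarrow> \<exists>N. \<forall>m\<ge>N. \<forall>n\<ge>N. nm (\<lambda>x. F m x - F n x) < e"
  obtains f where "f \<in> V" "(\<lambda>n. nm (\<lambda>x. F n x - f x)) \<longlonglongrightarrow> 0"
  using complete[of F] assms unfolding nm_def by blast

lemma tendsto_ip:
  assumes F: "\<And>n. F n \<in> V" "f \<in> V" and g: "g \<in> V"
    and lim: "(\<lambda>n. nm (\<lambda>x. F n x - f x)) \<longlonglongrightarrow> 0"
  shows "(\<lambda>n. ip (F n) g) \<longlonglongrightarrow> ip f g"
proof -
  have "(\<lambda>n. ip (F n) g - ip f g) \<longlonglongrightarrow> 0"
  proof (rule tendsto_rabs_zero_cancel, rule tendsto_sandwich[OF _ _ tendsto_const])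
    show "(\<lambda>n. nm (\<lambda>x. F n x - f x) * nm g) \<longlonglongrightarrow> 0"
      using tendsto_mult_right[OF lim, of "nm g"] by simp
    show "\<forall>\<^sub>F n in sequentially. \<bar>ip (F n) g - ip f g\<bar> \<le> nm (\<lambda>x. F n x - f x) * nm g"
      using Cauchy_Schwarz[of "\<lambda>x. F _ x - f x" g] F g
      by (intro always_eventually allI) (simp add: diff_left)
  qed simp
  then show ?thesis by (simp add: LIM_zero_iff)
qed

text \<open>Serves both the Banach iteration and the gliding hump argument; the explicit distance
  from \<open>F n\<close> to the limit is what the latter relies on.\<close>

lemma geometric_steps_converge:
  assumes F: "\<And>n. F n \<in> V" and r: "0 \<le> r" "r < 1"
    and step: "\<And>n. nm (\<lambda>x. F (Suc n) x - F n x) \<le> C * r ^ n"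
  obtains f where "f \<in> V" "(\<lambda>n. nm (\<lambda>x. F n x - f x)) \<longlonglongrightarrow> 0"
    and "\<And>n. nm (\<lambda>x. f x - F n x) \<le> C * r ^ n / (1 - r)"
proof -
  have C: "0 \<le> C"
    using order_trans[OF nm_nonneg step[of 0]] F by simp
  \<comment> \<open>The exact geometric sum, with its factor \<open>1 - r ^ d\<close>, is what makes
    the induction close; the factor is estimated away afterwards.\<close>
  have tail: "nm (\<lambda>x. F (n + d) x - F n x) \<le> C * r ^ n * (1 - r ^ d) / (1 - r)" for n d
  proof (induction d)
    case 0
    then show ?case by (simp add: nm_def)
  next
    case (Suc d)
    have "nm (\<lambda>x. F (n + Suc d) x - F n x)
        \<le> nm (\<lambda>x. F (Suc (n + d)) x - F (n + d) x) + nm (\<lambda>x. F (n + d) x - F n x)"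
      using nm_diff_triangle[OF F F F, of "Suc (n + d)" n "n + d"] by simp
    also have "\<dots> \<le> C * r ^ (n + d) + C * r ^ n * (1 - r ^ d) / (1 - r)"
      using step[of "n + d"] Suc.IH by simp
    also have "\<dots> = C * r ^ n * (1 - r ^ Suc d) / (1 - r)"
      using r by (simp add: field_simps power_add)
    finally show ?case .
  qed
  have tail': "nm (\<lambda>x. F m x - F n x) \<le> C * r ^ n / (1 - r)" if "m \<ge> n" for m n
  proof -
    have "nm (\<lambda>x. F m x - F n x) \<le> C * r ^ n * (1 - r ^ (m - n)) / (1 - r)"
      using tail[of n "m - n"] that by simp
    also have "\<dots> \<le> C * r ^ n * 1 / (1 - r)"
      using r C by (intro divide_right_mono mult_left_mono) auto
    finally show ?thesis by simp
  qed
  have lim0: "(\<lambda>n. C * r ^ n / (1 - r)) \<longlonglongrightarrow> 0"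
    using tendsto_mult_right_zero[OF LIMSEQ_realpow_zero[OF r], of "C / (1 - r)"] by simp
  have "\<exists>N. \<forall>m\<ge>N. \<forall>n\<ge>N. nm (\<lambda>x. F m x - F n x) < e" if e: "e > 0" for e
  proof -
    obtain N where N: "\<And>n. n \<ge> N \<Longrightarrow> C * r ^ n / (1 - r) < e"
      using order_tendstoD(2)[OF lim0 e] by (auto simp: eventually_sequentially)
    have "nm (\<lambda>x. F m x - F n x) < e" if "m \<ge> N" "n \<ge> N" for m n
    proof (cases "m \<ge> n")
      case True
      then show ?thesis using tail'[OF True] N[OF \<open>n \<ge> N\<close>] by simp
    next
      case False
      then show ?thesis
        using tail'[of m n] N[OF \<open>m \<ge> N\<close>] nm_minus_commute[OF F F, of m n] by simp
    qed
    then show ?thesis by blast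
  qed
  then obtain f where f: "f \<in> V" "(\<lambda>n. nm (\<lambda>x. F n x - f x)) \<longlonglongrightarrow> 0"
    by (rule Cauchy_converges[OF F])
  have "nm (\<lambda>x. f x - F n x) \<le> C * r ^ n / (1 - r)" for n
  proof (rule tendsto_lowerbound)
    show "(\<lambda>m. nm (\<lambda>x. F m x - f x) + C * r ^ n / (1 - r)) \<longlonglongrightarrow> C * r ^ n / (1 - r)"
      using tendsto_add[OF f(2) tendsto_const] by simp
    show "\<forall>\<^sub>F m in sequentially. nm (\<lambda>x. f x - F n x) \<le> nm (\<lambda>x. F m x - f x) + C * r ^ n / (1 - r)"
      using eventually_ge_at_top[of n]
    proof eventually_elim
      case (elim m)
      then show ?case
        using nm_diff_triangle[OF f(1) F F, of n m] tail'[of n m] nm_minus_commute[OF F f(1), of m]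
        by simp
    qed
  qed simp
  with f that show ?thesis by blast
qed

lemma contraction_fixpoint:
  assumes T: "\<And>f. f \<in> V \<Longrightarrow> T f \<in> V" and r: "0 \<le> r" "r < 1"
    and contr: "\<And>f g. f \<in> V \<Longrightarrow> g \<in> V \<Longrightarrow>
      nm (\<lambda>x. T f x - T g x) \<le> r * nm (\<lambda>x. f x - g x)"
  obtains f where "f \<in> V" "T f = f"
proof -
  define F where "F n = (T ^^ n) (\<lambda>_. 0)" for n
  have F: "F n \<in> V" for n
    by (induction n) (auto simp: F_def T)
  have step: "nm (\<lambda>x. F (Suc n) x - F n x) \<le> nm (\<lambda>x. F (Suc 0) x - F 0 x) * r ^ n" for n
  proof (induction n)
    case (Suc n)
    have "nm (\<lambda>x. F (Suc (Suc n)) x - F (Suc n) x) \<le> r * nm (\<lambda>x. F (Suc n) x - F n x)"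
      using contr[OF F F, of "Suc n" n] by (simp add: F_def)
    also have "\<dots> \<le> r * (nm (\<lambda>x. F (Suc 0) x - F 0 x) * r ^ n)"
      by (intro mult_left_mono Suc.IH r)
    finally show ?case by (simp add: mult_ac)
  qed simp
  obtain f where f: "f \<in> V" and lim: "(\<lambda>n. nm (\<lambda>x. F n x - f x)) \<longlonglongrightarrow> 0"
    using geometric_steps_converge[OF F r step] by blast
  have "nm (\<lambda>x. T f x - f x) \<le> 0"
  proof (rule tendsto_lowerbound)
    show "(\<lambda>n. r * nm (\<lambda>x. F n x - f x) + nm (\<lambda>x. F (Suc n) x - f x)) \<longlonglongrightarrow> 0"
      using tendsto_add[OF tendsto_mult_left[OF lim, of r] LIMSEQ_Suc[OF lim]] by simp
    have "nm (\<lambda>x. T f x - f x) \<le> r * nm (\<lambda>x. F n x - f x) + nm (\<lambda>x. F (Suc n) x - f x)" for n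
    proof -
      have "nm (\<lambda>x. T f x - F (Suc n) x) \<le> r * nm (\<lambda>x. F n x - f x)"
        using contr[OF f F, of n] nm_minus_commute[OF f F, of n] by (simp add: F_def)
      then show ?thesis
        using nm_diff_triangle[OF T[OF f] F f, of "Suc n"] by simp
    qed
    then show "\<forall>\<^sub>F n in sequentially. nm (\<lambda>x. T f x - f x)
        \<le> r * nm (\<lambda>x. F n x - f x) + nm (\<lambda>x. F (Suc n) x - f x)"
      by simp
  qed simp
  moreover have m: "(\<lambda>x. T f x - f x) \<in> V" using T f by simp
  ultimately have "ip (\<lambda>x. T f x - f x) (\<lambda>x. T f x - f x) = 0"
    using nm_nonneg[OF m] nm_power2[OF m] by simp
  then have "T f = f" using definite[OF m] by (simp add: fun_eq_iff)
  with f that show ?thesis by blast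
qed

text \<open>The representer is the minimiser of \<open>f \<mapsto> \<langle>f, f\<rangle> - 2 \<sigma> f\<close>.\<close>

lemma Riesz:
  assumes add: "\<And>f g. f \<in> V \<Longrightarrow> g \<in> V \<Longrightarrow> \<sigma> (\<lambda>x. f x + g x) = \<sigma> f + \<sigma> g"
    and scale: "\<And>r f. f \<in> V \<Longrightarrow> \<sigma> (\<lambda>x. r * f x) = r * \<sigma> f"
    and bound: "\<And>f. f \<in> V \<Longrightarrow> \<bar>\<sigma> f\<bar> \<le> C * nm f"
  obtains g where "g \<in> V" "\<And>f. f \<in> V \<Longrightarrow> \<sigma> f = ip g f"
proof -
  define J where "J f = ip f f - 2 * \<sigma> f" for f
  have diff: "\<sigma> (\<lambda>x. f x - g x) = \<sigma> f - \<sigma> g" if "f \<in> V" "g \<in> V" for f g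
    using add[OF that(1) scale_mem[OF that(2), of "-1"]] scale[OF that(2), of "-1"] by simp
  have lower: "- (C\<^sup>2) \<le> J f" if "f \<in> V" for f
  proof -
    have "0 \<le> (nm f - C)\<^sup>2" by simp
    then have "2 * (C * nm f) \<le> ip f f + C\<^sup>2"
      using that by (simp add: power2_diff nm_power2 mult_ac)
    then show ?thesis
      unfolding J_def using bound[OF that] by linarith
  qed
  define m where "m = Inf (J ` V)"
  have bdd: "bdd_below (J ` V)"
    using lower by (intro bdd_belowI[of _ "- (C\<^sup>2)"]) auto
  have m_le: "m \<le> J f" if "f \<in> V" for f
    unfolding m_def using that bdd by (intro cInf_lower) auto
  have "\<exists>f\<in>V. J f < m + 1 / real (Suc n)" for n
    using cInf_less_iff[OF _ bdd, of "m + 1 / real (Suc n)"] zero_mem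
    unfolding m_def[symmetric] by (auto simp del: zero_mem)
  then obtain F where F: "\<And>n. F n \<in> V" and JF: "\<And>n. J (F n) < m + 1 / real (Suc n)"
    by metis
  \<comment> \<open>Parallelogram law at the midpoint \<open>h\<close>: the linear part of
    \<open>J\<close> cancels, and \<open>m \<le> J h\<close> turns it into an estimate under which
    minimising sequences are Cauchy.\<close>
  have para: "(nm (\<lambda>x. f x - g x))\<^sup>2 \<le> 2 * (J f - m) + 2 * (J g - m)" if "f \<in> V" "g \<in> V" for f g
  proof -
    define h where "h = (\<lambda>x. (1/2) * (f x + g x))"
    have "(nm (\<lambda>x. f x - g x))\<^sup>2 = 2 * J f + 2 * J g - 4 * J h"
      using that unfolding h_def
      apply (simp only: J_def nm_power2 bilinear add_mem scale_mem diff_mem scale add)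
      by (simp add: sym[of g f] algebra_simps)
    moreover have "m \<le> J h"
      unfolding h_def by (intro m_le scale_mem add_mem that)
    ultimately show ?thesis by argo
  qed
  have "\<exists>N. \<forall>i\<ge>N. \<forall>j\<ge>N. nm (\<lambda>x. F i x - F j x) < e" if "e > 0" for e
  proof -
    obtain N where N: "1 / real (Suc N) < e\<^sup>2 / 4"
      using nat_approx_posE[of "e\<^sup>2 / 4"] \<open>e > 0\<close> by auto
    have "nm (\<lambda>x. F i x - F j x) < e" if "i \<ge> N" "j \<ge> N" for i j
    proof (rule power2_less_imp_less)
      have "J (F k) - m < e\<^sup>2 / 4" if "k \<ge> N" for k
      proof -
        have "1 / real (Suc k) \<le> 1 / real (Suc N)"
          using that by (simp add: frac_le)
        then show ?thesis using JF[of k] N by linarith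
      qed
      from this[OF \<open>i \<ge> N\<close>] this[OF \<open>j \<ge> N\<close>] show "(nm (\<lambda>x. F i x - F j x))\<^sup>2 < e\<^sup>2"
        using para[OF F F, of i j] by argo
    qed (use \<open>e > 0\<close> in simp)
    then show ?thesis by blast
  qed
  then obtain g where g: "g \<in> V" and lim: "(\<lambda>n. nm (\<lambda>x. F n x - g x)) \<longlonglongrightarrow> 0"
    by (rule Cauchy_converges[OF F])
  \<comment> \<open>Lower semicontinuity: comparing \<open>J g\<close> with \<open>J (F n)\<close>,
    the linear difference tends to 0 and the quadratic one has a sign that lets it be
    dropped.\<close>
  have "J g \<le> m"
  proof (rule tendsto_lowerbound)
    show "(\<lambda>n. m + 1 / real (Suc n) + 2 * ((ip g (\<lambda>x. g x - F n x)) - \<sigma> (\<lambda>x. g x - F n x))) \<longlonglongrightarrow> m"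
    proof -
      have "(\<lambda>n. ip g (\<lambda>x. g x - F n x)) \<longlonglongrightarrow> 0"
        using tendsto_diff[OF tendsto_const tendsto_ip[OF F g g lim], of "ip g g"] F g
        by (simp add: diff_right sym[of g "F _"])
      moreover have "(\<lambda>n. \<sigma> (\<lambda>x. g x - F n x)) \<longlonglongrightarrow> 0"
      proof (rule tendsto_rabs_zero_cancel, rule tendsto_sandwich[OF _ _ tendsto_const])
        show "(\<lambda>n. C * nm (\<lambda>x. F n x - g x)) \<longlonglongrightarrow> 0"
          using tendsto_mult_left[OF lim, of C] by simp
        show "\<forall>\<^sub>F n in sequentially. \<bar>\<sigma> (\<lambda>x. g x - F n x)\<bar> \<le> C * nm (\<lambda>x. F n x - g x)"
          using bound[of "\<lambda>x. g x - F _ x"] F g by (simp add: nm_minus_commute[OF F g])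
      qed simp
      ultimately show ?thesis
        using tendsto_add[OF tendsto_add[OF tendsto_const LIMSEQ_Suc[OF lim_1_over_n]]
            tendsto_mult_left[OF tendsto_diff], of _ 0 _ 0 m 2] by simp
    qed
    have "J g \<le> m + 1 / real (Suc n) + 2 * ((ip g (\<lambda>x. g x - F n x)) - \<sigma> (\<lambda>x. g x - F n x))" for n
    proof -
      have "J g = J (F n) + 2 * (ip g (\<lambda>x. g x - F n x) - \<sigma> (\<lambda>x. g x - F n x))
          - (nm (\<lambda>x. g x - F n x))\<^sup>2"
        unfolding J_def using F[of n] g
        by (simp add: nm_power2 bilinear diff sym[of g "F n"] algebra_simps)
      then show ?thesis using JF[of n] by (smt (verit) zero_le_power2)
    qed
    then show "\<forall>\<^sub>F n in sequentially. J g \<le> m + 1 / real (Suc n)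
        + 2 * ((ip g (\<lambda>x. g x - F n x)) - \<sigma> (\<lambda>x. g x - F n x))"
      by simp
  qed simp
  have "\<sigma> f = ip g f" if f: "f \<in> V" for f
  proof -
    \<comment> \<open>First variation: the minimiser is compared with \<open>g + t f\<close> for
      every real \<open>t\<close>, of either sign.\<close>
    have "0 \<le> 2 * t * (ip g f - \<sigma> f) + t\<^sup>2 * ip f f" for t
    proof -
      have "J g \<le> J (\<lambda>x. g x + t * f x)"
        using \<open>J g \<le> m\<close> m_le[of "\<lambda>x. g x + t * f x"] f g by simp
      then show ?thesis
        unfolding J_def using f g
        by (simp add: bilinear add scale sym[of f g] algebra_simps power2_eq_square)
    qed
    then have "ip g f - \<sigma> f = 0" by (rule nonneg_quadratic_linear_coeff_zero)
    then show ?thesis by simp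
  qed
  with g that show ?thesis by blast
qed

end

section \<open>Banach-Steinhaus, duals and reflexivity\<close>

context hilbert_functions
begin

text \<open>Sokal's gliding hump: step \<open>k\<close> moves the point \<open>X k\<close> by \<open>3\<^sup>-\<^sup>k\<close> in the direction of an \<open>h n\<close> of norm
  at least \<open>k 3\<^sup>k\<close>, with the sign that cannot decrease the pairing; the remaining steps undo at most half of it.\<close>

lemma uniform_boundedness:
  assumes h: "\<And>n::nat. h n \<in> V" and bd: "\<And>g. g \<in> V \<Longrightarrow> Bseq (\<lambda>n. ip (h n) g)"
  obtains C where "\<And>n. nm (h n) \<le> C"
proof -
  have "\<exists>C. \<forall>n. nm (h n) \<le> C"
  proof (rule ccontr)
    assume "\<not> ?thesis"
    then have "\<forall>k::nat. \<exists>n. nm (h n) > real k * 3 ^ k" by (meson not_le)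
    then obtain N where N: "\<And>k. nm (h (N k)) > real k * 3 ^ k" by metis
    define u where "u k = h (N k)" for k
    have u: "u k \<in> V" "nm (u k) > 0" "nm (u k) > real k * 3 ^ k" for k
      using N[of k] h by (auto simp: u_def intro: le_less_trans[rotated])
    define X where "X = rec_nat (\<lambda>_. 0)
      (\<lambda>k x. \<lambda>b. x b + (if ip (u k) x \<ge> 0 then 1 else -1) * (1/3) ^ k / nm (u k) * u k b)"
    have X0: "X 0 = (\<lambda>_. 0)"
      and XS: "X (Suc k) = (\<lambda>b. X k b
        + (if ip (u k) (X k) \<ge> 0 then 1 else -1) * (1/3) ^ k / nm (u k) * u k b)" for k
      by (simp_all add: X_def)
    have X: "X k \<in> V" for k
    proof (induction k)
      case (Suc k)
      then show ?case unfolding XS by (intro add_mem scale_mem u)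
    qed (simp add: X0)
    have step: "nm (\<lambda>b. X (Suc k) b - X k b) \<le> 1 * (1/3) ^ k" for k
    proof -
      define s :: real where "s = (if ip (u k) (X k) \<ge> 0 then 1 else -1)"
      have "nm (\<lambda>b. X (Suc k) b - X k b) = nm (\<lambda>b. s * (1/3) ^ k / nm (u k) * u k b)"
        unfolding XS s_def by simp
      also have "\<dots> = (1/3) ^ k"
        using u[of k] by (simp only: nm_scale) (simp add: s_def abs_mult)
      finally show ?thesis by simp
    qed
    \<comment> \<open>The ratio 1/3 matters here: the steps after step \<open>k\<close> sum to at
      most \<open>(1/3) ^ (k + 1) / (1 - 1/3)\<close>, half of step \<open>k\<close>. The ratio 1/2
      would leave a tail as large as the step itself.\<close>
    obtain x where x: "x \<in> V" and close: "\<And>k. nm (\<lambda>b. x b - X k b) \<le> 1 * (1/3) ^ k / (1 - 1/3)"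
      using geometric_steps_converge[OF X _ _ step] by auto
    have big: "real k / 2 \<le> \<bar>ip (u k) x\<bar>" for k
    proof -
      define s :: real where "s = (if ip (u k) (X k) \<ge> 0 then 1 else -1)"
      have "ip (u k) (X (Suc k)) = ip (u k) (X k) + s * (1/3) ^ k * nm (u k)"
        unfolding XS s_def[symmetric] using u[of k] X[of k]
        by (simp only: bilinear scale_mem) (simp add: power2_eq_square flip: nm_power2)
      then have "(1/3) ^ k * nm (u k) \<le> \<bar>ip (u k) (X (Suc k))\<bar>"
        using u[of k] by (auto simp: s_def split: if_splits)
      moreover have "\<bar>ip (u k) x - ip (u k) (X (Suc k))\<bar> \<le> (1/3) ^ k * nm (u k) / 2"
      proof -
        have "\<bar>ip (u k) x - ip (u k) (X (Suc k))\<bar> \<le> nm (u k) * nm (\<lambda>b. x b - X (Suc k) b)"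
          using Cauchy_Schwarz[of "u k" "\<lambda>b. x b - X (Suc k) b"] u(1)[of k] x X[of "Suc k"]
          by (simp add: diff_right)
        also have "\<dots> \<le> nm (u k) * ((1/3) ^ k / 2)"
          using close[of "Suc k"] u(2)[of k] by (intro mult_left_mono) auto
        finally show ?thesis by (simp add: mult_ac)
      qed
      ultimately have "(1/3) ^ k * nm (u k) / 2 \<le> \<bar>ip (u k) x\<bar>" by linarith
      moreover have "real k \<le> (1/3) ^ k * nm (u k)"
        using u(3)[of k] by (simp add: power_one_over field_simps)
      ultimately show ?thesis by linarith
    qed
    obtain K where K: "\<And>n. norm (ip (h n) x) \<le> K"
      using BseqE[OF bd[OF x]] by metis
    obtain k :: nat where "2 * K < real k" using reals_Archimedean2 by blast
    then show False using big[of k] K[of "N k"] by (simp add: u_def)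
  qed
  with that show ?thesis by blast
qed

text \<open>The value 0 off \<open>V\<close> matches the totalisation in \<open>dual\<close>, so
  that functionals can be compared by plain equality.\<close>

definition riesz :: "('b \<Rightarrow> real) \<Rightarrow> ('b \<Rightarrow> real) \<Rightarrow> real" where
  "riesz g f = (if f \<in> V then ip g f else 0)"

lemma riesz_in_dual: "g \<in> V \<Longrightarrow> riesz g \<in> dual V nm"
  unfolding dual_def using Cauchy_Schwarz[of g]
  by (auto simp: riesz_def bilinear intro!: exI[of _ "nm g"])

lemma dual_eq_riesz:
  assumes "\<sigma> \<in> dual V nm"
  obtains g where "g \<in> V" "\<sigma> = riesz g"
proof -
  obtain C where C: "\<forall>f\<in>V. \<bar>\<sigma> f\<bar> \<le> C * nm f"
    using assms by (auto simp: dual_def)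
  obtain g where "g \<in> V" "\<And>f. f \<in> V \<Longrightarrow> \<sigma> f = ip g f"
    using assms C by (rule_tac Riesz[of \<sigma> C]) (auto simp: dual_def)
  moreover have "\<sigma> f = 0" if "f \<notin> V" for f
    using assms that by (auto simp: dual_def)
  ultimately show ?thesis by (intro that[of g]) (auto simp: riesz_def)
qed

lemma dual_norm_riesz:
  assumes "g \<in> V"
  shows "dual_norm V nm (riesz g) \<le> nm g"
  unfolding dual_norm_def
proof (rule cSUP_least)
  have "(\<lambda>_. 0) \<in> {f \<in> V. nm f \<le> 1}" by (simp add: nm_def)
  then show "{f \<in> V. nm f \<le> 1} \<noteq> {}" by blast
  show "\<bar>riesz g f\<bar> \<le> nm g" if "f \<in> {f \<in> V. nm f \<le> 1}" for f
    using Cauchy_Schwarz[of g f] mult_left_mono[of "nm f" 1 "nm g"] that assms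
    by (simp add: riesz_def)
qed

text \<open>Read as a statement about \<open>\<sigma>\<close>: evaluation at \<open>f\<close> is a
  bounded functional on the dual, with constant \<open>nm f\<close>.\<close>

lemma dual_norm_bound:
  assumes \<sigma>: "\<sigma> \<in> dual V nm" and f: "f \<in> V"
  shows "\<bar>\<sigma> f\<bar> \<le> nm f * dual_norm V nm \<sigma>"
proof (cases "nm f = 0")
  case True
  then have "f = (\<lambda>_. 0)" using definite[OF f] nm_power2[OF f] by simp
  then have "\<sigma> f = 0" using \<sigma> zero_mem by (auto simp: dual_def dest!: bspec[of _ _ "\<lambda>_. 0"])
  then show ?thesis using True by simp
next
  case False
  then have pos: "nm f > 0" using nm_nonneg[OF f] by linarith
  obtain C where C: "\<forall>f\<in>V. \<bar>\<sigma> f\<bar> \<le> C * nm f"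
    using \<sigma> by (auto simp: dual_def)
  have scale: "\<sigma> (\<lambda>b. r * f b) = r * \<sigma> f" for r
    using \<sigma> f by (auto simp: dual_def)
  have "\<bar>\<sigma> (\<lambda>b. 1 / nm f * f b)\<bar> \<le> dual_norm V nm \<sigma>"
    unfolding dual_norm_def
  proof (rule cSUP_upper)
    show "(\<lambda>b. 1 / nm f * f b) \<in> {f \<in> V. nm f \<le> 1}"
      using f pos scale_mem[OF f] by (simp only: mem_Collect_eq nm_scale) simp
    show "bdd_above ((\<lambda>f. \<bar>\<sigma> f\<bar>) ` {f \<in> V. nm f \<le> 1})"
    proof (rule bdd_aboveI2)
      fix f assume "f \<in> {f \<in> V. nm f \<le> 1}"
      then show "\<bar>\<sigma> f\<bar> \<le> \<bar>C\<bar>"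
        using C[rule_format, of f] mult_mono[of C "\<bar>C\<bar>" "nm f" 1] abs_ge_self[of C] by auto
    qed
  qed
  then show ?thesis using pos unfolding scale by (simp add: abs_mult field_simps)
qed

text \<open>Reflexivity. Composed with the linear, norm nonincreasing map \<open>riesz\<close>,
  \<open>\<phi>\<close> becomes a bounded functional on \<open>V\<close>; its Riesz representer is
  the point of evaluation.\<close>

lemma bidual_eq_evaluation:
  assumes \<phi>: "\<phi> \<in> dual (dual V nm) (dual_norm V nm)"
  obtains f where "f \<in> V" "\<And>\<sigma>. \<sigma> \<in> dual V nm \<Longrightarrow> \<phi> \<sigma> = \<sigma> f"
proof -
  have add: "riesz (\<lambda>x. f x + g x) = (\<lambda>b. riesz f b + riesz g b)" if "f \<in> V" "g \<in> V" for f g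
    using that by (auto simp: riesz_def bilinear)
  have scale: "riesz (\<lambda>x. r * f x) = (\<lambda>b. r * riesz f b)" if "f \<in> V" for r f
    using that by (auto simp: riesz_def bilinear)
  obtain C where C: "\<forall>\<sigma>\<in>dual V nm. \<bar>\<phi> \<sigma>\<bar> \<le> C * dual_norm V nm \<sigma>"
    using \<phi> by (auto simp: dual_def[of "dual V nm"])
  \<comment> \<open>The constant \<open>C\<close> may be negative; passing to its absolute value
    requires the sign of the dual norm, which is not immediate for a real supremum.\<close>
  have dn: "0 \<le> dual_norm V nm (riesz g)" if "g \<in> V" for g
  proof (cases "nm g = 0")
    case True
    then have "g = (\<lambda>_. 0)" using definite[OF that] nm_power2[OF that] by simp
    then have "riesz g = (\<lambda>_. 0)" by (auto simp: riesz_def)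
    moreover have "{f \<in> V. nm f \<le> 1} \<noteq> {}"
      using zero_mem by (auto simp: nm_def intro!: exI[of _ "\<lambda>_. 0"])
    ultimately show ?thesis by (simp add: dual_norm_def)
  next
    case False
    then have "nm g > 0" using nm_nonneg[OF that] by linarith
    moreover have "0 \<le> nm g * dual_norm V nm (riesz g)"
      using dual_norm_bound[OF riesz_in_dual[OF that] that] by linarith
    ultimately show ?thesis by (simp add: zero_le_mult_iff)
  qed
  obtain f where f: "f \<in> V" "\<And>g. g \<in> V \<Longrightarrow> \<phi> (riesz g) = ip f g"
  proof (rule Riesz[of "\<lambda>g. \<phi> (riesz g)" "\<bar>C\<bar>"])
    show "\<phi> (riesz (\<lambda>x. f x + g x)) = \<phi> (riesz f) + \<phi> (riesz g)" if "f \<in> V" "g \<in> V" for f g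
      using \<phi> riesz_in_dual[OF that(1)] riesz_in_dual[OF that(2)]
      by (simp add: add that dual_def[of "dual V nm"])
    show "\<phi> (riesz (\<lambda>x. r * f x)) = r * \<phi> (riesz f)" if "f \<in> V" for r f
      using \<phi> riesz_in_dual[OF that] by (simp add: scale that dual_def[of "dual V nm"])
    show "\<bar>\<phi> (riesz g)\<bar> \<le> \<bar>C\<bar> * nm g" if "g \<in> V" for g
      using bspec[OF C riesz_in_dual[OF that]] dual_norm_riesz[OF that] dn[OF that]
        mult_mono[of C "\<bar>C\<bar>" "dual_norm V nm (riesz g)" "nm g"] abs_ge_self[of C] by auto
  qed blast
  show ?thesis
  proof (rule that[OF f(1)])
    fix \<sigma> assume "\<sigma> \<in> dual V nm"
    then obtain g where "g \<in> V" "\<sigma> = riesz g" by (rule dual_eq_riesz)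
    then show "\<phi> \<sigma> = \<sigma> f" using f by (simp add: riesz_def sym[of f g])
  qed
qed

lemma dual_add:
  assumes \<sigma>: "\<sigma> \<in> dual V nm" and \<tau>: "\<tau> \<in> dual V nm"
  shows "(\<lambda>b. \<sigma> b + \<tau> b) \<in> dual V nm"
proof -
  obtain g where "g \<in> V" "\<sigma> = riesz g" by (rule dual_eq_riesz[OF \<sigma>])
  moreover obtain h where "h \<in> V" "\<tau> = riesz h" by (rule dual_eq_riesz[OF \<tau>])
  ultimately show ?thesis
    using riesz_in_dual[of "\<lambda>x. g x + h x"]
    by (simp add: riesz_def[abs_def] bilinear if_distrib if_distribR cong: if_cong)
qed

lemma dual_scale:
  assumes \<sigma>: "\<sigma> \<in> dual V nm"
  shows "(\<lambda>b. r * \<sigma> b) \<in> dual V nm"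
proof -
  obtain g where "g \<in> V" "\<sigma> = riesz g" by (rule dual_eq_riesz[OF \<sigma>])
  then show ?thesis
    using riesz_in_dual[of "\<lambda>x. r * g x"]
    by (simp add: riesz_def[abs_def] bilinear if_distrib if_distribR cong: if_cong)
qed

lemma evaluation_in_bidual:
  assumes "f \<in> V"
  shows "(\<lambda>\<sigma>. if \<sigma> \<in> dual V nm then \<sigma> f else 0) \<in> dual (dual V nm) (dual_norm V nm)"
  using dual_norm_bound[OF _ assms] dual_add dual_scale
  by (subst dual_def) (auto intro!: exI[of _ "nm f"])

lemma dual_scaled_diff:
  assumes "\<sigma> \<in> dual V nm" "\<tau> \<in> dual V nm"
  shows "(\<lambda>b. (\<sigma> b - \<tau> b) / r) \<in> dual V nm"
proof -
  have "(\<lambda>b. (1 / r) * (\<sigma> b + (-1) * \<tau> b)) \<in> dual V nm"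
    by (intro dual_scale dual_add assms)
  then show ?thesis by simp
qed

text \<open>By reflexivity the weak and the weak-* topology of the dual agree, so convergence is
  tested pointwise on \<open>V\<close>.\<close>

lemma has_weak_derivative_dual_iff:
  "has_weak_derivative (dual V nm) (dual_norm V nm) I x t x' \<longleftrightarrow>
     t \<in> I \<and> t islimpt I \<and> (\<forall>s\<in>I. x s \<in> dual V nm) \<and> x' \<in> dual V nm \<and>
     (\<forall>f\<in>V. ((\<lambda>s. (x s f - x t f) / (s - t)) \<longlongrightarrow> x' f) (at t within I))"
    (is "?l \<longleftrightarrow> ?r")
proof
  assume l: ?l
  then have x: "t \<in> I" "\<forall>s\<in>I. x s \<in> dual V nm" "x' \<in> dual V nm"
    by (auto simp: has_weak_derivative_def)
  have "((\<lambda>s. (x s f - x t f) / (s - t)) \<longlongrightarrow> x' f) (at t within I)" if f: "f \<in> V" for f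
  proof -
    have "((\<lambda>s. if (\<lambda>b. (x s b - x t b) / (s - t)) \<in> dual V nm then (x s f - x t f) / (s - t) else 0)
        \<longlongrightarrow> x' f) (at t within I)"
      using l evaluation_in_bidual[OF f] x by (auto simp: has_weak_derivative_def dest!: bspec)
    \<comment> \<open>Evaluation is cut off outside the dual, but for \<open>s\<close> in
      \<open>I\<close> the difference quotient lies in the dual, so the cut-off is inactive along
      the filter.\<close>
    then show ?thesis
    proof (rule Lim_transform_eventually)
      show "\<forall>\<^sub>F s in at t within I. (if (\<lambda>b. (x s b - x t b) / (s - t)) \<in> dual V nm
          then (x s f - x t f) / (s - t) else 0) = (x s f - x t f) / (s - t)"
        unfolding eventually_at_filter using x dual_scaled_diff by (intro always_eventually) auto
    qed
  qed
  with l show ?r by (auto simp: has_weak_derivative_def)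
next
  assume r: ?r
  have "((\<lambda>s. \<phi> (\<lambda>b. (x s b - x t b) / (s - t))) \<longlongrightarrow> \<phi> x') (at t within I)"
    if \<phi>: "\<phi> \<in> dual (dual V nm) (dual_norm V nm)" for \<phi>
  proof -
    obtain f where f: "f \<in> V" "\<And>\<sigma>. \<sigma> \<in> dual V nm \<Longrightarrow> \<phi> \<sigma> = \<sigma> f"
      using bidual_eq_evaluation[OF \<phi>] by blast
    have "((\<lambda>s. (x s f - x t f) / (s - t)) \<longlongrightarrow> \<phi> x') (at t within I)"
      using r f by simp
    then show ?thesis
    proof (rule Lim_transform_eventually)
      show "\<forall>\<^sub>F s in at t within I. (x s f - x t f) / (s - t) = \<phi> (\<lambda>b. (x s b - x t b) / (s - t))"
        unfolding eventually_at_filter using r dual_scaled_diff f(2)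
        by (intro always_eventually) auto
    qed
  qed
  with r show ?l by (auto simp: has_weak_derivative_def)
qed

lemma has_weak_derivative_inner:
  assumes d: "has_weak_derivative V nm I x t x'" and g: "g \<in> V"
  shows "((\<lambda>s. ip g (\<lambda>b. (x s b - x t b) / (s - t))) \<longlongrightarrow> ip g x') (at t within I)"
proof -
  have x: "t \<in> I" "\<forall>s\<in>I. x s \<in> V" "x' \<in> V"
    using d by (auto simp: has_weak_derivative_def)
  have "((\<lambda>s. riesz g (\<lambda>b. (x s b - x t b) / (s - t))) \<longlongrightarrow> riesz g x') (at t within I)"
    using d riesz_in_dual[OF g] by (auto simp: has_weak_derivative_def)
  then have "((\<lambda>s. riesz g (\<lambda>b. (x s b - x t b) / (s - t))) \<longlongrightarrow> ip g x') (at t within I)"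
    using x by (simp add: riesz_def)
  then show ?thesis
  proof (rule Lim_transform_eventually)
    have "(\<lambda>b. (x s b - x t b) / (s - t)) \<in> V" if "s \<in> I" for s
      using scale_mem[OF diff_mem, of "x s" "x t" "1 / (s - t)"] x that by simp
    then show "\<forall>\<^sub>F s in at t within I. riesz g (\<lambda>b. (x s b - x t b) / (s - t))
        = ip g (\<lambda>b. (x s b - x t b) / (s - t))"
      unfolding eventually_at_filter by (intro always_eventually) (auto simp: riesz_def)
  qed
qed

end

section \<open>Uniqueness and existence of the RKHS\<close>

lemma is_rkhs_iff:
  "is_rkhs k H ip \<longleftrightarrow>
     hilbert_functions H ip \<and> (\<forall>x. k x \<in> H) \<and> (\<forall>f\<in>H. \<forall>x. ip f (k x) = f x)"
  unfolding is_rkhs_def hilbert_functions_def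
  by (rule iffI; elim conjE; intro conjI allI ballI impI; (simp; fail | blast))

lemma rkhs_tendsto_pointwise:
  assumes k: "is_rkhs k H ip" and F: "\<And>n. F n \<in> H" "f \<in> H"
    and lim: "(\<lambda>n. sqrt (ip (\<lambda>x. F n x - f x) (\<lambda>x. F n x - f x))) \<longlonglongrightarrow> 0"
  shows "(\<lambda>n. F n x) \<longlonglongrightarrow> f x"
proof -
  interpret hilbert_functions H ip using k by (simp add: is_rkhs_iff)
  have "(\<lambda>n. ip (F n) (k x)) \<longlonglongrightarrow> ip f (k x)"
    using k F lim by (intro tendsto_ip) (auto simp: nm_def is_rkhs_iff)
  then show ?thesis using k F by (simp add: is_rkhs_iff)
qed

text \<open>The issue is completeness. Each norm is dominated by the joint one, so a Cauchy sequence
  has a limit in both spaces, and the limits coincide because both convergences imply pointwise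
  convergence.\<close>

lemma rkhs_Int_hilbert:
  assumes 1: "is_rkhs k H1 ip1" and 2: "is_rkhs k H2 ip2"
  shows "hilbert_functions (H1 \<inter> H2) (\<lambda>f g. ip1 f g + ip2 f g)"
proof -
  interpret A: hilbert_functions H1 ip1 using 1 by (simp add: is_rkhs_iff)
  interpret B: hilbert_functions H2 ip2 using 2 by (simp add: is_rkhs_iff)
  show ?thesis
  proof
    show "fun_subspace (H1 \<inter> H2)" by (simp add: fun_subspace_def)
    show "f = (\<lambda>_. 0)" if "f \<in> H1 \<inter> H2" "ip1 f f + ip2 f f = 0" for f
      using that A.nonneg[of f] B.nonneg[of f] A.definite[of f] by auto
    fix F :: "nat \<Rightarrow> 'a \<Rightarrow> real"
    assume F: "\<And>n. F n \<in> H1 \<inter> H2"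
      and Cauchy: "\<And>e. e > 0 \<Longrightarrow> \<exists>N. \<forall>m\<ge>N. \<forall>n\<ge>N. sqrt (ip1 (\<lambda>x. F m x - F n x) (\<lambda>x. F m x - F n x)
        + ip2 (\<lambda>x. F m x - F n x) (\<lambda>x. F m x - F n x)) < e"
    have F1: "F n \<in> H1" and F2: "F n \<in> H2" for n using F by auto
    let ?q1 = "\<lambda>f. ip1 f f" and ?q2 = "\<lambda>f. ip2 f f"
    have q1: "0 \<le> ?q1 (\<lambda>x. F m x - F n x)" and q2: "0 \<le> ?q2 (\<lambda>x. F m x - F n x)" for m n
      using A.nonneg B.nonneg F1 F2 by simp_all
    obtain f1 where f1: "f1 \<in> H1" "(\<lambda>n. A.nm (\<lambda>x. F n x - f1 x)) \<longlonglongrightarrow> 0"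
    proof (rule A.Cauchy_converges[OF F1])
      fix e :: real assume "e > 0"
      then obtain N where N: "\<forall>m\<ge>N. \<forall>n\<ge>N. sqrt (?q1 (\<lambda>x. F m x - F n x) + ?q2 (\<lambda>x. F m x - F n x)) < e"
        using Cauchy by blast
      have "A.nm (\<lambda>x. F m x - F n x) < e" if "m \<ge> N" "n \<ge> N" for m n
      proof -
        have "A.nm (\<lambda>x. F m x - F n x) \<le> sqrt (?q1 (\<lambda>x. F m x - F n x) + ?q2 (\<lambda>x. F m x - F n x))"
          unfolding A.nm_def using q2 by (intro real_sqrt_le_mono) simp
        then show ?thesis using N that by (meson le_less_trans)
      qed
      then show "\<exists>N. \<forall>m\<ge>N. \<forall>n\<ge>N. A.nm (\<lambda>x. F m x - F n x) < e" by blast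
    qed
    obtain f2 where f2: "f2 \<in> H2" "(\<lambda>n. B.nm (\<lambda>x. F n x - f2 x)) \<longlonglongrightarrow> 0"
    proof (rule B.Cauchy_converges[OF F2])
      fix e :: real assume "e > 0"
      then obtain N where N: "\<forall>m\<ge>N. \<forall>n\<ge>N. sqrt (?q1 (\<lambda>x. F m x - F n x) + ?q2 (\<lambda>x. F m x - F n x)) < e"
        using Cauchy by blast
      have "B.nm (\<lambda>x. F m x - F n x) < e" if "m \<ge> N" "n \<ge> N" for m n
      proof -
        have "B.nm (\<lambda>x. F m x - F n x) \<le> sqrt (?q1 (\<lambda>x. F m x - F n x) + ?q2 (\<lambda>x. F m x - F n x))"
          unfolding B.nm_def using q1 by (intro real_sqrt_le_mono) simp
        then show ?thesis using N that by (meson le_less_trans)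
      qed
      then show "\<exists>N. \<forall>m\<ge>N. \<forall>n\<ge>N. B.nm (\<lambda>x. F m x - F n x) < e" by blast
    qed
    have "f1 x = f2 x" for x
      using rkhs_tendsto_pointwise[OF 1 F1 f1[unfolded A.nm_def], of x]
        rkhs_tendsto_pointwise[OF 2 F2 f2[unfolded B.nm_def], of x]
      by (rule LIMSEQ_unique)
    then have eq: "f1 = f2" by auto
    have "(\<lambda>n. sqrt ((A.nm (\<lambda>x. F n x - f1 x))\<^sup>2 + (B.nm (\<lambda>x. F n x - f2 x))\<^sup>2)) \<longlonglongrightarrow> sqrt (0\<^sup>2 + 0\<^sup>2)"
      by (intro tendsto_intros f1 f2)
    then have "(\<lambda>n. sqrt (?q1 (\<lambda>x. F n x - f1 x) + ?q2 (\<lambda>x. F n x - f1 x))) \<longlonglongrightarrow> 0"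
      using F1 F2 f1 f2 eq by (simp add: A.nm_power2 B.nm_power2)
    then show "\<exists>f\<in>H1 \<inter> H2. (\<lambda>n. sqrt (?q1 (\<lambda>x. F n x - f x) + ?q2 (\<lambda>x. F n x - f x))) \<longlonglongrightarrow> 0"
      using f1(1) f2(1) eq by blast
  qed (auto simp: A.bilinear B.bilinear A.nonneg B.nonneg algebra_simps intro: A.sym B.sym
      simp: A.sym[of _ "_ :: 'a \<Rightarrow> real"] B.sym[of _ "_ :: 'a \<Rightarrow> real"])
qed

text \<open>In the intersection, with the sum of the two inner products, Riesz represents \<open>\<langle>f, \<cdot>\<rangle>\<^sub>1\<close> by some \<open>h\<close>;
  testing with the kernel gives \<open>f = 2 h\<close>.\<close>

lemma rkhs_mem_inner_unique:
  assumes 1: "is_rkhs k H1 ip1" and 2: "is_rkhs k H2 ip2" and f: "f \<in> H1"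
  shows "f \<in> H2 \<and> (\<forall>g\<in>H1 \<inter> H2. ip1 f g = ip2 f g)"
proof -
  interpret A: hilbert_functions H1 ip1 using 1 by (simp add: is_rkhs_iff)
  interpret B: hilbert_functions H2 ip2 using 2 by (simp add: is_rkhs_iff)
  interpret C: hilbert_functions "H1 \<inter> H2" "\<lambda>f g. ip1 f g + ip2 f g"
    using 1 2 by (rule rkhs_Int_hilbert)
  obtain h where h: "h \<in> H1 \<inter> H2" "\<And>g. g \<in> H1 \<inter> H2 \<Longrightarrow> ip1 f g = ip1 h g + ip2 h g"
  proof (rule C.Riesz[of "ip1 f" "A.nm f"])
    show "\<bar>ip1 f g\<bar> \<le> A.nm f * C.nm g" if "g \<in> H1 \<inter> H2" for g
    proof -
      have "A.nm g \<le> C.nm g"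
        unfolding A.nm_def C.nm_def using B.nonneg[of g] that by (intro real_sqrt_le_mono) auto
      then show ?thesis
        using A.Cauchy_Schwarz[of f g] mult_left_mono[of "A.nm g" "C.nm g" "A.nm f"] f that by auto
    qed
  qed (use f in \<open>auto simp: A.bilinear\<close>)
  have "f x = 2 * h x" for x
    using h(2)[of "k x"] 1 2 h(1) f by (simp add: is_rkhs_iff)
  then have eq: "f = (\<lambda>x. 2 * h x)" by auto
  then have "f \<in> H2" using h(1) by simp
  moreover have "ip1 f g = ip2 f g" if "g \<in> H1 \<inter> H2" for g
    using h(2)[OF that] h(1) that unfolding eq by (simp add: A.scale_left B.scale_left)
  ultimately show ?thesis by blast
qed

text \<open>Evaluates the definite descriptions: any concrete model of \<open>is_rkhs\<close>
  computes \<open>rkhs\<close> and, on that space, \<open>rkhs_inner\<close>.\<close>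

lemma rkhs_eqI:
  assumes k: "is_rkhs k H ip"
  shows "rkhs k = H" and "\<And>f g. f \<in> H \<Longrightarrow> g \<in> H \<Longrightarrow> rkhs_inner k f g = ip f g"
proof -
  show eq: "rkhs k = H"
    unfolding rkhs_def
  proof (rule the_equality)
    show "\<exists>ip. is_rkhs k H ip" using k by blast
    show "H' = H" if "\<exists>ip. is_rkhs k H' ip" for H'
      using that rkhs_mem_inner_unique[OF k] rkhs_mem_inner_unique[OF _ k] by blast
  qed
  show "rkhs_inner k f g = ip f g" if "f \<in> H" "g \<in> H" for f g
    unfolding rkhs_inner_def eq
  proof (rule the_equality)
    show "\<exists>ip'. is_rkhs k H ip' \<and> ip f g = ip' f g" using k by blast
    show "r = ip f g" if "\<exists>ip'. is_rkhs k H ip' \<and> r = ip' f g" for r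
      using that rkhs_mem_inner_unique[OF k _ \<open>f \<in> H\<close>] \<open>f \<in> H\<close> \<open>g \<in> H\<close> by auto
  qed
qed

text \<open>Inner products of the same kernel are determined only on \<open>H\<close>; this
  transfers \<open>is_rkhs\<close> from a concrete model to \<open>rkhs_inner\<close>, which may
  differ from it elsewhere.\<close>

lemma is_rkhs_cong:
  assumes "is_rkhs k H ip" "\<And>f g. f \<in> H \<Longrightarrow> g \<in> H \<Longrightarrow> ip' f g = ip f g"
  shows "is_rkhs k H ip'"
proof -
  interpret hilbert_functions H ip using assms by (simp add: is_rkhs_iff)
  have "hilbert_functions H ip'"
  proof
    fix F :: "nat \<Rightarrow> 'a \<Rightarrow> real"
    assume F: "\<And>n. F n \<in> H"
      and "\<And>e. e > 0 \<Longrightarrow>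
        \<exists>N. \<forall>m\<ge>N. \<forall>n\<ge>N. sqrt (ip' (\<lambda>x. F m x - F n x) (\<lambda>x. F m x - F n x)) < e"
    then have "\<exists>f\<in>H. (\<lambda>n. sqrt (ip (\<lambda>x. F n x - f x) (\<lambda>x. F n x - f x))) \<longlonglongrightarrow> 0"
      by (intro complete) (simp_all add: assms(2))
    then show "\<exists>f\<in>H. (\<lambda>n. sqrt (ip' (\<lambda>x. F n x - f x) (\<lambda>x. F n x - f x))) \<longlonglongrightarrow> 0"
      using F by (auto simp: assms(2))
  qed (simp_all add: assms(2) subspace bilinear nonneg definite sym)
  then show ?thesis using assms by (simp add: is_rkhs_iff)
qed

lemma is_rkhs_rkhs:
  assumes "is_rkhs k H ip"
  shows "is_rkhs k (rkhs k) (rkhs_inner k)"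
  unfolding rkhs_eqI(1)[OF assms] using assms rkhs_eqI(2)[OF assms] by (rule is_rkhs_cong)

text \<open>A finitely supported weight is a list of pairs of a coefficient and a point; repeated points are allowed, so
  that addition of weights is concatenation.\<close>

definition weight_pair :: "('a \<Rightarrow> real) \<Rightarrow> (real \<times> 'a) list \<Rightarrow> real" where
  "weight_pair f u = (\<Sum>(r, x)\<leftarrow>u. r * f x)"

definition weight_scale :: "real \<Rightarrow> (real \<times> 'a) list \<Rightarrow> (real \<times> 'a) list" where
  "weight_scale t = map (\<lambda>(r, x). (t * r, x))"

lemma weight_pair_simps [simp]:
  "weight_pair f [] = 0"
  "weight_pair f ((r, x) # u) = r * f x + weight_pair f u"
  "weight_pair f (u @ v) = weight_pair f u + weight_pair f v"
  by (simp_all add: weight_pair_def)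

lemma weight_pair_scale [simp]: "weight_pair f (weight_scale t u) = t * weight_pair f u"
  by (induction u) (auto simp: weight_scale_def weight_pair_def algebra_simps)

lemma weight_pair_add: "weight_pair (\<lambda>x. f x + g x) u = weight_pair f u + weight_pair g u"
  by (induction u) (auto simp: algebra_simps)

lemma weight_pair_diff: "weight_pair (\<lambda>x. f x - g x) u = weight_pair f u - weight_pair g u"
  by (induction u) (auto simp: algebra_simps)

lemma weight_pair_mult: "weight_pair (\<lambda>x. t * f x) u = t * weight_pair f u"
  by (induction u) (auto simp: algebra_simps)

lemma weight_pair_zero [simp]: "weight_pair (\<lambda>x. 0) u = 0"
  using weight_pair_mult[of 0 "\<lambda>_. 0" u] by simp

lemma weight_pair_swap:
  "weight_pair (\<lambda>x. weight_pair (\<lambda>y. k x y) u) v = weight_pair (\<lambda>y. weight_pair (\<lambda>x. k x y) v) u"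
  by (induction v) (auto simp: weight_pair_add weight_pair_mult)

lemma weight_pair_tendsto:
  assumes "\<And>x. ((\<lambda>n. F n x) \<longlongrightarrow> f x) A"
  shows "((\<lambda>n. weight_pair (F n) u) \<longlongrightarrow> weight_pair f u) A"
  by (induction u) (auto intro!: tendsto_intros assms)

text \<open>Collects repeated points, the total coefficient of \<open>x\<close> being the pairing
  with its indicator. This links lists to the sums over finite sets in
  \<open>positive_definite_kernel\<close>.\<close>

lemma weight_pair_eq_sum:
  assumes "finite S" "snd ` set u \<subseteq> S"
  shows "weight_pair f u = (\<Sum>x\<in>S. weight_pair (\<lambda>y. if y = x then 1 else 0) u * f x)"
  using assms(2)
proof (induction u)
  case (Cons p u)
  obtain r x where p: "p = (r, x)" by (cases p)
  have "(\<Sum>y\<in>S. r * (if x = y then 1 else 0) * f y) = (\<Sum>y\<in>S. if x = y then r * f x else 0)"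
    by (intro sum.cong) auto
  then have "(\<Sum>y\<in>S. r * (if x = y then 1 else 0) * f y) = r * f x"
    using Cons.prems assms(1) p by simp
  then show ?case
    using Cons by (simp add: p distrib_right sum.distrib)
qed simp

section \<open>The Moore-Aronszajn construction\<close>

locale pd_kernel =
  fixes k :: "'a \<Rightarrow> 'a \<Rightarrow> real"
  assumes pd: "positive_definite_kernel k"
begin

lemma k_sym: "k x y = k y x"
  using pd by (simp add: positive_definite_kernel_def)

definition gram :: "(real \<times> 'a) list \<Rightarrow> (real \<times> 'a) list \<Rightarrow> real" where
  "gram u v = weight_pair (\<lambda>x. weight_pair (k x) v) u"

lemma gram_sym: "gram u v = gram v u"
proof -
  have "gram u v = weight_pair (\<lambda>x. weight_pair (\<lambda>y. k y x) v) u"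
    unfolding gram_def by (simp add: k_sym[symmetric])
  also have "\<dots> = gram v u"
    unfolding gram_def using weight_pair_swap[of k u v] by simp
  finally show ?thesis .
qed

lemma gram_simps [simp]:
  "gram (u @ u') v = gram u v + gram u' v"
  "gram u (v @ v') = gram u v + gram u v'"
  "gram (weight_scale t u) v = t * gram u v"
  "gram u (weight_scale t v) = t * gram u v"
  "gram [] v = 0" "gram u [] = 0"
  by (simp_all add: gram_def weight_pair_add weight_pair_mult)

lemma gram_nonneg: "0 \<le> gram u u"
proof -
  let ?S = "snd ` set u" and ?w = "\<lambda>x. weight_pair (\<lambda>y. if y = x then 1 else 0) u"
  have "gram u u = (\<Sum>x\<in>?S. ?w x * (\<Sum>y\<in>?S. ?w y * k x y))"
    unfolding gram_def
    by (simp add: weight_pair_eq_sum[of ?S u "k _"] weight_pair_eq_sum[of ?S u "\<lambda>x. \<Sum>y\<in>?S. _ x y"]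
        cong: sum.cong)
  also have "\<dots> = (\<Sum>x\<in>?S. \<Sum>y\<in>?S. ?w x * ?w y * k x y)"
    by (simp add: sum_distrib_left mult.assoc)
  also have "\<dots> \<ge> 0"
    using pd by (simp add: positive_definite_kernel_def)
  finally show ?thesis .
qed

text \<open>The RKHS is realised as the dual of the space of weights with the Gram form; \<open>energy f\<close> is the
  squared dual norm.\<close>

definition deficit :: "('a \<Rightarrow> real) \<Rightarrow> (real \<times> 'a) list \<Rightarrow> real" where
  "deficit f u = 2 * weight_pair f u - gram u u"

definition finite_energy :: "('a \<Rightarrow> real) set" where
  "finite_energy = {f. bdd_above (range (deficit f))}"

definition energy :: "('a \<Rightarrow> real) \<Rightarrow> real" where
  "energy f = (SUP u. deficit f u)"

lemma deficit_le_energy: "f \<in> finite_energy \<Longrightarrow> deficit f u \<le> energy f"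
  unfolding energy_def finite_energy_def by (auto intro: cSUP_upper)

lemma energyI:
  assumes "\<And>u. deficit f u \<le> C"
  shows "f \<in> finite_energy" "energy f \<le> C"
  unfolding energy_def finite_energy_def using assms by (auto intro!: bdd_aboveI2 cSUP_least)

lemma energy_nonneg: "f \<in> finite_energy \<Longrightarrow> 0 \<le> energy f"
  using deficit_le_energy[of f "[]"] by (simp add: deficit_def)

lemma finite_energy_zero: "(\<lambda>_. 0) \<in> finite_energy" "energy (\<lambda>_. 0) = 0"
proof -
  have "deficit (\<lambda>_. 0) u \<le> 0" for u using gram_nonneg[of u] by (simp add: deficit_def)
  from energyI[OF this] show "(\<lambda>_. 0) \<in> finite_energy" "energy (\<lambda>_. 0) = 0"
    using energy_nonneg[of "\<lambda>_. 0"] by auto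
qed

lemma deficit_scale: "t \<noteq> 0 \<Longrightarrow> deficit (\<lambda>x. t * f x) u = t\<^sup>2 * deficit f (weight_scale (1 / t) u)"
  by (simp add: deficit_def weight_pair_mult power2_eq_square field_simps)

text \<open>The inequality for \<open>t\<close>, together with the one for \<open>1 / t\<close>
  applied to the scaled function, gives equality.\<close>

lemma finite_energy_scale:
  assumes "f \<in> finite_energy"
  shows "(\<lambda>x. t * f x) \<in> finite_energy" and "energy (\<lambda>x. t * f x) = t\<^sup>2 * energy f"
proof -
  have le: "(\<lambda>x. t * f x) \<in> finite_energy \<and> energy (\<lambda>x. t * f x) \<le> t\<^sup>2 * energy f"
    if "f \<in> finite_energy" for t f
  proof (cases "t = 0")
    case True
    then show ?thesis using finite_energy_zero by simp
  next
    case False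
    have "deficit (\<lambda>x. t * f x) u \<le> t\<^sup>2 * energy f" for u
      unfolding deficit_scale[OF False] by (intro mult_left_mono deficit_le_energy that) simp
    then show ?thesis using energyI by blast
  qed
  then show m: "(\<lambda>x. t * f x) \<in> finite_energy" using assms by blast
  show "energy (\<lambda>x. t * f x) = t\<^sup>2 * energy f"
  proof (cases "t = 0")
    case True
    then show ?thesis using finite_energy_zero by simp
  next
    case False
    have "energy f \<le> (1 / t)\<^sup>2 * energy (\<lambda>x. t * f x)"
      using le[OF m, of "1 / t"] False by simp
    then have "t\<^sup>2 * energy f \<le> energy (\<lambda>x. t * f x)"
      using False by (simp add: field_simps)
    then show ?thesis using le[OF assms, of t] by auto
  qed
qed

text \<open>\<open>deficit\<close> is affine in the function, and the sum is the average of
  \<open>2 f\<close> and \<open>2 g\<close>.\<close>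

lemma finite_energy_add:
  assumes "f \<in> finite_energy" "g \<in> finite_energy"
  shows "(\<lambda>x. f x + g x) \<in> finite_energy"
proof (rule energyI)
  fix u
  have "deficit (\<lambda>x. f x + g x) u = (1/2) * (deficit (\<lambda>x. 2 * f x) u + deficit (\<lambda>x. 2 * g x) u)"
    by (simp add: deficit_def weight_pair_add weight_pair_mult)
  also have "\<dots> \<le> (1/2) * (energy (\<lambda>x. 2 * f x) + energy (\<lambda>x. 2 * g x))"
    by (intro mult_left_mono add_mono deficit_le_energy finite_energy_scale assms) simp
  finally show "deficit (\<lambda>x. f x + g x) u
    \<le> (1/2) * (energy (\<lambda>x. 2 * f x) + energy (\<lambda>x. 2 * g x))" .
qed

lemma finite_energy_diff:
  "f \<in> finite_energy \<Longrightarrow> g \<in> finite_energy \<Longrightarrow> (\<lambda>x. f x - g x) \<in> finite_energy"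
  using finite_energy_add[OF _ finite_energy_scale(1), of f g "-1"] by simp

text \<open>Testing \<open>f + g\<close> with \<open>u + v\<close> and \<open>f - g\<close> with
  \<open>u - v\<close> separates into deficits of \<open>f\<close> at \<open>u\<close> and
  \<open>g\<close> at \<open>v\<close>, by the parallelogram law of the Gram form. This is one
  inequality; the other is the same one for \<open>f + g\<close> and \<open>f - g\<close>, whose sum
  and difference are \<open>2 f\<close> and \<open>2 g\<close>.\<close>

lemma energy_parallelogram:
  assumes f: "f \<in> finite_energy" and g: "g \<in> finite_energy"
  shows "energy (\<lambda>x. f x + g x) + energy (\<lambda>x. f x - g x) = 2 * energy f + 2 * energy g"
proof -
  have le: "2 * energy f + 2 * energy g \<le> energy (\<lambda>x. f x + g x) + energy (\<lambda>x. f x - g x)"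
    (is "_ \<le> ?R") if f: "f \<in> finite_energy" and g: "g \<in> finite_energy" for f g
  proof -
    have *: "2 * deficit f u + 2 * deficit g v \<le> ?R" for u v
    proof -
      have "2 * deficit f u + 2 * deficit g v
          = deficit (\<lambda>x. f x + g x) (u @ v) + deficit (\<lambda>x. f x - g x) (u @ weight_scale (-1) v)"
        by (simp add: deficit_def weight_pair_add weight_pair_diff gram_sym[of v u])
      also have "\<dots> \<le> ?R"
        by (intro add_mono deficit_le_energy finite_energy_add finite_energy_diff f g)
      finally show ?thesis .
    qed
    \<comment> \<open>The suprema over \<open>u\<close> and over \<open>v\<close> are taken one
      after the other.\<close>
    have "energy f \<le> ?R / 2 - deficit g v" for v
      using *[of _ v] by (intro energyI) (simp add: field_simps)
    then have "deficit g v \<le> ?R / 2 - energy f" for v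
      by (simp add: algebra_simps)
    then have "energy g \<le> ?R / 2 - energy f" by (intro energyI)
    then show ?thesis by argo
  qed
  have "2 * energy (\<lambda>x. f x + g x) + 2 * energy (\<lambda>x. f x - g x)
      \<le> energy (\<lambda>x. 2 * f x) + energy (\<lambda>x. 2 * g x)"
    using le[OF finite_energy_add[OF f g] finite_energy_diff[OF f g]] by simp
  then show ?thesis
    using le[OF f g] by (simp add: finite_energy_scale f g)
qed

text \<open>Cauchy-Schwarz for the dual norm, by optimising over multiples of \<open>u\<close>. For
  a null vector of the Gram form the bound is linear in the multiple, which forces the pairing to
  vanish.\<close>

lemma weight_pair_power2_le:
  assumes "f \<in> finite_energy"
  shows "(weight_pair f u)\<^sup>2 \<le> energy f * gram u u"
proof -
  have quad: "2 * t * weight_pair f u - t\<^sup>2 * gram u u \<le> energy f" for t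
    using deficit_le_energy[OF assms, of "weight_scale t u"]
    by (simp add: deficit_def power2_eq_square mult_ac)
  show ?thesis
  proof (cases "gram u u = 0")
    case True
    have "weight_pair f u = 0"
    proof (rule ccontr)
      assume "weight_pair f u \<noteq> 0"
      then show False
        using quad[of "(energy f + 1) / (2 * weight_pair f u)"] True by simp
    qed
    then show ?thesis using True by simp
  next
    case False
    then have "gram u u > 0" using gram_nonneg[of u] by simp
    then show ?thesis
      using quad[of "weight_pair f u / gram u u"] by (simp add: field_simps power2_eq_square)
  qed
qed

lemma power2_le_energy: "f \<in> finite_energy \<Longrightarrow> (f x)\<^sup>2 \<le> energy f * k x x"
  using weight_pair_power2_le[of f "[(1, x)]"] by (simp add: gram_def)

text \<open>Adding \<open>t * k x\<close> completes a square: it translates the test weight by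
  \<open>- t\<close> at \<open>x\<close>. The inequality for \<open>t\<close> is reversed by the one
  for \<open>- t\<close>. The two signs are those of polarisation against \<open>k x\<close>, so the
  reproducing property can be read off.\<close>

lemma energy_add_kernel:
  assumes f: "f \<in> finite_energy" and t: "t = 1 \<or> t = -1"
  shows "(\<lambda>y. f y + t * k x y) \<in> finite_energy"
    and "energy (\<lambda>y. f y + t * k x y) = energy f + 2 * t * f x + k x x"
proof -
  have shift: "deficit (\<lambda>y. f y + t * k x y) u
      = deficit f (u @ weight_scale (-t) [(1, x)]) + 2 * t * f x + k x x"
    if t: "t = 1 \<or> t = -1" for u f t
  proof -
    have "weight_pair (k x) u = gram u [(1, x)]"
      by (subst gram_sym) (simp add: gram_def)
    moreover have "gram [(1, x)] u = gram u [(1, x)]"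
      by (rule gram_sym)
    moreover have "gram [(1, x)] [(1, x)] = k x x" by (simp add: gram_def)
    ultimately show ?thesis
      using t by (auto simp: deficit_def weight_pair_add weight_pair_mult algebra_simps)
  qed
  have le: "(\<lambda>y. f y + t * k x y) \<in> finite_energy \<and>
      energy (\<lambda>y. f y + t * k x y) \<le> energy f + 2 * t * f x + k x x"
    if "f \<in> finite_energy" "t = 1 \<or> t = -1" for f t
  proof -
    have "deficit (\<lambda>y. f y + t * k x y) u \<le> energy f + 2 * t * f x + k x x" for u
      unfolding shift[OF that(2)] by (intro add_mono deficit_le_energy that order_refl)
    then show ?thesis using energyI by blast
  qed
  show m: "(\<lambda>y. f y + t * k x y) \<in> finite_energy" using le[OF f t] by blast
  have "energy f \<le> energy (\<lambda>y. f y + t * k x y) + 2 * (- t) * (f x + t * k x x) + k x x"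
    using le[OF m, of "- t"] t by auto
  then have "energy f + 2 * t * f x + k x x \<le> energy (\<lambda>y. f y + t * k x y)"
    using t by (auto simp: algebra_simps)
  then show "energy (\<lambda>y. f y + t * k x y) = energy f + 2 * t * f x + k x x"
    using le[OF f t] by simp
qed

text \<open>Jordan--von Neumann: the parallelogram law turns polarisation into an inner product.\<close>

definition energy_inner :: "('a \<Rightarrow> real) \<Rightarrow> ('a \<Rightarrow> real) \<Rightarrow> real" where
  "energy_inner f g = (energy (\<lambda>x. f x + g x) - energy (\<lambda>x. f x - g x)) / 4"

lemma energy_minus: "f \<in> finite_energy \<Longrightarrow> energy (\<lambda>x. - f x) = energy f"
  using finite_energy_scale(2)[of f "-1"] by simp

lemma energy_minus_commute:
  assumes "f \<in> finite_energy" "g \<in> finite_energy"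
  shows "energy (\<lambda>x. f x - g x) = energy (\<lambda>x. g x - f x)"
  using energy_minus[OF finite_energy_diff[OF assms]] by simp

lemma energy_inner_sym:
  "f \<in> finite_energy \<Longrightarrow> g \<in> finite_energy \<Longrightarrow> energy_inner f g = energy_inner g f"
  unfolding energy_inner_def by (simp add: energy_minus_commute[of f g] add.commute)

lemma energy_inner_self: "f \<in> finite_energy \<Longrightarrow> energy_inner f f = energy f"
  using finite_energy_scale(2)[of f 2] finite_energy_zero by (simp add: energy_inner_def)

text \<open>The parallelogram law at \<open>f + h\<close>, \<open>f - h\<close> against
  \<open>g\<close>, and at \<open>g + h\<close>, \<open>g - h\<close> against \<open>f\<close>: the
  energies in which \<open>f\<close> and \<open>g\<close> have opposite signs cancel.\<close>

lemma energy_inner_add: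
  assumes f: "f \<in> finite_energy" and g: "g \<in> finite_energy" and h: "h \<in> finite_energy"
  shows "energy_inner (\<lambda>x. f x + g x) h = energy_inner f h + energy_inner g h"
proof -
  note mem = finite_energy_add finite_energy_diff f g h
  have "energy (\<lambda>x. (f x + h x) + g x) + energy (\<lambda>x. (f x + h x) - g x)
      = 2 * energy (\<lambda>x. f x + h x) + 2 * energy g"
    by (intro energy_parallelogram mem)
  moreover have "energy (\<lambda>x. (f x - h x) + g x) + energy (\<lambda>x. (f x - h x) - g x)
      = 2 * energy (\<lambda>x. f x - h x) + 2 * energy g"
    by (intro energy_parallelogram mem)
  moreover have "energy (\<lambda>x. (g x + h x) + f x) + energy (\<lambda>x. (g x + h x) - f x)
      = 2 * energy (\<lambda>x. g x + h x) + 2 * energy f"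
    by (intro energy_parallelogram mem)
  moreover have "energy (\<lambda>x. (g x - h x) + f x) + energy (\<lambda>x. (g x - h x) - f x)
      = 2 * energy (\<lambda>x. g x - h x) + 2 * energy f"
    by (intro energy_parallelogram mem)
  moreover have "energy (\<lambda>x. (f x + h x) - g x) = energy (\<lambda>x. (g x - h x) - f x)"
    using energy_minus_commute[of "\<lambda>x. f x + h x" g] mem by (simp add: algebra_simps)
  moreover have "energy (\<lambda>x. (f x - h x) - g x) = energy (\<lambda>x. (g x + h x) - f x)"
    using energy_minus_commute[of "\<lambda>x. f x - h x" g] mem by (simp add: algebra_simps)
  ultimately have
    "energy (\<lambda>x. (f x + g x) + h x) - energy (\<lambda>x. (f x + g x) - h x)
      = (energy (\<lambda>x. f x + h x) - energy (\<lambda>x. f x - h x))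
        + (energy (\<lambda>x. g x + h x) - energy (\<lambda>x. g x - h x))"
    by (simp add: algebra_simps)
  then show ?thesis unfolding energy_inner_def by (simp add: add_divide_distrib)
qed

lemma abs_energy_inner_le:
  assumes f: "f \<in> finite_energy" and g: "g \<in> finite_energy"
  shows "\<bar>energy_inner f g\<bar> \<le> energy f + energy g"
proof -
  have "0 \<le> energy (\<lambda>x. f x + g x)" "0 \<le> energy (\<lambda>x. f x - g x)"
    by (intro energy_nonneg finite_energy_add finite_energy_diff f g)+
  then show ?thesis
    using energy_parallelogram[OF f g] energy_nonneg[OF f] energy_nonneg[OF g]
    unfolding energy_inner_def by (auto simp: abs_if field_simps)
qed

text \<open>The defect \<open>D\<close> of homogeneity is additive in \<open>t\<close> and vanishes at \<open>1\<close>, so it is periodic and hence bounded;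
  a bounded additive function is zero.\<close>

lemma energy_inner_scale:
  assumes f: "f \<in> finite_energy" and g: "g \<in> finite_energy"
  shows "energy_inner (\<lambda>x. t * f x) g = t * energy_inner f g"
proof -
  define D where "D t = energy_inner (\<lambda>x. t * f x) g - t * energy_inner f g" for t
  have add: "D (s + t) = D s + D t" for s t
    using energy_inner_add[OF finite_energy_scale(1)[OF f] finite_energy_scale(1)[OF f] g, of s t]
    by (simp add: D_def distrib_right)
  have one: "D 1 = 0" by (simp add: D_def)
  have zero: "D 0 = 0" using add[of 0 0] by simp
  have nat: "D (real n * t) = real n * D t" for n t
    by (induction n) (auto simp: zero add distrib_right)
  have neg: "D (- t) = - D t" for t using add[of t "- t"] zero by simp
  have int: "D (of_int n) = 0" for n
  proof (cases n)
    case (nonneg m)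
    then show ?thesis using nat[of m 1] one by simp
  next
    case (neg m)
    then show ?thesis using nat[of "Suc m" 1] one \<open>D (- real (Suc m)) = - D (real (Suc m))\<close>
      by (simp del: of_nat_Suc)
  qed
  define M where "M = energy f + energy g + \<bar>energy_inner f g\<bar>"
  have bounded: "\<bar>D t\<bar> \<le> M" for t
  proof -
    have "D t = D (of_int \<lfloor>t\<rfloor> + frac t)" by (simp add: frac_def)
    then have "D t = D (frac t)" by (simp add: add int)
    moreover have "\<bar>energy_inner (\<lambda>x. frac t * f x) g\<bar> \<le> (frac t)\<^sup>2 * energy f + energy g"
      using abs_energy_inner_le[OF finite_energy_scale(1)[OF f] g] by (simp add: finite_energy_scale f)
    moreover have "(frac t)\<^sup>2 * energy f \<le> 1 * energy f"
      using frac_ge_0[of t] frac_lt_1[of t] energy_nonneg[OF f]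
      by (intro mult_right_mono) (auto simp: power_le_one)
    moreover have "\<bar>frac t * energy_inner f g\<bar> \<le> \<bar>energy_inner f g\<bar>"
      using frac_ge_0[of t] frac_lt_1[of t] by (simp add: abs_mult mult_left_le_one_le)
    ultimately show ?thesis unfolding D_def M_def by argo
  qed
  have "D t = 0"
  proof (rule ccontr)
    assume "D t \<noteq> 0"
    then obtain n :: nat where "M < real n * \<bar>D t\<bar>"
      using reals_Archimedean3[of "\<bar>D t\<bar>"] by auto
    then show False using bounded[of "real n * t"] by (simp add: nat abs_mult)
  qed
  then show ?thesis by (simp add: D_def)
qed

text \<open>The energy bounds point values, so there is a pointwise limit. Each deficit involves
  finitely many points and passes to that limit, with a bound uniform in the weight; the supremum
  then bounds the energy of the tail.\<close>

lemma energy_complete: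
  assumes F: "\<And>n::nat. F n \<in> finite_energy"
    and Cauchy: "\<And>e. e > 0 \<Longrightarrow> \<exists>N. \<forall>m\<ge>N. \<forall>n\<ge>N. sqrt (energy (\<lambda>x. F m x - F n x)) < e"
  shows "\<exists>f\<in>finite_energy. (\<lambda>n. sqrt (energy (\<lambda>x. F n x - f x))) \<longlonglongrightarrow> 0"
proof -
  have "Cauchy (\<lambda>n. F n x)" for x
  proof (rule metric_CauchyI)
    fix e :: real assume "e > 0"
    \<comment> \<open>The tolerance below is divided by \<open>K + 1\<close>, because
      \<open>k x x\<close> may be 0.\<close>
    define K where "K = sqrt (k x x)"
    have "k x x \<ge> 0" using gram_nonneg[of "[(1, x)]"] by (simp add: gram_def)
    then have "K \<ge> 0" by (simp add: K_def)
    with \<open>e > 0\<close> have "e / (K + 1) > 0" by simp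
    from Cauchy[OF this] obtain N where N: "\<forall>m\<ge>N. \<forall>n\<ge>N. sqrt (energy (\<lambda>x. F m x - F n x)) < e / (K + 1)"
      by blast
    have "dist (F m x) (F n x) < e" if "m \<ge> N" "n \<ge> N" for m n
    proof -
      have "\<bar>F m x - F n x\<bar> \<le> sqrt (energy (\<lambda>x. F m x - F n x) * k x x)"
        using power2_le_energy[OF finite_energy_diff[OF F[of m] F[of n]], of x]
        by (metis real_sqrt_abs real_sqrt_le_mono)
      also have "\<dots> = sqrt (energy (\<lambda>x. F m x - F n x)) * K"
        by (simp add: real_sqrt_mult K_def)
      also have "\<dots> \<le> e / (K + 1) * K"
        using N that \<open>K \<ge> 0\<close> by (intro mult_right_mono) (auto intro: less_imp_le)
      also have "\<dots> < e"
        using \<open>K \<ge> 0\<close> \<open>e > 0\<close> by (simp add: field_simps)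
      finally show ?thesis by (simp add: dist_real_def)
    qed
    then show "\<exists>N. \<forall>m\<ge>N. \<forall>n\<ge>N. dist (F m x) (F n x) < e" by blast
  qed
  define f where "f x = lim (\<lambda>n. F n x)" for x
  have f: "(\<lambda>n. F n x) \<longlonglongrightarrow> f x" for x
    using Cauchy_convergent[OF \<open>Cauchy (\<lambda>n. F n x)\<close>] by (simp add: f_def convergent_LIMSEQ_iff)
  have tail: "\<exists>N. \<forall>m\<ge>N. (\<lambda>x. F m x - f x) \<in> finite_energy \<and> energy (\<lambda>x. F m x - f x) \<le> e\<^sup>2"
    if "e > 0" for e
  proof -
    obtain N where N: "\<forall>m\<ge>N. \<forall>n\<ge>N. sqrt (energy (\<lambda>x. F m x - F n x)) < e"
      using Cauchy[OF \<open>e > 0\<close>] by blast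
    have "deficit (\<lambda>x. F m x - f x) u \<le> e\<^sup>2" if m: "m \<ge> N" for m u
    proof (rule tendsto_upperbound)
      show "(\<lambda>n. deficit (\<lambda>x. F m x - F n x) u) \<longlonglongrightarrow> deficit (\<lambda>x. F m x - f x) u"
        unfolding deficit_def by (intro tendsto_intros weight_pair_tendsto f)
      show "\<forall>\<^sub>F n in sequentially. deficit (\<lambda>x. F m x - F n x) u \<le> e\<^sup>2"
        using eventually_ge_at_top[of N]
      proof eventually_elim
        case (elim n)
        have "deficit (\<lambda>x. F m x - F n x) u \<le> energy (\<lambda>x. F m x - F n x)"
          by (intro deficit_le_energy finite_energy_diff F)
        also have "\<dots> = (sqrt (energy (\<lambda>x. F m x - F n x)))\<^sup>2"
          using energy_nonneg[OF finite_energy_diff[OF F F]] by simp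
        also have "\<dots> \<le> e\<^sup>2"
          using N m elim energy_nonneg[OF finite_energy_diff[OF F F]]
          by (intro power_mono) (auto intro: less_imp_le)
        finally show ?case .
      qed
    qed simp
    then show ?thesis using energyI by blast
  qed
  obtain N where "(\<lambda>x. F N x - f x) \<in> finite_energy"
    using tail[of 1] by auto
  \<comment> \<open>The limit is recovered as \<open>F N - (F N - f)\<close>.\<close>
  from finite_energy_diff[OF F this, of N] have mem: "f \<in> finite_energy" by simp
  have "(\<lambda>n. sqrt (energy (\<lambda>x. F n x - f x))) \<longlonglongrightarrow> 0"
  proof (rule LIMSEQ_I)
    fix e :: real assume "e > 0"
    then obtain N where N: "\<forall>m\<ge>N. energy (\<lambda>x. F m x - f x) \<le> (e / 2)\<^sup>2"
      using tail[of "e / 2"] by auto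
    have "norm (sqrt (energy (\<lambda>x. F m x - f x)) - 0) < e" if "m \<ge> N" for m
    proof -
      have "sqrt (energy (\<lambda>x. F m x - f x)) \<le> sqrt ((e / 2)\<^sup>2)"
        using N that by (intro real_sqrt_le_mono) blast
      then show ?thesis
        using \<open>e > 0\<close> energy_nonneg[OF finite_energy_diff[OF F mem, of m]] by simp
    qed
    then show "\<exists>N. \<forall>m\<ge>N. norm (sqrt (energy (\<lambda>x. F m x - f x)) - 0) < e" by blast
  qed
  with mem show ?thesis by blast
qed

lemma Moore_Aronszajn: "is_rkhs k finite_energy energy_inner"
  unfolding is_rkhs_iff
proof (intro conjI ballI allI)
  show "hilbert_functions finite_energy energy_inner"
  proof
    show "fun_subspace finite_energy"
      by (simp add: fun_subspace_def finite_energy_zero finite_energy_add finite_energy_scale)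
    show "f = (\<lambda>_. 0)" if "f \<in> finite_energy" "energy_inner f f = 0" for f
      using that power2_le_energy[of f] by (auto simp: energy_inner_self)
  qed (simp_all add: energy_inner_sym energy_inner_add energy_inner_scale energy_inner_self
      energy_nonneg finite_energy_diff energy_complete)
  show "k x \<in> finite_energy" for x
    using energy_add_kernel(1)[OF finite_energy_zero(1), of 1 x] by simp
  show "energy_inner f (k x) = f x" if "f \<in> finite_energy" for f x
    using energy_add_kernel(2)[OF that, of 1 x] energy_add_kernel(2)[OF that, of "-1" x]
    by (simp add: energy_inner_def)
qed

end

text \<open>Multiplication by \<open>a\<close> is made an isometry from the old space onto the new
  one. For \<open>k_mu\<close> this describes its RKHS as \<open>a\<close> times that of
  \<open>k_c\<close>.\<close>

lemma is_rkhs_rescale: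
  fixes a :: "'a \<Rightarrow> real"
  assumes k: "is_rkhs k H ip" and a: "\<And>x. a x \<noteq> 0"
  shows "is_rkhs (\<lambda>x y. a x * a y * k x y) {f. (\<lambda>x. f x / a x) \<in> H}
    (\<lambda>f g. ip (\<lambda>x. f x / a x) (\<lambda>x. g x / a x))"
  unfolding is_rkhs_iff
proof (intro conjI ballI allI)
  interpret hilbert_functions H ip using k by (simp add: is_rkhs_iff)
  show "hilbert_functions {f. (\<lambda>x. f x / a x) \<in> H} (\<lambda>f g. ip (\<lambda>x. f x / a x) (\<lambda>x. g x / a x))"
  proof
    show "fun_subspace {f. (\<lambda>x. f x / a x) \<in> H}"
    proof -
      have "(\<lambda>x. r * f x / a x) \<in> H" if "(\<lambda>x. f x / a x) \<in> H" for r f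
        using scale_mem[OF that, of r] by simp
      then show ?thesis by (simp add: fun_subspace_def add_divide_distrib)
    qed
    show "ip (\<lambda>x. r * f x / a x) (\<lambda>x. h x / a x) = r * ip (\<lambda>x. f x / a x) (\<lambda>x. h x / a x)"
      if "f \<in> {f. (\<lambda>x. f x / a x) \<in> H}" "h \<in> {f. (\<lambda>x. f x / a x) \<in> H}" for f h r
      using scale_left[of "\<lambda>x. f x / a x" "\<lambda>x. h x / a x" r] that by simp
    show "f = (\<lambda>_. 0)"
      if "f \<in> {f. (\<lambda>x. f x / a x) \<in> H}" "ip (\<lambda>x. f x / a x) (\<lambda>x. f x / a x) = 0" for f
      using definite[of "\<lambda>x. f x / a x"] that a by (auto simp: fun_eq_iff)
    fix F :: "nat \<Rightarrow> 'a \<Rightarrow> real"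
    assume F: "\<And>n. F n \<in> {f. (\<lambda>x. f x / a x) \<in> H}"
      and C: "\<And>e. e > 0 \<Longrightarrow> \<exists>N. \<forall>m\<ge>N. \<forall>n\<ge>N. sqrt (ip (\<lambda>x. (F m x - F n x) / a x)
        (\<lambda>x. (F m x - F n x) / a x)) < e"
    have "\<exists>f\<in>H. (\<lambda>n. sqrt (ip (\<lambda>x. F n x / a x - f x) (\<lambda>x. F n x / a x - f x))) \<longlonglongrightarrow> 0"
      using F C by (intro complete) (auto simp: diff_divide_distrib)
    then obtain f where f: "f \<in> H"
      "(\<lambda>n. sqrt (ip (\<lambda>x. F n x / a x - f x) (\<lambda>x. F n x / a x - f x))) \<longlonglongrightarrow> 0" by blast
    show "\<exists>f\<in>{f. (\<lambda>x. f x / a x) \<in> H}.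
      (\<lambda>n. sqrt (ip (\<lambda>x. (F n x - f x) / a x) (\<lambda>x. (F n x - f x) / a x))) \<longlonglongrightarrow> 0"
      using f by (intro bexI[of _ "\<lambda>x. a x * f x"]) (simp_all add: diff_divide_distrib a)
  qed (simp_all add: add_divide_distrib bilinear nonneg sym)
  have div: "(\<lambda>y. a x * a y * k x y / a y) = (\<lambda>y. a x * k x y)" for x
    using a by (simp add: fun_eq_iff)
  show "(\<lambda>y. a x * a y * k x y) \<in> {f. (\<lambda>x. f x / a x) \<in> H}" for x
    using k scale_mem div[of x] by (simp only: mem_Collect_eq is_rkhs_iff)
  show "ip (\<lambda>x. f x / a x) (\<lambda>y. a x * a y * k x y / a y) = f x"
    if "f \<in> {f. (\<lambda>x. f x / a x) \<in> H}" for f x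
    unfolding div using k that a by (simp add: is_rkhs_iff scale_right)
qed

context hilbert_functions
begin

text \<open>Zarantonello's argument: \<open>f \<mapsto> (1 - \<tau>) f + \<tau> T f\<close> is a contraction for \<open>\<tau> = 1 / (1 + L\<^sup>2)\<close>.\<close>

lemma monotone_fixpoint:
  assumes T: "\<And>f. f \<in> V \<Longrightarrow> T f \<in> V"
    and mono: "\<And>f g. f \<in> V \<Longrightarrow> g \<in> V \<Longrightarrow> ip (\<lambda>x. T f x - T g x) (\<lambda>x. f x - g x) \<le> 0"
    and Lip: "\<And>f g. f \<in> V \<Longrightarrow> g \<in> V \<Longrightarrow> nm (\<lambda>x. T f x - T g x) \<le> L * nm (\<lambda>x. f x - g x)"
  obtains f where "f \<in> V" "T f = f"
proof -
  define \<tau> where "\<tau> = 1 / (1 + L\<^sup>2)"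
  have pos: "1 + L\<^sup>2 > 0" by (smt (verit) zero_le_power2)
  then have \<tau>: "0 < \<tau>" "\<tau> \<le> 1" by (auto simp: \<tau>_def)
  define S where "S f = (\<lambda>x. (1 - \<tau>) * f x + \<tau> * T f x)" for f
  \<comment> \<open>\<open>r\<^sup>2\<close> is the minimum over \<tau> of
    \<open>(1 - \<tau>)\<^sup>2 + \<tau>\<^sup>2 * L\<^sup>2\<close>, attained at the chosen \<tau>;
    the mixed term of the expansion is nonpositive by monotonicity.\<close>
  define r where "r = sqrt (L\<^sup>2 / (1 + L\<^sup>2))"
  have r: "0 \<le> r" "r < 1"
    using pos by (auto simp: r_def)
  have r2: "(1 - \<tau>)\<^sup>2 + \<tau>\<^sup>2 * L\<^sup>2 = r\<^sup>2"
  proof -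
    have 1: "1 - \<tau> = L\<^sup>2 * \<tau>" using pos by (simp add: \<tau>_def field_simps)
    have "r\<^sup>2 = L\<^sup>2 * \<tau>" using pos by (simp add: r_def \<tau>_def)
    moreover have "(1 - \<tau>)\<^sup>2 + \<tau>\<^sup>2 * L\<^sup>2 = L\<^sup>2 * \<tau> * ((1 + L\<^sup>2) * \<tau>)"
      unfolding 1 by (simp add: power2_eq_square algebra_simps)
    moreover have "(1 + L\<^sup>2) * \<tau> = 1" using pos by (simp add: \<tau>_def)
    ultimately show ?thesis by simp
  qed
  have S: "S f \<in> V" if "f \<in> V" for f using that T by (simp add: S_def)
  have "nm (\<lambda>x. S f x - S g x) \<le> r * nm (\<lambda>x. f x - g x)" if f: "f \<in> V" and g: "g \<in> V" for f g
  proof (rule power2_le_imp_le)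
    define d e where "d = (\<lambda>x. f x - g x)" and "e = (\<lambda>x. T f x - T g x)"
    have de: "d \<in> V" "e \<in> V" using f g T by (auto simp: d_def e_def)
    have "(\<lambda>x. S f x - S g x) = (\<lambda>x. (1 - \<tau>) * d x + \<tau> * e x)"
      by (simp add: S_def d_def e_def algebra_simps)
    then have "(nm (\<lambda>x. S f x - S g x))\<^sup>2
        = (1 - \<tau>)\<^sup>2 * (nm d)\<^sup>2 + 2 * (\<tau> * (1 - \<tau>)) * ip e d + \<tau>\<^sup>2 * (nm e)\<^sup>2"
      using de by (simp add: nm_power2 bilinear sym[of d e]) (simp add: power2_eq_square algebra_simps)
    also have "\<dots> \<le> (1 - \<tau>)\<^sup>2 * (nm d)\<^sup>2 + 0 + \<tau>\<^sup>2 * (L * nm d)\<^sup>2"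
    proof (intro add_mono mult_left_mono power_mono)
      show "nm e \<le> L * nm d" using Lip[OF f g] by (simp add: d_def e_def)
      show "2 * (\<tau> * (1 - \<tau>)) * ip e d \<le> 0"
        using mono[OF f g] \<tau> by (intro mult_nonneg_nonpos) (auto simp: d_def e_def)
    qed (use de in auto)
    also have "\<dots> = ((1 - \<tau>)\<^sup>2 + \<tau>\<^sup>2 * L\<^sup>2) * (nm d)\<^sup>2"
      by (simp add: power_mult_distrib algebra_simps)
    also have "\<dots> = (r * nm d)\<^sup>2"
      unfolding r2 by (simp add: power_mult_distrib)
    finally show "(nm (\<lambda>x. S f x - S g x))\<^sup>2 \<le> (r * nm (\<lambda>x. f x - g x))\<^sup>2"
      by (simp add: d_def)
  qed (use f g r in simp)
  from contraction_fixpoint[OF S r this] obtain f where f: "f \<in> V" "S f = f" .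
  have "T f x = f x" for x
    using fun_cong[OF f(2), of x] \<tau> by (simp add: S_def algebra_simps)
  then show ?thesis using that f(1) by blast
qed

end

section \<open>RKHSs of continuous kernels on compact spaces\<close>

lemma continuous_imp_bounded_on_compact:
  fixes f :: "'a::metric_space \<Rightarrow> real"
  assumes "compact (UNIV :: 'a set)" "continuous_on UNIV f"
  obtains B where "0 \<le> B" "\<And>x. \<bar>f x\<bar> \<le> B"
proof -
  have "bounded (range f)"
    using assms by (intro compact_imp_bounded compact_continuous_image)
  then obtain B where "B > 0" "\<forall>y\<in>range f. norm y \<le> B" by (auto simp: bounded_pos)
  then show ?thesis by (intro that[of B]) auto
qed

locale borel_prob = prob_space M for M :: "'a::metric_space measure" +
  assumes sets_eq: "sets M = sets borel"
begin

lemma borel_measurable_continuous: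
  "continuous_on UNIV f \<Longrightarrow> (f :: 'a \<Rightarrow> real) \<in> borel_measurable M"
  using borel_measurable_continuous_onI sets_eq measurable_cong_sets by blast

lemma integrable_continuous:
  assumes "compact (UNIV :: 'a set)" "continuous_on UNIV f"
  shows "integrable M (f :: 'a \<Rightarrow> real)"
proof -
  obtain B where "\<And>x. \<bar>f x\<bar> \<le> B"
    using continuous_imp_bounded_on_compact[OF assms] by blast
  then show ?thesis
    using borel_measurable_continuous[OF assms(2)] by (intro integrable_const_bound[of _ B]) auto
qed

lemma integrable_mult_continuous:
  assumes "compact (UNIV :: 'a set)" "continuous_on UNIV f" "integrable M w"
  shows "integrable M (\<lambda>x. f x * w x :: real)" "integrable M (\<lambda>x. w x * f x)"
proof -
  obtain B where B: "0 \<le> B" "\<And>x. \<bar>f x\<bar> \<le> B"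
    using continuous_imp_bounded_on_compact[OF assms(1,2)] by blast
  show "integrable M (\<lambda>x. f x * w x)"
  proof (rule Bochner_Integration.integrable_bound)
    show "integrable M (\<lambda>x. B * w x)" using assms by simp
    show "(\<lambda>x. f x * w x) \<in> borel_measurable M"
      using borel_measurable_continuous[OF assms(2)] assms(3) by measurable
    show "AE x in M. norm (f x * w x) \<le> norm (B * w x)"
      using B by (auto simp: abs_mult intro!: mult_right_mono)
  qed
  then show "integrable M (\<lambda>x. w x * f x)" by (simp add: mult.commute)
qed

lemma abs_integral_mult_le:
  fixes w :: "'a \<Rightarrow> real"
  assumes "compact (UNIV :: 'a set)" "continuous_on UNIV f" "integrable M w" "\<And>x. \<bar>f x\<bar> \<le> B"
  shows "\<bar>\<integral>x. f x * w x \<partial>M\<bar> \<le> B * (\<integral>x. \<bar>w x\<bar> \<partial>M)"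
proof -
  have "\<bar>\<integral>x. f x * w x \<partial>M\<bar> \<le> (\<integral>x. \<bar>f x * w x\<bar> \<partial>M)"
    using integral_norm_bound[of M "\<lambda>x. f x * w x"] by simp
  also have "\<dots> \<le> (\<integral>x. B * \<bar>w x\<bar> \<partial>M)"
    using integrable_mult_continuous[OF assms(1-3)] assms(3,4)
    by (intro integral_mono integrable_abs integrable_mult_right)
      (auto simp: abs_mult intro: mult_right_mono)
  finally show ?thesis by simp
qed

end

locale compact_rkhs = pd_kernel k for k :: "'a::metric_space \<Rightarrow> 'a \<Rightarrow> real" +
  assumes compact: "compact (UNIV :: 'a set)"
    and k_cont: "continuous_on UNIV (\<lambda>(x, y). k x y)"
begin

lemma is_rkhs: "is_rkhs k (rkhs k) (rkhs_inner k)"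
  using Moore_Aronszajn by (rule is_rkhs_rkhs)

sublocale hilbert_functions "rkhs k" "rkhs_inner k"
  using is_rkhs by (simp add: is_rkhs_iff)

lemma nm_eq: "nm = rkhs_norm k"
  by (simp add: fun_eq_iff nm_def rkhs_norm_def)

lemma kernel_mem [simp]: "k x \<in> rkhs k"
  using is_rkhs by (simp add: is_rkhs_iff)

lemma kernel_mem' [simp]: "(\<lambda>x. k x y) \<in> rkhs k"
  by (subst k_sym) simp

lemma reproducing: "f \<in> rkhs k \<Longrightarrow> rkhs_inner k f (k x) = f x"
  using is_rkhs by (simp add: is_rkhs_iff)

lemma continuous_kernel: "continuous_on UNIV (k x)" "continuous_on UNIV (\<lambda>y. k y x)"
  "continuous_on UNIV (\<lambda>y. k y y)"
proof -
  have "continuous_on UNIV (\<lambda>y. k (p y) (q y))" if "continuous_on UNIV p" "continuous_on UNIV q" for p q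
    using continuous_on_compose2[OF k_cont continuous_on_Pair[OF that]] by simp
  from this[of "\<lambda>_. x" "\<lambda>y. y"] this[of "\<lambda>y. y" "\<lambda>_. x"] this[of "\<lambda>y. y" "\<lambda>y. y"]
  show "continuous_on UNIV (k x)" "continuous_on UNIV (\<lambda>y. k y x)" "continuous_on UNIV (\<lambda>y. k y y)"
    by (simp_all add: continuous_on_const continuous_on_id)
qed

text \<open>The pseudometric induced by the feature map. Every \<open>f\<close> is Lipschitz for it
  with constant \<open>nm f\<close>, so norm bounded sets are equicontinuous.\<close>

definition kdist :: "'a \<Rightarrow> 'a \<Rightarrow> real" where
  "kdist x y = nm (\<lambda>z. k x z - k y z)"

lemma kdist_nonneg: "0 \<le> kdist x y"
  by (simp add: kdist_def)

lemma kdist_self: "kdist x x = 0"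
  by (simp add: kdist_def nm_def)

lemma continuous_kdist: "continuous_on UNIV (\<lambda>x. kdist x y)"
proof -
  have "kdist x y = sqrt (k x x + k y y - 2 * k x y)" for x
    unfolding kdist_def nm_def by (simp add: bilinear reproducing k_sym[of y x])
  then show ?thesis by (auto intro!: continuous_intros continuous_kernel)
qed

lemma abs_diff_le_kdist:
  assumes "f \<in> rkhs k"
  shows "\<bar>f x - f y\<bar> \<le> nm f * kdist x y"
proof -
  have "f x - f y = rkhs_inner k f (\<lambda>z. k x z - k y z)"
    using assms by (simp add: bilinear reproducing)
  then show ?thesis
    using Cauchy_Schwarz[OF assms, of "\<lambda>z. k x z - k y z"] by (simp add: kdist_def)
qed

lemma continuous_mem:
  assumes "f \<in> rkhs k"
  shows "continuous_on UNIV f"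
  unfolding continuous_on_def
proof
  fix y
  have "((\<lambda>x. kdist x y) \<longlongrightarrow> kdist y y) (at y)"
    using continuous_kdist[of y] by (simp add: continuous_on_def)
  then have "((\<lambda>x. nm f * kdist x y) \<longlongrightarrow> 0) (at y)"
    using tendsto_mult_left[of "\<lambda>x. kdist x y" 0 "at y" "nm f"] by (simp add: kdist_self)
  then have "((\<lambda>x. f x - f y) \<longlongrightarrow> 0) (at y)"
    using abs_diff_le_kdist[OF assms] by (intro Lim_null_comparison[of "\<lambda>x. f x - f y"]) simp_all
  then show "(f \<longlongrightarrow> f y) (at y within UNIV)"
    by (simp add: LIM_zero_iff)
qed

lemma sup_bound:
  obtains C where "0 \<le> C" "\<And>f x. f \<in> rkhs k \<Longrightarrow> \<bar>f x\<bar> \<le> C * nm f"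
proof -
  obtain B where B: "0 \<le> B" "\<And>x. \<bar>k x x\<bar> \<le> B"
    using continuous_imp_bounded_on_compact[OF compact continuous_kernel(3)] by blast
  have "\<bar>f x\<bar> \<le> sqrt B * nm f" if f: "f \<in> rkhs k" for f x
  proof -
    have "\<bar>f x\<bar> \<le> nm f * nm (k x)"
      using Cauchy_Schwarz[OF f, of "k x"] f by (simp add: reproducing)
    also have "nm (k x) \<le> sqrt B"
      unfolding nm_def using B(2)[of x] by (simp add: reproducing)
    finally show ?thesis using f by (simp add: mult.commute[of "sqrt B"] mult_left_mono)
  qed
  then show ?thesis using that[of "sqrt B"] B(1) by simp
qed

text \<open>An Arzela-Ascoli argument: a norm bound gives equicontinuity with respect to
  \<open>kdist\<close>, and finitely many small \<open>kdist\<close>-balls cover the space, so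
  convergence at their centres is enough.\<close>

lemma uniform_of_pointwise:
  assumes h: "\<And>n. h n \<in> rkhs k" "g \<in> rkhs k" and bd: "\<And>n. nm (h n) \<le> C"
    and lim: "\<And>x. ((\<lambda>n. h n x) \<longlongrightarrow> g x) A" and e: "e > 0"
  shows "\<forall>\<^sub>F n in A. \<forall>x. \<bar>h n x - g x\<bar> < e"
proof -
  \<comment> \<open>\<open>D\<close> bounds the norm of every \<open>h n - g\<close>; the summand 1
    keeps the radius \<open>e / (2 * D)\<close> well defined.\<close>
  define D where "D = \<bar>C\<bar> + nm g + 1"
  have D: "D > 0" using nm_nonneg[OF h(2)] by (simp add: D_def)
  define U where "U x = {y. kdist y x < e / (2 * D)}" for x
  have "open (U x)" for x
    unfolding U_def using continuous_kdist by (intro open_Collect_less continuous_intros) auto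
  moreover have "UNIV \<subseteq> (\<Union>x\<in>UNIV. U x)"
    using e D by (auto simp: U_def kdist_self intro!: exI)
  ultimately obtain T where T: "finite T" "UNIV \<subseteq> (\<Union>x\<in>T. U x)"
    using compactE_image[OF compact, of UNIV U] by metis
  have "\<forall>\<^sub>F n in A. \<forall>x\<in>T. \<bar>h n x - g x\<bar> < e / 2"
  proof (rule eventually_ball_finite[OF T(1)], rule ballI)
    show "\<forall>\<^sub>F n in A. \<bar>h n x - g x\<bar> < e / 2" for x
      using tendstoD[OF lim[of x], of "e / 2"] e by (simp add: dist_real_def)
  qed
  then show ?thesis
  proof eventually_elim
    case (elim n)
    show ?case
    proof
      fix y
      obtain x where x: "x \<in> T" "kdist y x < e / (2 * D)" using T(2) by (auto simp: U_def)
      have mem: "(\<lambda>z. h n z - g z) \<in> rkhs k" using h by simp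
      have "nm (\<lambda>z. h n z - g z) \<le> D"
        using nm_triangle[of "h n" "\<lambda>z. (-1) * g z"] nm_scale[of g "-1"] h bd[of n]
        by (simp add: D_def)
      then have "nm (\<lambda>z. h n z - g z) * kdist y x \<le> D * kdist y x"
        by (intro mult_right_mono kdist_nonneg)
      also have "\<dots> < e / 2"
        using x(2) D by (simp add: field_simps)
      finally have "\<bar>(h n y - g y) - (h n x - g x)\<bar> < e / 2"
        using abs_diff_le_kdist[OF mem, of y x] by linarith
      moreover have "\<bar>h n x - g x\<bar> < e / 2" using elim x(1) by blast
      ultimately show "\<bar>h n y - g y\<bar> < e" by linarith
    qed
  qed
qed

text \<open>The kernel mean embedding of the measure with density \<open>w\<close> with respect to
  \<open>M\<close>.\<close>

definition embed :: "'a measure \<Rightarrow> ('a \<Rightarrow> real) \<Rightarrow> 'a \<Rightarrow> real" where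
  "embed M w y = (\<integral>x. w x * k x y \<partial>M)"

text \<open>Riesz represents \<open>g \<mapsto> \<integral> g w dM\<close>, and evaluating the representer by the reproducing property shows
  that it is the integral operator; no interchange of integrals is involved.\<close>

lemma embed_Riesz:
  assumes M: "borel_prob M" and w: "integrable M w"
  shows "embed M w \<in> rkhs k \<and> (\<forall>g\<in>rkhs k. rkhs_inner k (embed M w) g = (\<integral>x. w x * g x \<partial>M))"
proof -
  interpret borel_prob M by (rule M)
  obtain C where C: "0 \<le> C" "\<And>f x. f \<in> rkhs k \<Longrightarrow> \<bar>f x\<bar> \<le> C * nm f"
    by (rule sup_bound) blast
  have int: "integrable M (\<lambda>x. w x * g x)" if "g \<in> rkhs k" for g
    using integrable_mult_continuous[OF compact continuous_mem[OF that] w] by simp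
  obtain J where J: "J \<in> rkhs k" "\<And>g. g \<in> rkhs k \<Longrightarrow> (\<integral>x. w x * g x \<partial>M) = rkhs_inner k J g"
  proof (rule Riesz[of "\<lambda>g. \<integral>x. w x * g x \<partial>M" "C * (\<integral>x. \<bar>w x\<bar> \<partial>M)"])
    show "(\<integral>x. w x * (f x + g x) \<partial>M) = (\<integral>x. w x * f x \<partial>M) + (\<integral>x. w x * g x \<partial>M)"
      if "f \<in> rkhs k" "g \<in> rkhs k" for f g
      using int that by (simp add: distrib_left)
    show "(\<integral>x. w x * (r * f x) \<partial>M) = r * (\<integral>x. w x * f x \<partial>M)" if "f \<in> rkhs k" for r f
      by (simp add: mult.left_commute)
    show "\<bar>\<integral>x. w x * f x \<partial>M\<bar> \<le> C * (\<integral>x. \<bar>w x\<bar> \<partial>M) * nm f" if "f \<in> rkhs k" for f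
      using abs_integral_mult_le[OF compact continuous_mem[OF that] w C(2)[OF that]]
      by (simp add: mult_ac)
  qed blast
  have "embed M w y = J y" for y
  proof -
    have "J y = (\<integral>x. w x * k y x \<partial>M)" using J reproducing by simp
    then show ?thesis by (simp add: embed_def k_sym[of y])
  qed
  then have "embed M w = J" by auto
  with J show ?thesis by simp
qed

lemma embed_mem: "borel_prob M \<Longrightarrow> integrable M w \<Longrightarrow> embed M w \<in> rkhs k"
  using embed_Riesz by blast

lemma inner_embed:
  "borel_prob M \<Longrightarrow> integrable M w \<Longrightarrow> g \<in> rkhs k \<Longrightarrow>
    rkhs_inner k (embed M w) g = (\<integral>x. w x * g x \<partial>M)"
  using embed_Riesz by blast

end

section \<open>Self-transport potentials\<close>

lemma integral_nonpos_of_nonpos: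
  fixes f :: "'a \<Rightarrow> real"
  assumes "\<And>x. f x \<le> 0"
  shows "(\<integral>x. f x \<partial>M) \<le> 0"
  using integral_nonneg_AE[where M = M and f = "\<lambda>x. - f x"] assms by simp

locale bounded_kernel = compact_rkhs k for k :: "'a::metric_space \<Rightarrow> 'a \<Rightarrow> real" +
  fixes \<kappa> :: real
  assumes \<kappa>_pos: "\<kappa> > 0" and \<kappa>_le: "\<And>x y. \<kappa> \<le> k x y" and k_le_1: "\<And>x y. k x y \<le> 1"
begin

lemma \<kappa>_le_1: "\<kappa> \<le> 1"
  using \<kappa>_le k_le_1 order_trans by blast

lemma embed_bounds:
  assumes M: "borel_prob M" and w: "integrable M w" "\<And>x. 0 \<le> w x"
  shows "\<kappa> * (\<integral>x. w x \<partial>M) \<le> embed M w y" "embed M w y \<le> (\<integral>x. w x \<partial>M)"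
proof -
  interpret borel_prob M by (rule M)
  have int: "integrable M (\<lambda>x. w x * k x y)"
    using integrable_mult_continuous[OF compact continuous_kernel(2) w(1)] by simp
  have "(\<integral>x. \<kappa> * w x \<partial>M) \<le> (\<integral>x. w x * k x y \<partial>M)"
    using int w mult_right_mono[OF \<kappa>_le w(2)]
    by (intro integral_mono integrable_mult_right) (auto simp: mult.commute)
  then show "\<kappa> * (\<integral>x. w x \<partial>M) \<le> embed M w y" by (simp add: embed_def)
  show "embed M w y \<le> (\<integral>x. w x \<partial>M)"
    unfolding embed_def using int w mult_left_mono[OF k_le_1 w(2)]
    by (intro integral_mono) auto
qed

text \<open>With \<open>m\<close> the integral of \<open>1 / b\<close>, the kernel bounds give
  \<open>\<kappa> * m \<le> b \<le> m\<close>. Integrating \<open>1 / m \<le> 1 / b\<close> yields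
  \<open>1 \<le> m\<close>, hence the lower bound; this in turn gives
  \<open>m \<le> 1 / \<kappa>\<close>.\<close>

lemma scaling_bounds:
  assumes M: "borel_prob M" and b: "continuous_on UNIV b" "\<And>x. 0 < b x"
    and eq: "embed M (\<lambda>x. 1 / b x) = b"
  shows "\<kappa> \<le> b x" "b x \<le> 1 / \<kappa>"
proof -
  interpret borel_prob M by (rule M)
  have cont: "continuous_on UNIV (\<lambda>x. 1 / b x)"
    using b by (intro continuous_intros) (auto simp: less_imp_neq[symmetric])
  note int = integrable_continuous[OF compact cont]
  define m where "m = (\<integral>x. 1 / b x \<partial>M)"
  have bounds: "\<kappa> * m \<le> b x" "b x \<le> m" for x
    using embed_bounds[OF M int, of x] less_imp_le[OF b(2)] unfolding eq m_def by simp_all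
  have "0 < m" using bounds(2) b(2) by (meson less_le_trans)
  have "(\<integral>x. 1 / m \<partial>M) \<le> m"
    unfolding m_def[symmetric] by (subst (2) m_def, intro integral_mono int)
      (use bounds(2) b(2) \<open>0 < m\<close> in \<open>auto intro!: frac_le\<close>)
  then have "1 \<le> m"
    using \<open>0 < m\<close> prob_space by (simp add: field_simps) (smt (verit) mult_less_cancel_right2)
  show lower: "\<kappa> \<le> b x" for x
    using order_trans[OF mult_left_mono[OF \<open>1 \<le> m\<close>, of \<kappa>] bounds(1)[of x]] \<kappa>_pos by simp
  have "m \<le> (\<integral>x. 1 / \<kappa> \<partial>M)"
    unfolding m_def by (intro integral_mono int) (use lower \<kappa>_pos in \<open>auto intro!: frac_le\<close>)
  then show "b x \<le> 1 / \<kappa>" using bounds(2)[of x] prob_space by simp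
qed

text \<open>The squared norm of \<open>b - b'\<close> is the integral of
  \<open>(1 / b - 1 / b') * (b - b')\<close>, which is nonpositive because the reciprocal is
  decreasing.\<close>

lemma scaling_unique:
  assumes M: "borel_prob M" and b: "continuous_on UNIV b" "\<And>x. 0 < b x" "embed M (\<lambda>x. 1 / b x) = b"
    and b': "continuous_on UNIV b'" "\<And>x. 0 < b' x" "embed M (\<lambda>x. 1 / b' x) = b'"
  shows "b = b'"
proof -
  interpret borel_prob M by (rule M)
  have int: "integrable M (\<lambda>x. 1 / b x)" "integrable M (\<lambda>x. 1 / b' x)"
    using b b' by (auto intro!: integrable_continuous compact continuous_intros
        simp: less_imp_neq[symmetric])
  have mem: "b \<in> rkhs k" "b' \<in> rkhs k"
    using embed_mem[OF M int(1)] embed_mem[OF M int(2)] b(3) b'(3) by simp_all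
  define d where "d = (\<lambda>x. b x - b' x)"
  have d: "d \<in> rkhs k" using mem by (simp add: d_def)
  have intd: "integrable M (\<lambda>x. 1 / b x * d x)" "integrable M (\<lambda>x. 1 / b' x * d x)"
    using integrable_mult_continuous[OF compact continuous_mem[OF d]] int by blast+
  have "rkhs_inner k b d = (\<integral>x. 1 / b x * d x \<partial>M)" "rkhs_inner k b' d = (\<integral>x. 1 / b' x * d x \<partial>M)"
    using inner_embed[OF M int(1) d] inner_embed[OF M int(2) d] b(3) b'(3) by simp_all
  then have "rkhs_inner k d d = (\<integral>x. 1 / b x * d x - 1 / b' x * d x \<partial>M)"
    using mem d intd by (subst d_def) (simp add: diff_left)
  also have "\<dots> \<le> 0"
  proof (rule integral_nonpos_of_nonpos)
    show "1 / b x * d x - 1 / b' x * d x \<le> 0" for x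
    proof -
      have "1 / b x * d x - 1 / b' x * d x = - (d x)\<^sup>2 / (b x * b' x)"
        using b(2)[of x] b'(2)[of x] by (simp add: d_def field_simps power2_eq_square)
      also have "\<dots> \<le> 0"
        using b(2)[of x] b'(2)[of x] by (simp add: divide_nonpos_pos)
      finally show ?thesis .
    qed
  qed
  finally have "rkhs_inner k d d = 0" using nonneg[OF d] by simp
  then have "d = (\<lambda>_. 0)" by (rule definite[OF d])
  then show ?thesis by (simp add: d_def fun_eq_iff)
qed

text \<open>Truncating \<open>1 / b\<close> at \<open>\<kappa>\<close> makes it Lipschitz; the truncation is inactive at the fixpoint.\<close>

lemma scaling_exists:
  assumes M: "borel_prob M"
  obtains b where "b \<in> rkhs k" "\<And>x. 0 < b x" "embed M (\<lambda>x. 1 / b x) = b"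
proof -
  interpret borel_prob M by (rule M)
  define \<phi> where "\<phi> t = 1 / max t \<kappa>" for t
  have \<phi>_Lip: "\<bar>\<phi> s - \<phi> t\<bar> \<le> (1 / \<kappa>\<^sup>2) * \<bar>s - t\<bar>" for s t
  proof -
    have "\<phi> s - \<phi> t = (max t \<kappa> - max s \<kappa>) / (max s \<kappa> * max t \<kappa>)"
      using \<kappa>_pos by (simp add: \<phi>_def field_simps max_def)
    then have "\<bar>\<phi> s - \<phi> t\<bar> = \<bar>max t \<kappa> - max s \<kappa>\<bar> / (max s \<kappa> * max t \<kappa>)"
      using \<kappa>_pos by (simp add: abs_mult)
    also have "\<dots> \<le> \<bar>s - t\<bar> / (\<kappa> * \<kappa>)"
      using \<kappa>_pos by (intro frac_le mult_mono) auto
    finally show ?thesis by (simp add: power2_eq_square)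
  qed
  have \<phi>_mono: "(\<phi> s - \<phi> t) * (s - t) \<le> 0" for s t
  proof (cases "s \<le> t")
    case True
    then have "\<phi> t \<le> \<phi> s" unfolding \<phi>_def using \<kappa>_pos by (intro frac_le) auto
    then show ?thesis using True by (simp add: mult_nonneg_nonpos)
  next
    case False
    then have "\<phi> s \<le> \<phi> t" unfolding \<phi>_def using \<kappa>_pos by (intro frac_le) auto
    then show ?thesis using False by (simp add: mult_nonpos_nonneg)
  qed
  have \<phi>_cont: "continuous_on UNIV (\<lambda>x. \<phi> (f x))" if "f \<in> rkhs k" for f
    unfolding \<phi>_def using continuous_mem[OF that] \<kappa>_pos
    by (intro continuous_intros) (auto simp: max_def)
  note int = integrable_continuous[OF compact \<phi>_cont]
  define T where "T f = embed M (\<lambda>x. \<phi> (f x))" for f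
  have T: "T f \<in> rkhs k" if "f \<in> rkhs k" for f
    unfolding T_def by (intro embed_mem M int that)
  have inner: "rkhs_inner k (\<lambda>x. T f x - T g x) u = (\<integral>x. u x * (\<phi> (f x) - \<phi> (g x)) \<partial>M)"
    if "f \<in> rkhs k" "g \<in> rkhs k" "u \<in> rkhs k" for f g u
  proof -
    have "integrable M (\<lambda>x. \<phi> (f x) * u x)" "integrable M (\<lambda>x. \<phi> (g x) * u x)"
      using integrable_mult_continuous[OF compact continuous_mem] int that by blast+
    then show ?thesis
      using that T by (simp add: diff_left) (simp add: T_def inner_embed M int right_diff_distrib mult.commute)
  qed
  obtain C where C: "0 \<le> C" "\<And>f x. f \<in> rkhs k \<Longrightarrow> \<bar>f x\<bar> \<le> C * nm f"
    by (rule sup_bound) blast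
  obtain b where b: "b \<in> rkhs k" "T b = b"
  \<comment> \<open>The Lipschitz constant of \<phi> is \<open>1 / \<kappa>\<^sup>2\<close>; one
    \<open>C\<close> passes from the sup norm to the norm for the difference of arguments, the other
    for the difference of images.\<close>
  proof (rule monotone_fixpoint[of T "C * (C / \<kappa>\<^sup>2)"])
    fix f g assume f: "f \<in> rkhs k" and g: "g \<in> rkhs k"
    show "T f \<in> rkhs k" by (rule T[OF f])
    define d e where "d = (\<lambda>x. f x - g x)" and "e = (\<lambda>x. T f x - T g x)"
    have de: "d \<in> rkhs k" "e \<in> rkhs k" using f g T by (simp_all add: d_def e_def)
    show "rkhs_inner k (\<lambda>x. T f x - T g x) (\<lambda>x. f x - g x) \<le> 0"
      unfolding inner[OF f g de(1)[unfolded d_def]]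
      using \<phi>_mono by (intro integral_nonpos_of_nonpos) (simp add: mult.commute)
    have "(nm e)\<^sup>2 = (\<integral>x. e x * (\<phi> (f x) - \<phi> (g x)) \<partial>M)"
      using inner[OF f g de(2)] de by (simp add: nm_power2) (simp add: e_def)
    also have "\<dots> \<le> (\<integral>x. (C * nm e) * (C / \<kappa>\<^sup>2 * nm d) \<partial>M)"
    proof (rule integral_mono)
      show "integrable M (\<lambda>x. e x * (\<phi> (f x) - \<phi> (g x)))"
        by (intro integrable_mult_continuous compact continuous_mem de Bochner_Integration.integrable_diff int f g)
      show "e x * (\<phi> (f x) - \<phi> (g x)) \<le> (C * nm e) * (C / \<kappa>\<^sup>2 * nm d)" for x
      proof -
        have "\<bar>\<phi> (f x) - \<phi> (g x)\<bar> \<le> (1 / \<kappa>\<^sup>2) * \<bar>d x\<bar>"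
          using \<phi>_Lip by (simp add: d_def)
        also have "\<dots> \<le> (1 / \<kappa>\<^sup>2) * (C * nm d)"
          by (intro mult_left_mono C de) simp
        finally have "\<bar>\<phi> (f x) - \<phi> (g x)\<bar> \<le> C / \<kappa>\<^sup>2 * nm d" by simp
        then have "\<bar>e x * (\<phi> (f x) - \<phi> (g x))\<bar> \<le> (C * nm e) * (C / \<kappa>\<^sup>2 * nm d)"
          unfolding abs_mult using C de by (intro mult_mono) auto
        then show ?thesis by linarith
      qed
    qed simp
    finally have le: "nm e * nm e \<le> nm e * (C * (C / \<kappa>\<^sup>2) * nm d)"
      using prob_space by (simp add: power2_eq_square mult_ac)
    show "nm (\<lambda>x. T f x - T g x) \<le> C * (C / \<kappa>\<^sup>2) * nm (\<lambda>x. f x - g x)"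
    proof (cases "nm e = 0")
      case True
      then show ?thesis using C(1) de(1) by (simp add: d_def e_def)
    next
      case False
      then have "0 < nm e" using nm_nonneg[OF de(2)] by linarith
      then show ?thesis
        using le unfolding d_def e_def by (simp only: mult_le_cancel_left_pos)
    qed
  qed
  \<comment> \<open>The truncated fixpoint satisfies \<open>1 / max m \<kappa> \<le> m\<close>.
    Since \<open>\<kappa> \<le> 1\<close>, this forces \<open>1 \<le> m\<close> and thus
    \<open>\<kappa> \<le> b\<close>, where the truncation does nothing.\<close>
  define m where "m = (\<integral>x. \<phi> (b x) \<partial>M)"
  have \<phi>_pos: "0 \<le> \<phi> t" for t using \<kappa>_pos by (simp add: \<phi>_def)
  have bounds: "\<kappa> * m \<le> b x" "b x \<le> m" for x
    using embed_bounds[OF M int[OF b(1)] \<phi>_pos, of x] b(2) unfolding T_def m_def by simp_all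
  have "0 < max m \<kappa>" using \<kappa>_pos by simp
  have "(\<integral>x. 1 / max m \<kappa> \<partial>M) \<le> m"
    unfolding m_def[symmetric]
    by (subst (2) m_def, intro integral_mono int b)
      (use bounds(2) \<kappa>_pos in \<open>auto simp: \<phi>_def intro!: frac_le max.mono\<close>)
  then have "1 / max m \<kappa> \<le> m" using prob_space by simp
  then have "1 \<le> m * max m \<kappa>" using \<open>0 < max m \<kappa>\<close> by (simp add: field_simps)
  have "1 \<le> m"
  proof (rule ccontr)
    assume "\<not> 1 \<le> m"
    then have "max m \<kappa> \<le> 1" using \<kappa>_le_1 by simp

    have "m \<ge> 0" unfolding m_def using \<phi>_pos by (intro integral_nonneg_AE) simp
    then have "m * max m \<kappa> \<le> m * 1" using \<open>max m \<kappa> \<le> 1\<close> by (intro mult_left_mono)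
    with \<open>1 \<le> m * max m \<kappa>\<close> \<open>\<not> 1 \<le> m\<close> show False by simp
  qed
  have lower: "\<kappa> \<le> b x" for x
    using order_trans[OF mult_left_mono[OF \<open>1 \<le> m\<close>, of \<kappa>] bounds(1)[of x]] \<kappa>_pos by simp
  have "\<phi> (b x) = 1 / b x" for x by (simp add: \<phi>_def max_absorb1 lower)
  then have "embed M (\<lambda>x. 1 / b x) = b" using b(2) by (simp add: T_def)
  moreover have "0 < b x" for x using lower[of x] \<kappa>_pos by linarith
  ultimately show ?thesis using that b(1) by blast
qed

end

lemma borel_prob_iff: "borel_prob M \<longleftrightarrow> M \<in> prob_measures"
  by (simp add: borel_prob_def borel_prob_axioms_def prob_measures_def)

locale entropic_kernel = bounded_kernel "k_c \<epsilon> c" \<kappa>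
  for \<epsilon> :: real and c :: "'a::metric_space \<Rightarrow> 'a \<Rightarrow> real" and \<kappa> :: real +
  assumes \<epsilon>_pos: "\<epsilon> > 0"
begin

text \<open>In the variable \<open>exp (- f / \<epsilon>)\<close> the potential equation becomes the
  scaling equation solved above, as the factor depending on \<open>y\<close> leaves the
  integral.\<close>

lemma self_potential_equation_iff:
  "(\<forall>y. (\<integral>x. exp (1 / \<epsilon> * (f x + f y - c x y)) \<partial>M) = 1)
    \<longleftrightarrow> embed M (\<lambda>x. 1 / exp (- f x / \<epsilon>)) = (\<lambda>y. exp (- f y / \<epsilon>))"
proof -
  have *: "exp (1 / \<epsilon> * (f x + f y - c x y)) = exp (f y / \<epsilon>) * (1 / exp (- f x / \<epsilon>) * k_c \<epsilon> c x y)" for x y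
    by (simp add: k_c_def exp_minus field_simps flip: exp_add) (simp add: add_divide_distrib diff_divide_distrib)
  have "(\<integral>x. exp (1 / \<epsilon> * (f x + f y - c x y)) \<partial>M)
      = exp (f y / \<epsilon>) * embed M (\<lambda>x. 1 / exp (- f x / \<epsilon>)) y" for y
    by (simp only: * embed_def integral_mult_right_zero)
  moreover have "exp (f y / \<epsilon>) * t = 1 \<longleftrightarrow> t = exp (- f y / \<epsilon>)" for y t
    by (simp add: exp_minus field_simps)
  ultimately show ?thesis by (simp add: fun_eq_iff)
qed

text \<open>Evaluates the description \<open>self_potential\<close>: the scaling \<open>b\<close>
  yields the potential \<open>- \<epsilon> * ln b\<close>, and any continuous competitor yields a
  positive continuous scaling, equal to \<open>b\<close> by uniqueness.\<close>

lemma B_map_properties: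
  assumes M: "borel_prob M"
  shows "B_map \<epsilon> c M \<in> rkhs (k_c \<epsilon> c)"
    and "B_map \<epsilon> c M = embed M (a_mu \<epsilon> c M)"
    and "a_mu \<epsilon> c M x = 1 / B_map \<epsilon> c M x"
    and "\<kappa> \<le> B_map \<epsilon> c M x" "B_map \<epsilon> c M x \<le> 1 / \<kappa>"
proof -
  obtain b where b: "b \<in> rkhs (k_c \<epsilon> c)" "\<And>x. 0 < b x" "embed M (\<lambda>x. 1 / b x) = b"
    using scaling_exists[OF M] by blast
  note cont = continuous_mem[OF b(1)]
  define f where "f x = - \<epsilon> * ln (b x)" for x
  have exp_f: "exp (- f x / \<epsilon>) = b x" for x
    using b(2)[of x] \<epsilon>_pos by (simp add: f_def)
  have "self_potential \<epsilon> c M = f"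
    unfolding self_potential_def self_potential_equation_iff
  proof (rule the_equality)
    show "continuous_on UNIV f \<and> embed M (\<lambda>x. 1 / exp (- f x / \<epsilon>)) = (\<lambda>y. exp (- f y / \<epsilon>))"
    proof
      show "continuous_on UNIV f"
        unfolding f_def using b(2)
        by (intro continuous_intros cont) (auto simp: less_imp_neq[symmetric])
    qed (use b(3) in \<open>simp only: exp_f\<close>)
  next
    fix g assume g: "continuous_on UNIV g \<and>
      embed M (\<lambda>x. 1 / exp (- g x / \<epsilon>)) = (\<lambda>y. exp (- g y / \<epsilon>))"
    have "(\<lambda>y. exp (- g y / \<epsilon>)) = b"
    proof (rule scaling_unique[OF M _ _ _ cont b(2,3)])
      show "continuous_on UNIV (\<lambda>y. exp (- g y / \<epsilon>))"
        using g \<epsilon>_pos by (intro continuous_intros) auto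
    qed (use g in auto)
    then have "exp (- g x / \<epsilon>) = exp (- f x / \<epsilon>)" for x
      unfolding exp_f by (rule fun_cong)
    then show "g = f" using \<epsilon>_pos by auto
  qed
  then have a: "a_mu \<epsilon> c M x = 1 / b x" for x
    by (simp add: a_mu_def exp_f[of x, symmetric] exp_minus divide_inverse)
  have B: "B_map \<epsilon> c M = embed M (a_mu \<epsilon> c M)"
    by (simp add: B_map_def embed_def fun_eq_iff)
  moreover have "embed M (a_mu \<epsilon> c M) = b"
    using b(3) a by (metis (no_types, lifting) ext)
  ultimately have Bb: "B_map \<epsilon> c M = b" by simp
  show "B_map \<epsilon> c M \<in> rkhs (k_c \<epsilon> c)" "B_map \<epsilon> c M = embed M (a_mu \<epsilon> c M)"
    "a_mu \<epsilon> c M x = 1 / B_map \<epsilon> c M x"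
    using b a B Bb by simp_all
  show "\<kappa> \<le> B_map \<epsilon> c M x" "B_map \<epsilon> c M x \<le> 1 / \<kappa>"
    unfolding Bb using scaling_bounds[OF M cont b(2,3)] by auto
qed

end

section \<open>The Markov operator of the normalised kernel\<close>

locale entropic_measure = entropic_kernel \<epsilon> c \<kappa> + borel_prob M
  for \<epsilon> :: real and c :: "'a::metric_space \<Rightarrow> 'a \<Rightarrow> real" and \<kappa> :: real and M :: "'a measure"
begin

abbreviation "kc \<equiv> k_c \<epsilon> c"
abbreviation "a \<equiv> a_mu \<epsilon> c M"
abbreviation "b \<equiv> B_map \<epsilon> c M"
abbreviation "km \<equiv> k_mu \<epsilon> c M"
abbreviation "K \<equiv> K_mu \<epsilon> c M"

lemmas b_properties = B_map_properties[OF borel_prob_axioms]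

lemma b_mem [simp]: "b \<in> rkhs kc"
  by (rule b_properties)

lemma b_pos: "0 < b x"
  using b_properties(4)[of x] \<kappa>_pos by linarith

lemma a_pos: "0 < a x"
  using b_pos[of x] by (simp add: b_properties(3))

lemma a_nonzero [simp]: "a x \<noteq> 0"
  using a_pos[of x] by simp

lemma a_mult_b [simp]: "a x * b x = 1"
  using b_pos[of x] by (simp add: b_properties(3))

lemma a_bounds: "\<kappa> \<le> a x" "a x \<le> 1 / \<kappa>"
proof -
  show "a x \<le> 1 / \<kappa>"
    unfolding b_properties(3) using b_properties(4)[of x] \<kappa>_pos by (intro frac_le) auto
  have "1 / (1 / \<kappa>) \<le> a x"
    unfolding b_properties(3) using b_properties(5)[of x] b_pos by (intro frac_le) auto
  then show "\<kappa> \<le> a x" by simp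
qed

lemma continuous_a: "continuous_on UNIV a"
proof -
  have "continuous_on UNIV (\<lambda>x. 1 / b x)"
    using continuous_mem[OF b_mem] b_pos by (intro continuous_intros) (auto simp: less_imp_neq[symmetric])
  then show ?thesis by (simp add: b_properties(3)[abs_def])
qed

lemma integrable_a_mult: "integrable M w \<Longrightarrow> integrable M (\<lambda>x. a x * w x)"
  by (rule integrable_mult_continuous(1)[OF compact continuous_a])

lemma integrable_a: "integrable M a"
  by (rule integrable_continuous[OF compact continuous_a])

text \<open>\<open>b\<close> represents integration against \<open>a M\<close>; thus orthogonality
  to \<open>b\<close> and vanishing of that integral are the same tangency condition.\<close>

lemma inner_b: "g \<in> rkhs kc \<Longrightarrow> rkhs_inner kc b g = (\<integral>x. a x * g x \<partial>M)"
  using inner_embed[OF borel_prob_axioms integrable_a] b_properties(2) by simp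

lemma km_eq: "km = (\<lambda>x y. a x * a y * kc x y)"
  by (simp add: k_mu_def fun_eq_iff)

lemma is_rkhs_km:
  "is_rkhs km {f. (\<lambda>x. f x / a x) \<in> rkhs kc}
    (\<lambda>f g. rkhs_inner kc (\<lambda>x. f x / a x) (\<lambda>x. g x / a x))"
  unfolding km_eq using is_rkhs by (rule is_rkhs_rescale) simp

lemma rkhs_km: "rkhs km = {f. (\<lambda>x. f x / a x) \<in> rkhs kc}"
  by (rule rkhs_eqI(1)[OF is_rkhs_km])

lemma a_mult_mem_km [simp]: "g \<in> rkhs kc \<Longrightarrow> (\<lambda>x. a x * g x) \<in> rkhs km"
  by (simp add: rkhs_km)

lemma rkhs_norm_km:
  "f \<in> rkhs km \<Longrightarrow> rkhs_norm km f = rkhs_norm kc (\<lambda>x. f x / a x)"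
  unfolding rkhs_norm_def using rkhs_eqI(2)[OF is_rkhs_km] rkhs_km by simp

sublocale km: hilbert_functions "rkhs km" "rkhs_inner km"
  using is_rkhs_rkhs[OF is_rkhs_km] by (simp add: is_rkhs_iff)

lemma km_nm_eq: "km.nm = rkhs_norm km"
  by (simp add: fun_eq_iff km.nm_def rkhs_norm_def)

lemma one_mem_km [simp]: "(\<lambda>_. r) \<in> rkhs km"
proof -
  have "(\<lambda>x. r / a x) = (\<lambda>x. r * b x)"
    by (simp add: b_properties(3))
  then show ?thesis by (simp add: rkhs_km)
qed

lemma continuous_mem_km:
  assumes "f \<in> rkhs km"
  shows "continuous_on UNIV f"
proof -
  have "continuous_on UNIV (\<lambda>x. a x * (f x / a x))"
    using assms by (intro continuous_intros continuous_a continuous_mem) (simp add: rkhs_km)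
  then show ?thesis by simp
qed

lemma K_eq: "K w y = a y * embed M (\<lambda>x. a x * w x) y"
  by (simp add: K_mu_def k_mu_def embed_def mult_ac flip: integral_mult_right_zero)

text \<open>\<open>K\<close> smooths: it sends integrable functions into the RKHS of
  \<open>km\<close>, hence to continuous functions. This is the bridge between the L2 quotient and
  the RKHS quotient.\<close>

lemma K_mem: "integrable M w \<Longrightarrow> K w \<in> rkhs km"
  using embed_mem[OF borel_prob_axioms integrable_a_mult]
  by (simp add: K_eq[abs_def])

text \<open>Invariance of \<open>M\<close> under \<open>K\<close>; symmetry of the inner product of
  \<open>b\<close> with an embedding takes the place of Fubini.\<close>

lemma K_integral:
  assumes "integrable M w"
  shows "(\<integral>x. K w x \<partial>M) = (\<integral>x. w x \<partial>M)"
proof -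
  let ?e = "embed M (\<lambda>x. a x * w x)"
  have e: "?e \<in> rkhs kc" by (intro embed_mem borel_prob_axioms integrable_a_mult assms)
  have "(\<integral>x. K w x \<partial>M) = rkhs_inner kc b ?e"
    by (simp add: K_eq inner_b e)
  also have "\<dots> = rkhs_inner kc ?e b" by (rule sym) (use e in simp_all)
  also have "\<dots> = (\<integral>x. a x * w x * b x \<partial>M)"
    by (intro inner_embed borel_prob_axioms integrable_a_mult assms) simp
  also have "\<dots> = (\<integral>x. w x * (a x * b x) \<partial>M)" by (simp only: mult_ac)
  finally show ?thesis by simp
qed

lemma K_diff:
  assumes v: "integrable M v" and w: "integrable M w"
  shows "K (\<lambda>x. v x - w x) = (\<lambda>y. K v y - K w y)"
proof -
  have "integrable M (\<lambda>x. v x * km x y)" if "integrable M v" for v y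
  proof -
    have "continuous_on UNIV (\<lambda>x. km x y)"
      unfolding k_mu_def by (intro continuous_intros continuous_a continuous_kernel)
    then show ?thesis using integrable_mult_continuous[OF compact _ that] by blast
  qed
  then show ?thesis
    using v w by (simp add: K_mu_def fun_eq_iff left_diff_distrib)
qed

lemma K_cong_AE: "AE x in M. v x = w x \<Longrightarrow> v \<in> borel_measurable M \<Longrightarrow> w \<in> borel_measurable M
    \<Longrightarrow> K v = K w"
  unfolding K_mu_def
proof (rule ext)
  fix y
  assume "AE x in M. v x = w x" "v \<in> borel_measurable M" "w \<in> borel_measurable M"
  moreover have "(\<lambda>x. km x y) \<in> borel_measurable M"
    unfolding k_mu_def
    by (intro borel_measurable_continuous continuous_intros continuous_a continuous_kernel)
  ultimately show "(\<integral>x. v x * km x y \<partial>M) = (\<integral>x. w x * km x y \<partial>M)"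
    by (intro integral_cong_AE) auto
qed

lemma K_const: "K (\<lambda>_. r) = (\<lambda>_. r)"
proof
  fix y
  have "K (\<lambda>_. r) y = a y * (r * b y)"
    using b_properties(2) by (simp add: K_eq embed_def fun_eq_iff mult_ac)
  also have "\<dots> = r * (a y * b y)" by (simp only: mult_ac)
  finally show "K (\<lambda>_. r) y = r" by simp
qed

lemma km_lower: "\<kappa> ^ 3 \<le> km x y"
proof -
  have "\<kappa> * \<kappa> * \<kappa> \<le> a x * a y * kc x y"
    using a_bounds \<kappa>_le \<kappa>_pos a_pos[of x] a_pos[of y]
    by (intro mult_mono) (auto intro: less_imp_le)
  then show ?thesis by (simp add: km_eq power3_eq_cube)
qed

text \<open>Subtracting the lower bound \<open>\<kappa>\<^sup>3\<close> of the Markov kernel leaves mass \<open>1 - \<kappa>\<^sup>3\<close> (Doeblin).\<close>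

lemma Doeblin:
  assumes w: "continuous_on UNIV w" "\<And>x. \<bar>w x\<bar> \<le> S"
  shows "\<bar>K w y - \<kappa> ^ 3 * (\<integral>x. w x \<partial>M)\<bar> \<le> (1 - \<kappa> ^ 3) * S"
proof -
  have cont: "continuous_on UNIV (\<lambda>x. km x y)"
    unfolding k_mu_def by (intro continuous_intros continuous_a continuous_kernel)
  note int = integrable_continuous[OF compact]
  have "K w y - \<kappa> ^ 3 * (\<integral>x. w x \<partial>M) = (\<integral>x. w x * (km x y - \<kappa> ^ 3) \<partial>M)"
    using int[OF continuous_on_mult[OF w(1) cont]] int[OF w(1)]
    by (simp add: K_mu_def right_diff_distrib mult.commute)
  then have "\<bar>K w y - \<kappa> ^ 3 * (\<integral>x. w x \<partial>M)\<bar> \<le> S * (\<integral>x. \<bar>km x y - \<kappa> ^ 3\<bar> \<partial>M)"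
    using abs_integral_mult_le[OF compact w(1) _ w(2), of "\<lambda>x. km x y - \<kappa> ^ 3"]
      int[OF cont] by simp
  also have "(\<integral>x. \<bar>km x y - \<kappa> ^ 3\<bar> \<partial>M) = (\<integral>x. km x y - \<kappa> ^ 3 \<partial>M)"
    using km_lower by (intro Bochner_Integration.integral_cong) auto
  also have "\<dots> = 1 - \<kappa> ^ 3"
    using K_const[of 1] int[OF cont] prob_space by (simp add: K_mu_def fun_eq_iff)
  finally show ?thesis by (simp add: mult.commute)
qed

lemma K_contraction:
  assumes w: "continuous_on UNIV w" "\<And>x. \<bar>w x\<bar> \<le> S" "(\<integral>x. w x \<partial>M) = 0"
  shows "\<bar>K w y\<bar> \<le> (1 - \<kappa> ^ 3) * S"
  using Doeblin[OF w(1,2), of y] w(3) by simp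

lemma \<kappa>3: "0 \<le> 1 - \<kappa> ^ 3" "1 - \<kappa> ^ 3 < 1"
  using \<kappa>_pos \<kappa>_le_1 by (auto intro: power_le_one)

text \<open>After subtracting the mean, two contractions bound the supremum \<open>S\<close> by
  \<open>(1 - \<kappa> ^ 3)\<^sup>2 * S\<close>. The version for the square serves both quotients,
  since a fixed point of \<open>K\<close> is also one of its square.\<close>

lemma K_square_fixed_imp_const:
  assumes w: "continuous_on UNIV w" and fixed: "K (K w) = w"
  shows "w = (\<lambda>_. \<integral>x. w x \<partial>M)"
proof -
  define m where "m = (\<integral>x. w x \<partial>M)"
  define v where "v = (\<lambda>x. w x - m)"
  have int: "integrable M w" using integrable_continuous[OF compact w] .
  have v: "continuous_on UNIV v" unfolding v_def by (intro continuous_intros w)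
  then have intv: "integrable M v" by (rule integrable_continuous[OF compact])
  have mean: "(\<integral>x. v x \<partial>M) = 0" using int prob_space by (simp add: v_def m_def)
  have Kv: "K v = (\<lambda>x. K w x - m)" using K_diff[OF int, of "\<lambda>_. m"] by (simp add: v_def K_const)
  have "K (K v) = (\<lambda>x. K (K w) x - m)"
    using K_diff[of "K w" "\<lambda>_. m"] integrable_continuous[OF compact continuous_mem_km[OF K_mem[OF int]]]
    by (simp add: Kv K_const)
  then have KKv: "K (K v) = v" using fixed by (simp add: v_def)
  obtain B where B: "\<And>x. \<bar>v x\<bar> \<le> B" "0 \<le> B"
    using continuous_imp_bounded_on_compact[OF compact v] by metis
  define S where "S = (SUP x. \<bar>v x\<bar>)"
  have bdd: "bdd_above (range (\<lambda>x. \<bar>v x\<bar>))" using B by (intro bdd_aboveI2)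
  have S: "\<bar>v x\<bar> \<le> S" for x unfolding S_def using bdd by (intro cSUP_upper) auto
  have "\<bar>K v x\<bar> \<le> (1 - \<kappa> ^ 3) * S" for x by (rule K_contraction[OF v S mean])
  moreover have "(\<integral>x. K v x \<partial>M) = 0" using K_integral[OF intv] mean by simp
  ultimately have "\<bar>K (K v) x\<bar> \<le> (1 - \<kappa> ^ 3) * ((1 - \<kappa> ^ 3) * S)" for x
    by (rule K_contraction[OF continuous_mem_km[OF K_mem[OF intv]]])
  then have "S \<le> (1 - \<kappa> ^ 3) * ((1 - \<kappa> ^ 3) * S)"
    unfolding KKv S_def[symmetric] by (subst (1) S_def) (intro cSUP_least, auto)
  moreover have "0 \<le> S" using S[of undefined] abs_ge_zero order_trans by blast
  moreover have "(1 - \<kappa> ^ 3) * ((1 - \<kappa> ^ 3) * S) \<le> (1 - \<kappa> ^ 3) * S"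
    using \<kappa>3 \<open>0 \<le> S\<close> by (intro mult_left_mono mult_left_le_one_le) auto
  ultimately have "S = 0" using \<kappa>_pos by (smt (verit) mult_less_cancel_right2 \<kappa>3)
  then have "v x = 0" for x using S[of x] by simp
  then show ?thesis unfolding m_def[symmetric] by (simp add: v_def fun_eq_iff)
qed

text \<open>The rank one correction \<open>\<kappa> ^ 3\<close> times the mean makes the iteration
  contract on all bounded continuous functions, so the Banach fixpoint theorem applies without
  restricting to mean-zero ones.\<close>

lemma Neumann:
  assumes h: "continuous_on UNIV h" and mean: "(\<integral>x. h x \<partial>M) = 0"
  obtains f where "continuous_on UNIV f" "(\<integral>x. f x \<partial>M) = 0" "\<And>x. f x - K f x = h x"
proof -
  have bcont: "g \<in> bcontfun" if "continuous_on UNIV g" for g :: "'a \<Rightarrow> real"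
    using that compact_imp_bounded[OF compact_continuous_image[OF that compact]]
    by (simp add: bcontfun_def)
  have cont: "continuous_on UNIV (apply_bcontfun \<phi>)" for \<phi> :: "('a, real) bcontfun"
    using apply_bcontfun[of \<phi>] by (simp add: bcontfun_def)
  note int = integrable_continuous[OF compact]
  define T where "T \<phi> = (\<lambda>y. h y + K (apply_bcontfun \<phi>) y - \<kappa> ^ 3 * (\<integral>x. apply_bcontfun \<phi> x \<partial>M))" for \<phi>
  have T: "continuous_on UNIV (T \<phi>)" for \<phi>
    unfolding T_def by (intro continuous_intros h continuous_mem_km K_mem int cont)
  then have TB: "apply_bcontfun (Bcontfun (T \<phi>)) = T \<phi>" for \<phi>
    by (intro Bcontfun_inverse bcont)
  have "dist (Bcontfun (T \<phi>)) (Bcontfun (T \<psi>)) \<le> (1 - \<kappa> ^ 3) * dist \<phi> \<psi>" for \<phi> \<psi>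
  proof (rule dist_bound)
    fix y
    have "\<bar>K (\<lambda>x. \<phi> x - \<psi> x) y - \<kappa> ^ 3 * (\<integral>x. \<phi> x - \<psi> x \<partial>M)\<bar> \<le> (1 - \<kappa> ^ 3) * dist \<phi> \<psi>"
      using dist_bounded[of \<phi> _ \<psi>]
      by (intro Doeblin continuous_intros cont) (simp add: dist_real_def)
    then show "dist (apply_bcontfun (Bcontfun (T \<phi>)) y) (apply_bcontfun (Bcontfun (T \<psi>)) y)
        \<le> (1 - \<kappa> ^ 3) * dist \<phi> \<psi>"
      unfolding TB using int[OF cont[of \<phi>]] int[OF cont[of \<psi>]]
      by (simp add: T_def K_diff dist_real_def algebra_simps)
  qed
  then obtain \<phi> where "Bcontfun (T \<phi>) = \<phi>"
    using banach_fix_type[of "1 - \<kappa> ^ 3" "\<lambda>\<phi>. Bcontfun (T \<phi>)"] \<kappa>3 by blast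
  then have fixed: "T \<phi> = apply_bcontfun \<phi>" using TB[of \<phi>] by simp
  have intK: "integrable M (K \<phi>)" by (intro int continuous_mem_km K_mem cont)
  \<comment> \<open>Integrating the fixpoint equation shows that the correction vanishes:
    \<open>h\<close> has mean 0 and \<open>K\<close> preserves integrals.\<close>
  have "(\<integral>x. \<phi> x \<partial>M) = (\<integral>x. T \<phi> x \<partial>M)" by (simp add: fixed)
  also have "\<dots> = (\<integral>x. \<phi> x \<partial>M) - \<kappa> ^ 3 * (\<integral>x. \<phi> x \<partial>M)"
    unfolding T_def using int[OF h] intK mean prob_space K_integral[OF int[OF cont]] by simp
  finally have m0: "(\<integral>x. \<phi> x \<partial>M) = 0" using \<kappa>_pos by simp
  have "\<phi> x - K \<phi> x = h x" for x
    using fun_cong[OF fixed, of x] m0 by (simp add: T_def)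
  then show ?thesis using that[OF cont m0] by blast
qed

end

section \<open>Inverses on quotients and the two metric tensors\<close>

lemma fun_subspace_add: "fun_subspace N \<Longrightarrow> f \<in> N \<Longrightarrow> g \<in> N \<Longrightarrow> (\<lambda>x. f x + g x) \<in> N"
  by (simp add: fun_subspace_def)

lemma fun_subspace_diff:
  assumes "fun_subspace N" "f \<in> N" "g \<in> N"
  shows "(\<lambda>x. f x - g x) \<in> N"
proof -
  have "(\<lambda>x. -1 * g x) \<in> N" using assms by (simp only: fun_subspace_def)
  then have "(\<lambda>x. f x + -1 * g x) \<in> N" using assms by (simp only: fun_subspace_def)
  then show ?thesis by simp
qed

lemma coset_eqI:
  assumes N: "fun_subspace N" and uv: "(\<lambda>x. u x - v x) \<in> N"
  shows "coset V N u = coset V N v"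
proof -
  have "(\<lambda>x. g x - u x) \<in> N \<longleftrightarrow> (\<lambda>x. g x - v x) \<in> N" for g
  proof
    assume "(\<lambda>x. g x - u x) \<in> N"
    from fun_subspace_add[OF N this uv] show "(\<lambda>x. g x - v x) \<in> N" by simp
  next
    assume "(\<lambda>x. g x - v x) \<in> N"
    from fun_subspace_diff[OF N this uv] show "(\<lambda>x. g x - u x) \<in> N" by simp
  qed
  then show ?thesis by (simp add: coset_def)
qed

lemma mem_coset_self: "fun_subspace N \<Longrightarrow> u \<in> V \<Longrightarrow> u \<in> coset V N u"
  by (simp add: coset_def fun_subspace_def)

lemma quot_map_coset:
  assumes N: "fun_subspace N" and u: "u \<in> V"
    and T: "\<And>v. v \<in> V \<Longrightarrow> (\<lambda>x. v x - u x) \<in> N \<Longrightarrow> (\<lambda>x. T v x - T u x) \<in> N"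
  shows "quot_map V N T (coset V N u) = coset V N (T u)"
proof -
  have "coset V N (T v) = coset V N (T u)" if "v \<in> coset V N u" for v
    using that T[of v] by (intro coset_eqI N) (simp add: coset_def)
  then have "quot_map V N T (coset V N u) = (\<Union>v\<in>coset V N u. coset V N (T u))"
    by (simp add: quot_map_def)
  moreover have "coset V N u \<noteq> {}" using mem_coset_self[OF N u] by blast
  ultimately show ?thesis by simp
qed

text \<open>\<open>inv_into\<close> picks some preimage, so the value is pinned down by two facts:
  \<open>f\<close> solves the equation modulo \<open>N\<close>, and every solution for this
  \<open>h\<close> is congruent to \<open>f\<close>.\<close>

lemma quot_inverse_coset:
  assumes N: "fun_subspace N" and f: "f \<in> V"
    and TV: "\<And>u. u \<in> V \<Longrightarrow> T u \<in> V"
    and TN: "\<And>u v. u \<in> V \<Longrightarrow> v \<in> V \<Longrightarrow> (\<lambda>x. u x - v x) \<in> N \<Longrightarrow> (\<lambda>x. T u x - T v x) \<in> N"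
    and Tf: "(\<lambda>x. T f x - h x) \<in> N"
    and inj: "\<And>u. u \<in> V \<Longrightarrow> (\<lambda>x. T u x - h x) \<in> N \<Longrightarrow> (\<lambda>x. u x - f x) \<in> N"
  shows "quot_inverse V N T (coset V N h) = coset V N f"
proof -
  have map: "quot_map V N T (coset V N u) = coset V N (T u)" if "u \<in> V" for u
    using quot_map_coset[OF N that] TN that by blast
  define q where "q = quot_inverse V N T (coset V N h)"
  have "coset V N h = quot_map V N T (coset V N f)"
    using map[OF f] coset_eqI[OF N Tf] by simp
  then have img: "coset V N h \<in> quot_map V N T ` quot V N"
    using f by (auto simp: quot_def)
  have "q \<in> quot V N" "quot_map V N T q = coset V N h"
    using inv_into_into[OF img] f_inv_into_f[OF img] by (simp_all add: q_def quot_inverse_def)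
  then obtain u where u: "u \<in> V" "q = coset V N u" "coset V N (T u) = coset V N h"
    using map by (auto simp: quot_def)
  have "T u \<in> coset V N h"
    using mem_coset_self[OF N TV[OF u(1)]] u(3) by simp
  then have "(\<lambda>x. u x - f x) \<in> N"
    using inj[OF u(1)] by (simp add: coset_def)
  then show ?thesis using coset_eqI[OF N] u(2) by (simp add: q_def)
qed

lemma quot_pairing_coset:
  assumes "fun_subspace N" "f \<in> V" "\<And>g. g \<in> V \<Longrightarrow> (\<lambda>x. g x - f x) \<in> N \<Longrightarrow> \<sigma> g = \<sigma> f"
  shows "quot_pairing \<sigma> (coset V N f) = \<sigma> f"
proof -
  have "\<sigma> ` coset V N f = {\<sigma> f}"
  proof
    show "\<sigma> ` coset V N f \<subseteq> {\<sigma> f}" using assms(3) by (auto simp: coset_def)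
    show "{\<sigma> f} \<subseteq> \<sigma> ` coset V N f" using mem_coset_self[OF assms(1,2)] by blast
  qed
  then show ?thesis by (simp add: quot_pairing_def)
qed

lemma fun_subspace_constants: "fun_subspace constants"
  by (auto simp: fun_subspace_def constants_def)

section \<open>Square integrable functions and almost everywhere constants\<close>

context borel_prob
begin

lemma L2_add: "f \<in> L2 M \<Longrightarrow> g \<in> L2 M \<Longrightarrow> (\<lambda>x. f x + g x) \<in> L2 M"
proof -
  assume "f \<in> L2 M" "g \<in> L2 M"
  then have f: "f \<in> borel_measurable M" "integrable M (\<lambda>x. (f x)\<^sup>2)"
    and g: "g \<in> borel_measurable M" "integrable M (\<lambda>x. (g x)\<^sup>2)" by (auto simp: L2_def)
  have "integrable M (\<lambda>x. (f x + g x)\<^sup>2)"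
  proof (rule Bochner_Integration.integrable_bound)
    show "integrable M (\<lambda>x. 2 * (f x)\<^sup>2 + 2 * (g x)\<^sup>2)" using f g by simp
    show "(\<lambda>x. (f x + g x)\<^sup>2) \<in> borel_measurable M" using f g by measurable
    have "(s + t)\<^sup>2 \<le> 2 * s\<^sup>2 + 2 * t\<^sup>2" for s t :: real
      using zero_le_power2[of "s - t"] by (simp add: power2_sum power2_diff)
    then show "AE x in M. norm ((f x + g x)\<^sup>2) \<le> norm (2 * (f x)\<^sup>2 + 2 * (g x)\<^sup>2)" by simp
  qed
  then show ?thesis using f g by (simp add: L2_def)
qed

lemma L2_scale: "f \<in> L2 M \<Longrightarrow> (\<lambda>x. r * f x) \<in> L2 M"
  by (auto simp: L2_def power_mult_distrib)

lemma L2_const: "(\<lambda>_. r) \<in> L2 M"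
  by (simp add: L2_def)

lemma fun_subspace_L2: "fun_subspace (L2 M)"
  using L2_add L2_scale L2_const by (simp add: fun_subspace_def)

lemma L2_imp_integrable:
  assumes "f \<in> L2 M"
  shows "integrable M f"
proof (rule Bochner_Integration.integrable_bound)
  show "integrable M (\<lambda>x. 1 + (f x)\<^sup>2)" using assms by (simp add: L2_def)
  show "f \<in> borel_measurable M" using assms by (simp add: L2_def)
  have "\<bar>t\<bar> \<le> 1 + t\<^sup>2" for t :: real
    using zero_le_power2[of "\<bar>t\<bar> - 1"] by (simp add: power2_diff)
  then show "AE x in M. norm (f x) \<le> norm (1 + (f x)\<^sup>2)" by simp
qed

lemma continuous_imp_L2:
  assumes "compact (UNIV :: 'a set)" "continuous_on UNIV f"
  shows "f \<in> L2 M"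
  using borel_measurable_continuous[OF assms(2)]
    integrable_continuous[OF assms(1) continuous_on_power[OF assms(2)]]
  by (simp add: L2_def)

lemma fun_subspace_L2_constants: "fun_subspace (L2_constants M)"
  unfolding fun_subspace_def
proof (intro conjI ballI allI)
  show "(\<lambda>_. 0) \<in> L2_constants M" by (auto simp: L2_constants_def L2_const)
  show "(\<lambda>x. f x + g x) \<in> L2_constants M" if fg: "f \<in> L2_constants M" "g \<in> L2_constants M" for f g
  proof -
    obtain r s where "AE x in M. f x = r" "AE x in M. g x = s"
      using fg by (auto simp: L2_constants_def)
    then have "AE x in M. f x + g x = r + s" by eventually_elim simp
    then show ?thesis using fg L2_add by (auto simp: L2_constants_def)
  qed
  show "(\<lambda>x. r * f x) \<in> L2_constants M" if f: "f \<in> L2_constants M" for r f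
  proof -
    obtain s where "AE x in M. f x = s" using f by (auto simp: L2_constants_def)
    then have "AE x in M. r * f x = r * s" by eventually_elim simp
    then show ?thesis using f L2_scale by (auto simp: L2_constants_def)
  qed
qed

end

section \<open>Evaluation of both quadratic forms\<close>

context entropic_measure
begin

lemma integrable_mem_km: "f \<in> rkhs km \<Longrightarrow> integrable M f"
  by (rule integrable_continuous[OF compact continuous_mem_km])

context
  fixes b' h f
  assumes b': "b' \<in> rkhs kc" and mean: "(\<integral>x. a x * b' x \<partial>M) = 0"
    and h_def: "h = (\<lambda>x. a x * b' x)"
    and f_cont: "continuous_on UNIV f" and f_mean: "(\<integral>x. f x \<partial>M) = 0"
    and f_eq: "\<And>x. f x - K f x = h x"
begin

lemma h_mem: "h \<in> rkhs km"
  unfolding h_def using b' by simp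

lemma h_mean: "(\<integral>x. h x \<partial>M) = 0"
  using mean by (simp add: h_def)

lemma f_int: "integrable M f"
  by (rule integrable_continuous[OF compact f_cont])

text \<open>Solving for \<open>f\<close> writes \<open>f / a\<close> as \<open>b'\<close> plus an
  embedding. This places the merely continuous \<open>f\<close> in the RKHS of \<open>km\<close> and
  later evaluates its pairing.\<close>

lemma f_decomp: "f = (\<lambda>x. a x * (b' x + embed M (\<lambda>x. a x * f x) x))"
proof
  show "f x = a x * (b' x + embed M (\<lambda>x. a x * f x) x)" for x
    using f_eq[of x] unfolding h_def K_eq distrib_left by linarith
qed

lemma f_mem: "f \<in> rkhs km"
proof -
  have "embed M (\<lambda>x. a x * f x) \<in> rkhs kc"
    by (intro embed_mem borel_prob_axioms integrable_a_mult f_int)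
  with b' have "(\<lambda>x. b' x + embed M (\<lambda>x. a x * f x) x) \<in> rkhs kc"
    by (rule add_mem)
  then have "(\<lambda>x. a x * (b' x + embed M (\<lambda>x. a x * f x) x)) \<in> rkhs km"
    by (rule a_mult_mem_km)
  then show ?thesis by (subst f_decomp) assumption
qed

lemma Kf: "K f = (\<lambda>x. f x - h x)"
proof
  show "K f x = f x - h x" for x
    using f_eq[of x] by linarith
qed

text \<open>The continuous solution is also the one in L2 modulo constants: the difference of two
  solutions agrees almost everywhere with its image under \<open>K\<close>, which is continuous and
  therefore falls under the uniqueness argument for continuous functions.\<close>

lemma metric_g_tilde_eq:
  "metric_g_tilde \<epsilon> c M b' = \<epsilon> / 2 * ((rkhs_norm kc b')\<^sup>2 + 2 * (\<integral>x. h x * f x \<partial>M))"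
proof -
  let ?T = "\<lambda>f x. f x - K f x"
  note L2c = continuous_imp_L2[OF compact]
  have KL2: "K u \<in> L2 M" if "u \<in> L2 M" for u
    using K_mem[OF L2_imp_integrable[OF that]] by (intro L2c continuous_mem_km)
  note diff = fun_subspace_diff[OF fun_subspace_L2]
  have "quot_inverse (L2 M) (L2_constants M) ?T (coset (L2 M) (L2_constants M) h)
      = coset (L2 M) (L2_constants M) f"
  proof (rule quot_inverse_coset[OF fun_subspace_L2_constants])
    show "f \<in> L2 M" by (rule L2c[OF f_cont])
    show "?T u \<in> L2 M" if "u \<in> L2 M" for u
      using that KL2 by (intro diff)
    show "(\<lambda>x. ?T u x - ?T v x) \<in> L2_constants M"
      if u: "u \<in> L2 M" and v: "v \<in> L2 M" and uv: "(\<lambda>x. u x - v x) \<in> L2_constants M" for u v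
    proof -
      obtain r where r: "AE x in M. u x - v x = r" using uv by (auto simp: L2_constants_def)
      have "K (\<lambda>x. u x - v x) = K (\<lambda>_. r)"
        using r u v by (intro K_cong_AE) (auto simp: L2_def)
      then have K: "K u x - K v x = r" for x
        using K_diff[OF L2_imp_integrable[OF u] L2_imp_integrable[OF v]] K_const[of r]
        by (simp add: fun_eq_iff)
      have "AE x in M. ?T u x - ?T v x = 0"
        using r by eventually_elim (use K in \<open>simp add: algebra_simps\<close>)
      moreover have "(\<lambda>x. ?T u x - ?T v x) \<in> L2 M"
        by (intro diff KL2 u v)
      ultimately show ?thesis by (auto simp: L2_constants_def)
    qed
    show "(\<lambda>x. ?T f x - h x) \<in> L2_constants M"
      using fun_subspace_L2_constants by (simp add: f_eq fun_subspace_def)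
    show "(\<lambda>x. u x - f x) \<in> L2_constants M"
      if u: "u \<in> L2 M" and Tu: "(\<lambda>x. ?T u x - h x) \<in> L2_constants M" for u
    proof -
      define w where "w = (\<lambda>x. u x - f x)"
      have w: "w \<in> L2 M" unfolding w_def by (intro diff u L2c f_cont)
      note wint = L2_imp_integrable[OF w]
      obtain r where r: "AE x in M. ?T u x - h x = r" using Tu by (auto simp: L2_constants_def)
      have Kw: "K w = (\<lambda>x. K u x - K f x)"
        unfolding w_def by (rule K_diff[OF L2_imp_integrable[OF u] f_int])
      have Tw: "AE x in M. w x - K w x = r"
        using r unfolding Kw by eventually_elim (simp add: w_def f_eq[symmetric])
      have Kint: "integrable M (K w)" by (rule L2_imp_integrable[OF KL2[OF w]])
      \<comment> \<open>An equation modulo constants is upgraded to an exact one: \<open>K\<close>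
        preserves integrals, so the constant must be 0.\<close>
      have "r = (\<integral>x. r \<partial>M)" using prob_space by simp
      also have "\<dots> = (\<integral>x. w x - K w x \<partial>M)"
        using Tw wint Kint by (intro integral_cong_AE) auto
      also have "\<dots> = 0" using wint Kint by (simp add: K_integral)
      finally have "r = 0" .
      \<comment> \<open>Applying \<open>K\<close> removes the null set, so \<open>K w\<close> is a
        fixed point everywhere.\<close>
      then have AE: "AE x in M. w x = K w x" using Tw by simp
      then have fix1: "K w = K (K w)"
        using wint Kint by (intro K_cong_AE) auto
      have "K w = (\<lambda>_. \<integral>x. K w x \<partial>M)"
        using fix1 by (intro K_square_fixed_imp_const continuous_mem_km K_mem wint) simp
      then obtain s where "K w = (\<lambda>_. s)" by blast
      then have "AE x in M. w x = s" using AE by simp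
      then show ?thesis using w unfolding w_def[symmetric] by (auto simp: L2_constants_def)
    qed
  qed
  moreover have "quot_pairing (L2_inner M h) (coset (L2 M) (L2_constants M) f) = L2_inner M h f"
  proof (rule quot_pairing_coset[OF fun_subspace_L2_constants L2c[OF f_cont]])
    fix g assume g: "g \<in> L2 M" and gf: "(\<lambda>x. g x - f x) \<in> L2_constants M"
    obtain r where r: "AE x in M. g x - f x = r" using gf by (auto simp: L2_constants_def)
    note hg = integrable_mult_continuous(1)[OF compact continuous_mem_km[OF h_mem]]
    have "(\<integral>x. h x * g x \<partial>M) - (\<integral>x. h x * f x \<partial>M) = (\<integral>x. h x * g x - h x * f x \<partial>M)"
      using hg[OF L2_imp_integrable[OF g]] hg[OF f_int] by simp
    also have "\<dots> = (\<integral>x. h x * r \<partial>M)"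
    proof (rule integral_cong_AE)
      show "AE x in M. h x * g x - h x * f x = h x * r"
        using r by eventually_elim (simp add: right_diff_distrib[symmetric])
    qed (use hg[OF L2_imp_integrable[OF g]] hg[OF f_int] integrable_mem_km[OF h_mem] in auto)
    also have "\<dots> = 0" using h_mean by simp
    finally show "L2_inner M h g = L2_inner M h f" by (simp add: L2_inner_def)
  qed
  ultimately show ?thesis
    by (simp add: metric_g_tilde_def Let_def h_def[symmetric] L2_inner_def)
qed

text \<open>\<open>H[\<sigma>] = h + K h = (id - K\<^sup>2) f\<close>, so the solution \<open>f\<close> of \<open>(id - K) f = h\<close> serves both metrics.\<close>

lemma metric_g_eq:
  assumes \<sigma>: "\<And>g. g \<in> rkhs kc \<Longrightarrow>
    \<sigma> (\<lambda>x. a x * g x) = rkhs_inner kc b' g + (\<integral>x. h x * (a x * g x) \<partial>M)"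
  shows "metric_g \<epsilon> c M \<sigma> = \<epsilon> / 2 * ((rkhs_norm kc b')\<^sup>2 + 2 * (\<integral>x. h x * f x \<partial>M))"
proof -
  let ?T = "\<lambda>f x. f x - K (K f) x"
  have \<sigma>': "\<sigma> u = rkhs_inner kc b' (\<lambda>x. u x / a x) + (\<integral>x. h x * u x \<partial>M)" if "u \<in> rkhs km" for u
    using \<sigma>[of "\<lambda>x. u x / a x"] that by (simp add: rkhs_km)
  have H: "H_mu \<epsilon> c M \<sigma> = (\<lambda>y. h y + K h y)"
  proof
    fix y
    have "H_mu \<epsilon> c M \<sigma> y = \<sigma> (\<lambda>x. a x * (a y * kc x y))"
      by (simp add: H_mu_def k_mu_def mult_ac)
    also have "\<dots> = rkhs_inner kc b' (\<lambda>x. a y * kc y x) + (\<integral>x. h x * (a x * (a y * kc x y)) \<partial>M)"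
      by (simp add: \<sigma> k_sym[of y])
    also have "(\<integral>x. h x * (a x * (a y * kc x y)) \<partial>M) = K h y"
      by (simp add: K_mu_def k_mu_def mult_ac)
    also have "rkhs_inner kc b' (\<lambda>x. a y * kc y x) = h y"
      using b' by (simp add: scale_right reproducing h_def)
    finally show "H_mu \<epsilon> c M \<sigma> y = h y + K h y" .
  qed
  have Kint: "integrable M (K u)" if "u \<in> rkhs km" for u
    by (intro integrable_mem_km K_mem that)
  have KK: "K (K (\<lambda>x. u x - v x)) = (\<lambda>x. K (K u) x - K (K v) x)"
    if "u \<in> rkhs km" "v \<in> rkhs km" for u v
    using that by (simp add: K_diff integrable_mem_km Kint)
  have "quot_inverse (rkhs km) constants ?T (coset (rkhs km) constants (H_mu \<epsilon> c M \<sigma>))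
      = coset (rkhs km) constants f"
  proof (rule quot_inverse_coset[OF fun_subspace_constants f_mem])
    show "?T u \<in> rkhs km" if "u \<in> rkhs km" for u
      using that by (intro km.diff_mem K_mem Kint)
    show "(\<lambda>x. ?T u x - ?T v x) \<in> constants"
      if u: "u \<in> rkhs km" and v: "v \<in> rkhs km" and uv: "(\<lambda>x. u x - v x) \<in> constants" for u v
    proof -
      obtain r where r: "(\<lambda>x. u x - v x) = (\<lambda>_. r)" using uv by (auto simp: constants_def)
      have "(\<lambda>x. K (K u) x - K (K v) x) = (\<lambda>_. r)"
        using KK[OF u v] by (simp add: r K_const)
      then have "?T u x - ?T v x = 0" for x
        using r by (simp add: fun_eq_iff algebra_simps)
      then show ?thesis by (auto simp: constants_def)
    qed
    \<comment> \<open>Hence \<open>f - K (K f) = (f - K f) + K h = h + K h\<close>, which is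
      \<open>H_mu\<close> of \<sigma>.\<close>
    have "K (K f) = (\<lambda>x. K f x - K h x)"
      by (subst Kf, intro K_diff integrable_mem_km f_mem h_mem)
    then have "?T f x - H_mu \<epsilon> c M \<sigma> x = 0" for x
      by (simp add: H f_eq[of x, symmetric])
    then show "(\<lambda>x. ?T f x - H_mu \<epsilon> c M \<sigma> x) \<in> constants"
      by (auto simp: constants_def)
    show "(\<lambda>x. u x - f x) \<in> constants"
      if u: "u \<in> rkhs km" and Tu: "(\<lambda>x. ?T u x - H_mu \<epsilon> c M \<sigma> x) \<in> constants" for u
    proof -
      define w where "w = (\<lambda>x. u x - f x)"
      have w: "w \<in> rkhs km" unfolding w_def by (intro km.diff_mem u f_mem)
      obtain r where r: "\<And>x. ?T u x - H_mu \<epsilon> c M \<sigma> x = r"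
        using Tu by (auto simp: constants_def fun_eq_iff)
      have Tw: "w x - K (K w) x = r" for x
        using r[of x] \<open>?T f x - H_mu \<epsilon> c M \<sigma> x = 0\<close> KK[OF u f_mem] by (simp add: w_def)
      have intw: "integrable M w" "integrable M (K w)" "integrable M (K (K w))"
        using w by (auto intro!: integrable_mem_km K_mem)
      have "r = (\<integral>x. w x - K (K w) x \<partial>M)" unfolding Tw using prob_space by simp
      also have "\<dots> = 0" using intw by (simp add: K_integral)
      finally have "K (K w) = w" using Tw by (simp add: fun_eq_iff)
      then have "w = (\<lambda>_. \<integral>x. w x \<partial>M)"
        by (intro K_square_fixed_imp_const continuous_mem_km w)
      then show ?thesis unfolding w_def[symmetric] constants_def by blast
    qed
  qed
  moreover have "quot_pairing \<sigma> (coset (rkhs km) constants f) = \<sigma> f"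
  proof (rule quot_pairing_coset[OF fun_subspace_constants f_mem])
    fix g assume g: "g \<in> rkhs km" and "(\<lambda>x. g x - f x) \<in> constants"
    then obtain r where r: "\<And>x. g x - f x = r" by (auto simp: constants_def fun_eq_iff)
    \<comment> \<open>Division by \<open>a\<close> turns a constant into a multiple of
      \<open>b\<close>, to which \<open>b'\<close> is orthogonal.\<close>
    have "g x / a x - f x / a x = r * b x" for x
      unfolding diff_divide_distrib[symmetric] r b_properties(3) by simp
    then have "(\<lambda>x. g x / a x - f x / a x) = (\<lambda>x. r * b x)" by (rule ext)
    then have "rkhs_inner kc b' (\<lambda>x. g x / a x) - rkhs_inner kc b' (\<lambda>x. f x / a x)
        = rkhs_inner kc b' (\<lambda>x. r * b x)"
      using diff_right[of "\<lambda>x. g x / a x" "\<lambda>x. f x / a x" b'] g f_mem b' by (simp add: rkhs_km)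
    also have "\<dots> = r * rkhs_inner kc b b'"
      using b' by (simp add: scale_right sym[of b' b])
    also have "\<dots> = 0" using mean b' by (simp add: inner_b)
    finally have 1: "rkhs_inner kc b' (\<lambda>x. g x / a x) = rkhs_inner kc b' (\<lambda>x. f x / a x)" by simp
    note hg = integrable_mult_continuous(1)[OF compact continuous_mem_km[OF h_mem] integrable_mem_km]
    have "(\<integral>x. h x * g x \<partial>M) - (\<integral>x. h x * f x \<partial>M) = (\<integral>x. h x * g x - h x * f x \<partial>M)"
      using hg[OF g] hg[OF f_mem] by simp
    also have "\<dots> = (\<integral>x. h x * r \<partial>M)"
      by (simp add: right_diff_distrib[symmetric] r)
    also have "\<dots> = 0" using h_mean by simp
    finally show "\<sigma> g = \<sigma> f" using 1 by (simp add: \<sigma>' g f_mem)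
  qed
  \<comment> \<open>The factor 2 arises here: the integral of \<open>h * f\<close> occurs once
    explicitly in \<sigma> and once more from the embedding part of \<open>f / a\<close> in the
    inner product.\<close>
  moreover have "\<sigma> f = (rkhs_norm kc b')\<^sup>2 + 2 * (\<integral>x. h x * f x \<partial>M)"
  proof -
    let ?e = "embed M (\<lambda>x. a x * f x)"
    have e: "?e \<in> rkhs kc" by (intro embed_mem borel_prob_axioms integrable_a_mult f_int)
    have "(\<lambda>x. f x / a x) = (\<lambda>x. b' x + ?e x)"
      by (subst f_decomp) simp
    then have "rkhs_inner kc b' (\<lambda>x. f x / a x) = rkhs_inner kc b' b' + rkhs_inner kc ?e b'"
      using b' e by (simp add: add_right sym[of b' ?e])
    also have "rkhs_inner kc ?e b' = (\<integral>x. a x * f x * b' x \<partial>M)"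
      by (intro inner_embed borel_prob_axioms integrable_a_mult f_int b')
    also have "\<dots> = (\<integral>x. h x * f x \<partial>M)" by (simp add: h_def mult_ac)
    finally show ?thesis
      using \<sigma>'[OF f_mem] nm_power2[OF b'] by (simp add: nm_eq)
  qed
  ultimately show ?thesis by (simp add: metric_g_def Let_def)
qed

end

lemma metric_g_eq_metric_g_tilde:
  assumes b': "b' \<in> rkhs kc" and mean: "(\<integral>x. a x * b' x \<partial>M) = 0"
    and \<sigma>: "\<And>g. g \<in> rkhs kc \<Longrightarrow>
      \<sigma> (\<lambda>x. a x * g x) = rkhs_inner kc b' g + (\<integral>x. a x * b' x * (a x * g x) \<partial>M)"
  shows "metric_g \<epsilon> c M \<sigma> = metric_g_tilde \<epsilon> c M b'"
proof -
  have "continuous_on UNIV (\<lambda>x. a x * b' x)"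
    by (intro continuous_mem_km a_mult_mem_km b')
  then obtain f where f: "continuous_on UNIV f" "(\<integral>x. f x \<partial>M) = 0" "\<And>x. f x - K f x = a x * b' x"
    using Neumann mean by blast
  show ?thesis
    using metric_g_eq[OF b' mean refl f \<sigma>] metric_g_tilde_eq[OF b' mean refl f] by simp
qed

end

section \<open>Differentiability of the path of measures\<close>

context entropic_measure
begin

text \<open>The measure \<open>a M\<close> has mass at most \<open>1 / \<kappa>\<close>, a bound
  common to all measures of a path.\<close>

lemma abs_integral_a_mult_le:
  assumes w: "continuous_on UNIV w" "\<And>x. \<bar>w x\<bar> \<le> S"
  shows "\<bar>\<integral>x. a x * w x \<partial>M\<bar> \<le> S / \<kappa>"
proof -
  have S: "0 \<le> S" using w(2) abs_ge_zero order_trans by blast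
  have "\<bar>\<integral>x. a x * w x \<partial>M\<bar> \<le> S * (\<integral>x. \<bar>a x\<bar> \<partial>M)"
    using abs_integral_mult_le[OF compact w(1) integrable_a w(2)] by (simp add: mult.commute)
  also have "\<dots> \<le> S * (\<integral>x. 1 / \<kappa> \<partial>M)"
    using a_bounds a_pos integrable_a S
    by (intro mult_left_mono integral_mono) (auto simp: abs_of_pos)
  finally show ?thesis using prob_space by simp
qed

text \<open>\<open>N\<close> may differ from the measure defining \<open>km\<close>: every measure
  of the path acts on the one RKHS attached to time 0.\<close>

lemma integral_functional_in_dual:
  assumes N: "borel_prob N" and w: "integrable N w"
  shows "(\<lambda>u. if u \<in> rkhs km then \<integral>x. w x * u x \<partial>N else 0) \<in> rkhs_dual km"
proof -
  interpret N: borel_prob N by (rule N)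
  obtain C where C: "0 \<le> C" "\<And>f x. f \<in> rkhs kc \<Longrightarrow> \<bar>f x\<bar> \<le> C * nm f"
    by (rule sup_bound) blast
  have int: "integrable N (\<lambda>x. w x * u x)" if "u \<in> rkhs km" for u
    using N.integrable_mult_continuous(2)[OF compact continuous_mem_km[OF that] w] .
  have "\<bar>\<integral>x. w x * u x \<partial>N\<bar> \<le> (1 / \<kappa> * C * (\<integral>x. \<bar>w x\<bar> \<partial>N)) * rkhs_norm km u"
    if u: "u \<in> rkhs km" for u
  proof -
    have bound: "\<bar>u x\<bar> \<le> 1 / \<kappa> * (C * rkhs_norm km u)" for x
    proof -
      have "\<bar>u x\<bar> = a x * \<bar>u x / a x\<bar>" using a_pos[of x] by simp
      also have "\<dots> \<le> 1 / \<kappa> * (C * nm (\<lambda>x. u x / a x))"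
        using C(2)[of "\<lambda>x. u x / a x" x] u a_bounds(2) \<kappa>_pos
        by (intro mult_mono) (auto simp: rkhs_km)
      finally show ?thesis by (simp add: rkhs_norm_km[OF u] nm_eq)
    qed
    show ?thesis
      using N.abs_integral_mult_le[OF compact continuous_mem_km[OF u] w bound] by (simp add: mult_ac)
  qed
  then have "\<exists>C. \<forall>u\<in>rkhs km. \<bar>\<integral>x. w x * u x \<partial>N\<bar> \<le> C * rkhs_norm km u"
    by blast
  then show ?thesis
    unfolding dual_def using int by (auto simp: distrib_left mult.left_commute[of _ "_ :: real"])
qed

end

context entropic_kernel
begin

context
  fixes I :: "real set" and \<mu> :: "real \<Rightarrow> 'a measure" and \<beta>' :: "'a \<Rightarrow> real"
  assumes universal: "universal_kernel (k_c \<epsilon> c)"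
    and \<mu>: "\<And>t. t \<in> I \<Longrightarrow> borel_prob (\<mu> t)"
    and deriv: "has_weak_derivative (rkhs (k_c \<epsilon> c)) (rkhs_norm (k_c \<epsilon> c)) I
      (\<lambda>t. B_map \<epsilon> c (\<mu> t)) 0 \<beta>'"
begin

lemma zero_mem_I: "0 \<in> I" and \<beta>'_mem: "\<beta>' \<in> rkhs (k_c \<epsilon> c)"
  using deriv by (auto simp: has_weak_derivative_def)

lemma entropic_measure_path: "t \<in> I \<Longrightarrow> entropic_measure \<epsilon> c \<kappa> (\<mu> t)"
  using \<mu> entropic_kernel_axioms by (simp add: entropic_measure_def)

text \<open>Multiplying by \<open>1 = a\<^sub>s b\<^sub>s\<close> and inserting \<open>b\<^sub>s = b\<^sub>0 + s q\<close> replaces \<open>a\<^sub>0\<close> by \<open>a\<^sub>s\<close> under the integral,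
  which leaves only the inner product with \<open>q\<close> and an integral against \<open>a\<^sub>s \<mu>\<^sub>s\<close>, a measure that converges weakly.\<close>

lemma difference_quotient_identity:
  assumes s: "s \<in> I" "s \<noteq> 0" and g: "g \<in> rkhs (k_c \<epsilon> c)"
    and q_def: "q = (\<lambda>x. (B_map \<epsilon> c (\<mu> s) x - B_map \<epsilon> c (\<mu> 0) x) / s)"
  shows "((\<integral>x. a_mu \<epsilon> c (\<mu> 0) x * g x \<partial>\<mu> s) - (\<integral>x. a_mu \<epsilon> c (\<mu> 0) x * g x \<partial>\<mu> 0)) / s
    = rkhs_inner (k_c \<epsilon> c) q g
      + (\<integral>x. a_mu \<epsilon> c (\<mu> s) x * (a_mu \<epsilon> c (\<mu> 0) x * g x * q x) \<partial>\<mu> s)"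
proof -
  interpret S: entropic_measure \<epsilon> c \<kappa> "\<mu> s" by (rule entropic_measure_path[OF s(1)])
  interpret Z: entropic_measure \<epsilon> c \<kappa> "\<mu> 0" by (rule entropic_measure_path[OF zero_mem_I])
  have q: "q \<in> rkhs (k_c \<epsilon> c)"
    using scale_mem[OF diff_mem[OF S.b_mem Z.b_mem], of "1 / s"] by (simp add: q_def)
  have "Z.a x * g x = S.a x * g x + s * (S.a x * (Z.a x * g x * q x))" for x
  proof -
    have "Z.a x * g x = S.a x * S.b x * Z.a x * g x" by simp
    also have "S.b x = Z.b x + s * q x" using s by (simp add: q_def)
    also have "S.a x * (Z.b x + s * q x) * Z.a x * g x
        = S.a x * g x * (Z.a x * Z.b x) + s * (S.a x * (Z.a x * g x * q x))"
      by (simp only: distrib_left distrib_right mult_ac)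
    finally show ?thesis unfolding Z.a_mult_b mult_1_right .
  qed
  then have "(\<integral>x. Z.a x * g x \<partial>\<mu> s)
      = (\<integral>x. S.a x * g x + s * (S.a x * (Z.a x * g x * q x)) \<partial>\<mu> s)"
    by (intro Bochner_Integration.integral_cong refl)
  also have "\<dots> = (\<integral>x. S.a x * g x \<partial>\<mu> s) + s * (\<integral>x. S.a x * (Z.a x * g x * q x) \<partial>\<mu> s)"
  proof -
    have "integrable (\<mu> s) (\<lambda>x. S.a x * g x)"
      "integrable (\<mu> s) (\<lambda>x. S.a x * (Z.a x * g x * q x))"
      using continuous_mem[OF g] continuous_mem[OF q]
      by (intro S.integrable_continuous compact continuous_intros S.continuous_a Z.continuous_a; simp)+
    then show ?thesis by simp
  qed
  also have "(\<integral>x. S.a x * g x \<partial>\<mu> s) = rkhs_inner (k_c \<epsilon> c) S.b g"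
    by (rule S.inner_b[OF g, symmetric])
  finally have "(\<integral>x. Z.a x * g x \<partial>\<mu> s) - (\<integral>x. Z.a x * g x \<partial>\<mu> 0)
      = rkhs_inner (k_c \<epsilon> c) S.b g - rkhs_inner (k_c \<epsilon> c) Z.b g
        + s * (\<integral>x. S.a x * (Z.a x * g x * q x) \<partial>\<mu> s)"
    using Z.inner_b[OF g] by simp
  moreover have "rkhs_inner (k_c \<epsilon> c) q g = (rkhs_inner (k_c \<epsilon> c) S.b g - rkhs_inner (k_c \<epsilon> c) Z.b g) / s"
    using scale_left[OF diff_mem[OF S.b_mem Z.b_mem] g, of "1 / s"] g by (simp add: q_def diff_left)
  ultimately show ?thesis using s(2) by (simp add: add_divide_distrib)
qed

text \<open>Restricting the limit to sequences produces a countable family of quotients; weak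
  convergence bounds their norms, and this bound upgrades pointwise to uniform convergence.\<close>

lemma pairing_derivative:
  assumes g: "g \<in> rkhs (k_c \<epsilon> c)"
  shows "((\<lambda>s. ((\<integral>x. a_mu \<epsilon> c (\<mu> 0) x * g x \<partial>\<mu> s) - (\<integral>x. a_mu \<epsilon> c (\<mu> 0) x * g x \<partial>\<mu> 0)) / (s - 0))
    \<longlongrightarrow> rkhs_inner (k_c \<epsilon> c) \<beta>' g
      + (\<integral>x. a_mu \<epsilon> c (\<mu> 0) x * \<beta>' x * (a_mu \<epsilon> c (\<mu> 0) x * g x) \<partial>\<mu> 0)) (at 0 within I)"
  unfolding tendsto_at_iff_sequentially
proof (intro allI impI)
  fix X :: "nat \<Rightarrow> real" assume "\<forall>i. X i \<in> I - {0}" and X0: "X \<longlonglongrightarrow> 0"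
  then have XI: "X n \<in> I" "X n \<noteq> 0" for n by auto
  interpret Z: entropic_measure \<epsilon> c \<kappa> "\<mu> 0" by (rule entropic_measure_path[OF zero_mem_I])
  define q where "q n = (\<lambda>x. (B_map \<epsilon> c (\<mu> (X n)) x - Z.b x) / X n)" for n
  define A where "A n w = (\<integral>x. a_mu \<epsilon> c (\<mu> (X n)) x * w x \<partial>\<mu> (X n))" for n w
  define A0 where "A0 w = (\<integral>x. Z.a x * w x \<partial>\<mu> 0)" for w
  have b_mem: "B_map \<epsilon> c (\<mu> (X n)) \<in> rkhs (k_c \<epsilon> c)" for n
    using B_map_properties(1)[OF \<mu>[OF XI(1)]] .
  have q: "q n \<in> rkhs (k_c \<epsilon> c)" for n
    using scale_mem[OF diff_mem[OF b_mem[of n] Z.b_mem], of "1 / X n"] by (simp add: q_def)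
  have weak: "(\<lambda>n. rkhs_inner (k_c \<epsilon> c) (q n) u) \<longlonglongrightarrow> rkhs_inner (k_c \<epsilon> c) \<beta>' u"
    if u: "u \<in> rkhs (k_c \<epsilon> c)" for u
  proof -
    have "((\<lambda>s. rkhs_inner (k_c \<epsilon> c) u (\<lambda>b. (B_map \<epsilon> c (\<mu> s) b - B_map \<epsilon> c (\<mu> 0) b) / (s - 0)))
        \<longlongrightarrow> rkhs_inner (k_c \<epsilon> c) u \<beta>') (at 0 within I)"
      by (rule has_weak_derivative_inner[OF deriv[folded nm_eq] u])
    then have "(\<lambda>n. rkhs_inner (k_c \<epsilon> c) u (q n)) \<longlonglongrightarrow> rkhs_inner (k_c \<epsilon> c) u \<beta>'"
      unfolding tendsto_at_iff_sequentially using XI X0 by (auto simp: o_def q_def)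
    then show ?thesis using u q \<beta>'_mem by (simp add: sym[of u])
  qed
  obtain C where C: "\<And>n. nm (q n) \<le> C"
    by (rule uniform_boundedness[OF q]) (auto intro!: convergent_imp_Bseq convergentI weak)
  have q_lim: "(\<lambda>n. q n x) \<longlonglongrightarrow> \<beta>' x" for x
    using weak[of "k_c \<epsilon> c x"] q \<beta>'_mem by (simp add: reproducing)
  have unif: "\<forall>\<^sub>F n in sequentially. \<forall>x. \<bar>q n x - \<beta>' x\<bar> < e" if "e > 0" for e
    by (rule uniform_of_pointwise[OF q \<beta>'_mem C q_lim that])
  have A_bound: "\<bar>A n w\<bar> \<le> S / \<kappa>" if "continuous_on UNIV w" "\<And>x. \<bar>w x\<bar> \<le> S" for n w S
    unfolding A_def
    using entropic_measure.abs_integral_a_mult_le[OF entropic_measure_path[OF XI(1)]] that by blast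
  have A0_bound: "\<bar>A0 w\<bar> \<le> S / \<kappa>" if "continuous_on UNIV w" "\<And>x. \<bar>w x\<bar> \<le> S" for w S
    unfolding A0_def using Z.abs_integral_a_mult_le that by blast
  have A_diff: "A n (\<lambda>x. v x - w x) = A n v - A n w"
    if "continuous_on UNIV v" "continuous_on UNIV w" for n v w
  proof -
    interpret S: entropic_measure \<epsilon> c \<kappa> "\<mu> (X n)" by (rule entropic_measure_path[OF XI(1)])
    have "integrable (\<mu> (X n)) (\<lambda>x. S.a x * v x)" "integrable (\<mu> (X n)) (\<lambda>x. S.a x * w x)"
      using S.integrable_a_mult S.integrable_continuous[OF compact] that by blast+
    then show ?thesis by (simp add: A_def right_diff_distrib)
  qed
  have A0_diff: "A0 (\<lambda>x. v x - w x) = A0 v - A0 w"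
    if "continuous_on UNIV v" "continuous_on UNIV w" for v w
  proof -
    have "integrable (\<mu> 0) (\<lambda>x. Z.a x * v x)" "integrable (\<mu> 0) (\<lambda>x. Z.a x * w x)"
      using Z.integrable_a_mult Z.integrable_continuous[OF compact] that by blast+
    then show ?thesis by (simp add: A0_def right_diff_distrib)
  qed
  \<comment> \<open>On the RKHS, \<open>A n\<close> is the inner product with the scaling at
    \<open>X n\<close>, which differs from the one at 0 by \<open>X n\<close> times the quotient
    \<open>q n\<close>.\<close>
  have A_rkhs: "(\<lambda>n. A n u) \<longlonglongrightarrow> A0 u" if u: "u \<in> rkhs (k_c \<epsilon> c)" for u
  proof -
    have "A n u = A0 u + X n * rkhs_inner (k_c \<epsilon> c) (q n) u" for n
    proof -
      interpret S: entropic_measure \<epsilon> c \<kappa> "\<mu> (X n)" by (rule entropic_measure_path[OF XI(1)])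
      have "rkhs_inner (k_c \<epsilon> c) (q n) u = (rkhs_inner (k_c \<epsilon> c) S.b u - rkhs_inner (k_c \<epsilon> c) Z.b u) / X n"
        using scale_left[OF diff_mem[OF S.b_mem Z.b_mem] u, of "1 / X n"] u by (simp add: q_def diff_left)
      then show ?thesis
        using XI(2)[of n] by (simp add: A_def A0_def S.inner_b[OF u] Z.inner_b[OF u])
    qed
    moreover have "(\<lambda>n. A0 u + X n * rkhs_inner (k_c \<epsilon> c) (q n) u)
        \<longlonglongrightarrow> A0 u + 0 * rkhs_inner (k_c \<epsilon> c) \<beta>' u"
      by (intro tendsto_intros X0 weak u)
    ultimately show ?thesis by simp
  qed
  have A_lim: "(\<lambda>n. A n w) \<longlonglongrightarrow> A0 w" if w: "continuous_on UNIV w" for w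
  proof (rule LIMSEQ_I)
    fix e :: real assume "e > 0"
    \<comment> \<open>The masses are at most \<open>1 / \<kappa>\<close>, so replacing
      \<open>w\<close> by \<open>u\<close> costs at most \<open>e / 3\<close> for
      \<open>A n\<close>, uniformly in \<open>n\<close>, and for \<open>A0\<close>.\<close>
    define d where "d = e * \<kappa> / 3"
    have d: "d > 0" "d / \<kappa> = e / 3" using \<open>e > 0\<close> \<kappa>_pos by (auto simp: d_def)
    then obtain u where u: "u \<in> rkhs (k_c \<epsilon> c)" "\<And>x. \<bar>u x - w x\<bar> < d"
      using universal w unfolding universal_kernel_def by blast
    note cont = continuous_on_diff[OF continuous_mem[OF u(1)] w]
    have le: "\<bar>u x - w x\<bar> \<le> d" for x using u(2)[of x] by simp
    have 1: "\<bar>A n u - A n w\<bar> \<le> e / 3" for n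
      using A_bound[OF cont le, of n] A_diff[OF continuous_mem[OF u(1)] w] d by simp
    have 2: "\<bar>A0 u - A0 w\<bar> \<le> e / 3"
      using A0_bound[OF cont le] A0_diff[OF continuous_mem[OF u(1)] w] d by simp
    obtain N where N: "\<And>n. n \<ge> N \<Longrightarrow> \<bar>A n u - A0 u\<bar> < e / 3"
      using LIMSEQ_D[OF A_rkhs[OF u(1)], of "e / 3"] \<open>e > 0\<close> by auto
    have "norm (A n w - A0 w) < e" if "n \<ge> N" for n
      using 1[of n] 2 N[OF that] unfolding real_norm_def by linarith
    then show "\<exists>N. \<forall>n\<ge>N. norm (A n w - A0 w) < e" by blast
  qed
  define v where "v = (\<lambda>x. Z.a x * g x)"
  have v: "continuous_on UNIV v"
    unfolding v_def by (intro continuous_intros Z.continuous_a continuous_mem[OF g])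
  obtain S where S: "0 \<le> S" "\<And>x. \<bar>v x\<bar> \<le> S"
    using continuous_imp_bounded_on_compact[OF compact v] by blast
  have contq: "continuous_on UNIV (\<lambda>x. v x * q n x)" for n
    by (intro continuous_intros v continuous_mem[OF q])
  have cont\<beta>: "continuous_on UNIV (\<lambda>x. v x * \<beta>' x)"
    by (intro continuous_intros v continuous_mem[OF \<beta>'_mem])
  have "(\<lambda>n. A n (\<lambda>x. v x * q n x) - A n (\<lambda>x. v x * \<beta>' x)) \<longlonglongrightarrow> 0"
  proof (rule LIMSEQ_I)
    fix e :: real assume "e > 0"
    \<comment> \<open>Both the integrand and the measure depend on \<open>n\<close>; the uniform
      mass bound lets \<open>q n\<close> be replaced by its uniform limit first.
      \<open>S + 1\<close> guards against \<open>S = 0\<close>.\<close>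
    define d where "d = e * \<kappa> / (2 * (S + 1))"
    have d: "d > 0" using \<open>e > 0\<close> \<kappa>_pos S(1) by (simp add: d_def)
    have Sd: "S * d / \<kappa> < e"
    proof -
      have "S * d \<le> (S + 1) * d" using d by (intro mult_right_mono) auto
      also have "\<dots> = e * \<kappa> / 2" using S(1) unfolding d_def by (simp add: divide_simps)
      also have "\<dots> < e * \<kappa>" using \<open>e > 0\<close> \<kappa>_pos by simp
      finally show ?thesis using \<kappa>_pos by (simp add: pos_divide_less_eq)
    qed
    obtain N where N: "\<And>n x. n \<ge> N \<Longrightarrow> \<bar>q n x - \<beta>' x\<bar> < d"
      using unif[OF d] by (auto simp: eventually_sequentially)
    have "norm (A n (\<lambda>x. v x * q n x) - A n (\<lambda>x. v x * \<beta>' x) - 0) < e" if n: "n \<ge> N" for n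
    proof -
      have le: "\<bar>v x * q n x - v x * \<beta>' x\<bar> \<le> S * d" for x
        unfolding right_diff_distrib[symmetric] abs_mult
        using S N[OF n, of x] by (intro mult_mono) auto
      show ?thesis
        using A_bound[OF continuous_on_diff[OF contq cont\<beta>] le, of n] A_diff[OF contq cont\<beta>] Sd by simp
    qed
    then show "\<exists>N. \<forall>n\<ge>N. norm (A n (\<lambda>x. v x * q n x) - A n (\<lambda>x. v x * \<beta>' x) - 0) < e" by blast
  qed
  from tendsto_add[OF this A_lim[OF cont\<beta>]]
  have "(\<lambda>n. A n (\<lambda>x. v x * q n x)) \<longlonglongrightarrow> A0 (\<lambda>x. v x * \<beta>' x)" by simp
  then have "(\<lambda>n. rkhs_inner (k_c \<epsilon> c) (q n) g + A n (\<lambda>x. v x * q n x))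
      \<longlonglongrightarrow> rkhs_inner (k_c \<epsilon> c) \<beta>' g + A0 (\<lambda>x. v x * \<beta>' x)"
    by (intro tendsto_add weak g)
  moreover have "((\<integral>x. Z.a x * g x \<partial>\<mu> (X n)) - (\<integral>x. Z.a x * g x \<partial>\<mu> 0)) / (X n - 0)
      = rkhs_inner (k_c \<epsilon> c) (q n) g + A n (\<lambda>x. v x * q n x)" for n
    using difference_quotient_identity[OF XI g q_def] by (simp add: A_def v_def)
  moreover have "A0 (\<lambda>x. v x * \<beta>' x) = (\<integral>x. Z.a x * \<beta>' x * (Z.a x * g x) \<partial>\<mu> 0)"
    by (simp add: A0_def v_def mult_ac)
  ultimately show "((\<lambda>s. ((\<integral>x. Z.a x * g x \<partial>\<mu> s) - (\<integral>x. Z.a x * g x \<partial>\<mu> 0)) / (s - 0)) \<circ> X)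
      \<longlonglongrightarrow> rkhs_inner (k_c \<epsilon> c) \<beta>' g + (\<integral>x. Z.a x * \<beta>' x * (Z.a x * g x) \<partial>\<mu> 0)"
    by (simp add: o_def)
qed

lemma measure_path_weakly_differentiable:
  "rkhs_inner (k_c \<epsilon> c) \<beta>' (B_map \<epsilon> c (\<mu> 0)) = 0 \<and>
    (\<exists>!\<mu>'. has_weak_derivative
              (rkhs_dual (k_mu \<epsilon> c (\<mu> 0))) (rkhs_dual_norm (k_mu \<epsilon> c (\<mu> 0))) I
              (\<lambda>t. measure_functional (k_mu \<epsilon> c (\<mu> 0)) (\<mu> t)) 0 \<mu>') \<and>
    (\<forall>\<mu>'. has_weak_derivative
              (rkhs_dual (k_mu \<epsilon> c (\<mu> 0))) (rkhs_dual_norm (k_mu \<epsilon> c (\<mu> 0))) I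
              (\<lambda>t. measure_functional (k_mu \<epsilon> c (\<mu> 0)) (\<mu> t)) 0 \<mu>' \<longrightarrow>
          \<mu>' \<in> rkhs_dual0 (k_mu \<epsilon> c (\<mu> 0)) \<and>
          metric_g \<epsilon> c (\<mu> 0) \<mu>' = metric_g_tilde \<epsilon> c (\<mu> 0) \<beta>')"
proof -
  interpret Z: entropic_measure \<epsilon> c \<kappa> "\<mu> 0" by (rule entropic_measure_path[OF zero_mem_I])
  let ?D = "\<lambda>\<sigma>. has_weak_derivative (rkhs_dual Z.km) (rkhs_dual_norm Z.km) I
    (\<lambda>t. measure_functional Z.km (\<mu> t)) 0 \<sigma>"
  note D_iff = Z.km.has_weak_derivative_dual_iff[unfolded Z.km_nm_eq]
  define h where "h = (\<lambda>x. Z.a x * \<beta>' x)"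
  have h: "h \<in> rkhs Z.km" unfolding h_def using \<beta>'_mem by simp
  \<comment> \<open>The candidate derivative: \<open>riesz h\<close> in the space of
    \<open>km\<close> is the inner product with \<beta>' transported by multiplication with
    \<open>a\<close>, and both summands vanish off the RKHS.\<close>
  define \<sigma> where "\<sigma> = (\<lambda>u. Z.km.riesz h u + (if u \<in> rkhs Z.km then \<integral>x. h x * u x \<partial>\<mu> 0 else 0))"
  have \<sigma>_dual: "\<sigma> \<in> rkhs_dual Z.km"
    unfolding \<sigma>_def using Z.km.dual_add[unfolded Z.km_nm_eq]
      Z.km.riesz_in_dual[OF h, unfolded Z.km_nm_eq]
      Z.integral_functional_in_dual[OF Z.borel_prob_axioms Z.integrable_mem_km[OF h]] by blast
  have \<sigma>_eq: "\<sigma> (\<lambda>x. Z.a x * g x) = rkhs_inner (k_c \<epsilon> c) \<beta>' g + (\<integral>x. h x * (Z.a x * g x) \<partial>\<mu> 0)"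
    if "g \<in> rkhs (k_c \<epsilon> c)" for g
  proof -
    have "rkhs_inner Z.km h (\<lambda>x. Z.a x * g x) = rkhs_inner (k_c \<epsilon> c) \<beta>' g"
      using rkhs_eqI(2)[OF Z.is_rkhs_km, of h "\<lambda>x. Z.a x * g x"] that \<beta>'_mem by (simp add: h_def)
    then show ?thesis using that by (simp add: \<sigma>_def Z.km.riesz_def)
  qed
  have lim0: "at 0 within I \<noteq> bot"
    using deriv by (simp add: has_weak_derivative_def trivial_limit_within)
  have quot: "((\<lambda>s. (measure_functional Z.km (\<mu> s) u - measure_functional Z.km (\<mu> 0) u) / (s - 0)) \<longlongrightarrow> \<sigma> u)
      (at 0 within I)" if u: "u \<in> rkhs Z.km" for u
  proof -
    have g: "(\<lambda>x. u x / Z.a x) \<in> rkhs (k_c \<epsilon> c)" using u by (simp add: Z.rkhs_km)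
    show ?thesis
      using pairing_derivative[OF g] \<sigma>_eq[OF g] u by (simp add: measure_functional_def h_def)
  qed
  have D\<sigma>: "?D \<sigma>"
    unfolding D_iff
  proof (intro conjI ballI \<sigma>_dual quot)
    show "0 \<in> I" "0 islimpt I" using deriv by (auto simp: has_weak_derivative_def)
    show "measure_functional Z.km (\<mu> s) \<in> rkhs_dual Z.km" if "s \<in> I" for s
    proof -
      interpret N: borel_prob "\<mu> s" by (rule \<mu>[OF that])
      show ?thesis
        using Z.integral_functional_in_dual[OF \<mu>[OF that], of "\<lambda>_. 1"]
        by (simp add: measure_functional_def[abs_def] cong: if_cong)
    qed
  qed
  \<comment> \<open>On the RKHS limits are unique since 0 is an accumulation point of
    \<open>I\<close>; elsewhere both functionals are 0 by totalisation.\<close>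
  have unique: "\<tau> = \<sigma>" if \<tau>: "?D \<tau>" for \<tau>
  proof
    fix u show "\<tau> u = \<sigma> u"
    proof (cases "u \<in> rkhs Z.km")
      case True
      then show ?thesis
        using tendsto_unique[OF lim0 _ quot[OF True]] \<tau> by (auto simp: D_iff)
    next
      case False
      then show ?thesis using \<tau> \<sigma>_dual unfolding D_iff by (auto simp: dual_def)
    qed
  qed
  have "((\<lambda>s. 0) \<longlongrightarrow> \<sigma> (\<lambda>_. 1)) (at 0 within I)"
  proof (rule Lim_transform_eventually[OF quot[OF Z.one_mem_km]])
    show "\<forall>\<^sub>F s in at 0 within I. (measure_functional Z.km (\<mu> s) (\<lambda>_. 1)
        - measure_functional Z.km (\<mu> 0) (\<lambda>_. 1)) / (s - 0) = 0"
      unfolding eventually_at_filter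
      using borel_prob.axioms(1)[OF \<mu>] borel_prob.axioms(1)[OF \<mu>[OF zero_mem_I]]
      by (intro always_eventually) (auto simp: measure_functional_def prob_space.prob_space)
  qed
  then have \<sigma>_one: "\<sigma> (\<lambda>_. 1) = 0"
    using tendsto_unique[OF lim0 _ tendsto_const] by blast
  have inner: "rkhs_inner (k_c \<epsilon> c) \<beta>' Z.b = (\<integral>x. Z.a x * \<beta>' x \<partial>\<mu> 0)"
    using Z.inner_b[OF \<beta>'_mem] sym[OF \<beta>'_mem Z.b_mem] by simp
  \<comment> \<open>Because \<open>a b = 1\<close>, the left side is \<sigma> at the constant 1, and
    the integral on the right is that of \<open>h\<close>, again the inner product of \<beta>' with
    \<open>b\<close>.\<close>
  have "\<sigma> (\<lambda>x. Z.a x * Z.b x) = rkhs_inner (k_c \<epsilon> c) \<beta>' Z.b + (\<integral>x. h x * (Z.a x * Z.b x) \<partial>\<mu> 0)"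
    by (rule \<sigma>_eq) simp
  then have orth: "rkhs_inner (k_c \<epsilon> c) \<beta>' Z.b = 0"
    using \<sigma>_one by (simp add: inner h_def)
  have "metric_g \<epsilon> c (\<mu> 0) \<sigma> = metric_g_tilde \<epsilon> c (\<mu> 0) \<beta>'"
    using orth \<sigma>_eq by (intro Z.metric_g_eq_metric_g_tilde \<beta>'_mem) (simp_all add: inner h_def)
  moreover have "\<sigma> \<in> rkhs_dual0 Z.km"
    using \<sigma>_dual \<sigma>_one by (simp add: rkhs_dual0_def)
  ultimately show ?thesis using orth D\<sigma> unique by blast
qed

end

end

theorem theorem4p12:
  fixes c :: "'a::metric_space \<Rightarrow> 'a \<Rightarrow> real"
    and \<epsilon> :: real
    and I :: "real set"
    and \<mu> :: "real \<Rightarrow> 'a measure"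
    and \<beta>' :: "'a \<Rightarrow> real"
  assumes "compact (UNIV :: 'a set)"
    and "\<epsilon> > 0"
    and "continuous_on UNIV (\<lambda>(x, y). c x y)"
    and "\<And>x y. c x y \<ge> 0"
    and "\<And>x y. c x y = c y x"
    and "positive_definite_kernel (k_c \<epsilon> c)"
    and "universal_kernel (k_c \<epsilon> c)"
    and "\<And>t. t \<in> I \<Longrightarrow> \<mu> t \<in> prob_measures"
    and "has_weak_derivative (rkhs (k_c \<epsilon> c)) (rkhs_norm (k_c \<epsilon> c)) I
           (\<lambda>t. B_map \<epsilon> c (\<mu> t)) 0 \<beta>'"
  shows "rkhs_inner (k_c \<epsilon> c) \<beta>' (B_map \<epsilon> c (\<mu> 0)) = 0 \<and>
    (\<exists>!\<mu>'. has_weak_derivative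
              (rkhs_dual (k_mu \<epsilon> c (\<mu> 0))) (rkhs_dual_norm (k_mu \<epsilon> c (\<mu> 0))) I
              (\<lambda>t. measure_functional (k_mu \<epsilon> c (\<mu> 0)) (\<mu> t)) 0 \<mu>') \<and>
    (\<forall>\<mu>'. has_weak_derivative
              (rkhs_dual (k_mu \<epsilon> c (\<mu> 0))) (rkhs_dual_norm (k_mu \<epsilon> c (\<mu> 0))) I
              (\<lambda>t. measure_functional (k_mu \<epsilon> c (\<mu> 0)) (\<mu> t)) 0 \<mu>' \<longrightarrow>
          \<mu>' \<in> rkhs_dual0 (k_mu \<epsilon> c (\<mu> 0)) \<and>
          metric_g \<epsilon> c (\<mu> 0) \<mu>' = metric_g_tilde \<epsilon> c (\<mu> 0) \<beta>')"
proof -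
  have "compact (UNIV :: ('a \<times> 'a) set)"
    using compact_Times[OF assms(1) assms(1)] by simp
  then obtain C where C: "\<And>p. \<bar>case p of (x, y) \<Rightarrow> c x y\<bar> \<le> C"
    using continuous_imp_bounded_on_compact assms(3) by blast
  have c_le: "c x y \<le> C" for x y using C[of "(x, y)"] by simp
  \<comment> \<open>The cost is bounded by \<open>C\<close> on the compact product, whence the lower
    bound \<open>exp (- C / \<epsilon>)\<close> for the kernel; nonnegativity of the cost gives the
    upper bound 1.\<close>
  have "entropic_kernel \<epsilon> c (exp (- C / \<epsilon>))"
  proof
    show "continuous_on UNIV (\<lambda>(x, y). k_c \<epsilon> c x y)"
      using continuous_on_exp[OF continuous_on_divide[OF continuous_on_minus[OF assms(3)] continuous_on_const, of \<epsilon>]]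
        assms(2) by (simp add: k_c_def case_prod_unfold)
    show "exp (- C / \<epsilon>) \<le> k_c \<epsilon> c x y" "k_c \<epsilon> c x y \<le> 1" for x y
      using c_le[of x y] assms(2) assms(4)[of x y] by (simp_all add: k_c_def divide_right_mono)
  qed (use assms in simp_all)
  then show ?thesis
    using assms(7-9) by (intro entropic_kernel.measure_path_weakly_differentiable) (simp_all add: borel_prob_iff)
qed

end
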